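(* Let $m>1$ be an integer and let $\Gamma=\Gamma(1/4)$. Then there exist rational numbers $r_1,r_2,r_3,r_4,r_5\in\mathbb{Q}$ (depending on $m$) such that $$\Gamma(4m-2)\,\zeta_4(4m-2,\,3\,|\,2+2i,\,2-2i,\,1+i,\,1-i) = r_1\frac{\Gamma^{8m-8}}{\pi^{2m-2}} + \frac{r_2}{\sqrt{2}}\frac{\Gamma^{8m-6}}{\pi^{2m-3/2}} + r_3\frac{\Gamma^{8m-4}}{\pi^{2m-1}} + \frac{r_4}{\sqrt{2}}\frac{\Gamma^{8m-2}}{\pi^{2m+1/2}} + r_5\frac{\Gamma^{8m}}{\pi^{2m+2}},$$ where $\Gamma(4m-2)$ is the value of the Gamma function at $4m-2$ and, on the right-hand side, $\Gamma=\Gamma(1/4)$.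
   Context: For complex numbers $a_1,\ldots,a_N$ with $\Re(a_j)>0$, $\Re(\omega)>0$ and $\Re(s)>N$, the Barnes multiple zeta function is $$\zeta_N(s,\omega\,|\,a_1,\ldots,a_N)=\sum_{n_1,\ldots,n_N\geq 0}\frac{1}{(\omega+n_1a_1+\cdots+n_Na_N)^s}.$$ Euler's Gamma function is $\Gamma(z)=\int_0^\infty e^{-t}t^{z-1}\,dt$ for $\Re(z)>0$. *)

theory Defs
  imports "HOL-Analysis.Analysis"
begin

text \<open>
  The argument \<open>as\<close> is the list \<open>[a\<^sub>1, \<dots>, a\<^sub>N]\<close>, so \<open>N\<close> is its length, and the sum ranges
  over all lists \<open>[n\<^sub>1, \<dots>, n\<^sub>N]\<close> of natural numbers of that length. Powers are
  principal: \<open>z powr s = exp (s * Ln z)\<close>. The value is the intended one for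
  \<open>Re a\<^sub>j > 0\<close>, \<open>Re \<omega> > 0\<close> and \<open>Re s > N\<close>, where the series converges absolutely;
  no analytic continuation in \<open>s\<close> is built in.
\<close>

definition barnes_zeta :: "complex \<Rightarrow> complex \<Rightarrow> complex list \<Rightarrow> complex" where
  "barnes_zeta s \<omega> as =
     (\<Sum>\<^sub>\<infinity>ns\<in>{ns :: nat list. length ns = length as}.
        1 / (\<omega> + (\<Sum>j<length as. of_nat (ns ! j) * as ! j)) powr s)"

end

theory Submission
  imports Defs "HOL-Complex_Analysis.Complex_Analysis"
begin

text \<open>Put s = 4m - 2. The base 3 + n1 (2+2i) + n2 (2-2i) + n3 (1+i) + n4 (1-i) depends only on
  j = 2 n1 + n3 and k = 2 n2 + n4, so the fourfold series is a series over a quadrant of points with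
  odd coordinates 2j+3 and 2k+3, counted with multiplicity (j div 2 + 1)(k div 2 + 1). If the
  coordinates are written as |1+4a| and |1+4b| with nonzero integers a and b, the multiplicity is
  |ab|. Since i^s = -1, rotations by powers of i unfold the quadrant to the whole plane and turn
  |ab| into ab. Hence (\<open>barnes_zeta_eq\<close>) the Barnes value is an element of Q(i) times
  \<open>barnes_lattice_sum\<close>, the sum of (cnj l^2 - l^2) / (z0 - l)^s over the Gaussian
  integers l, at the point z0 = (1-i)/4.

  Centring cnj l at cnj z0 and l at z0 splits this sum (\<open>barnes_lattice_sum_expand\<close>)
  into Eisenstein-Kronecker sums of (cnj l - cnj z0)^a / (z0 - l)^k with a = 0, 1, 2. Let zeta and
  wp be the Weierstrass functions of the lattice. Up to rational factors these sums are Taylor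
  coefficients at z0 of zeta (a = 0), of (zeta^2 - wp)/2 (a = 1) and of (zeta^3 - 3 zeta wp - wp')/6
  (a = 2), with zeta first shifted by the constant pi cnj z0. Each step in a costs a factor 1/pi,
  because Legendre's relation reads zeta(z + mu) = zeta(z) + pi cnj mu
  (\<open>wzeta_translate\<close>, \<open>wQ2_higher_deriv\<close>,
  \<open>wQ3_higher_deriv\<close>).

  Let e = wp(1/2). Since 2 z0 is a half period, wp(z0), wp'(z0) and zeta(z0) - pi cnj z0 are
  elements of Q(i) times e, e^(3/2) and e^(1/2). The equation wp'' = 6 wp^2 - 2 e^2 carries this
  homogeneity to all Taylor coefficients (\<open>homog_wp\<close>, \<open>homog_uQ2\<close>,
  \<open>homog_uQ3\<close>), so the five pieces have weights s-2, ..., s+2 in sqrt e, the last two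
  divided by pi and pi^2. A Beta integral gives e = Gamma(1/4)^4 / (8 pi) (\<open>re_eq\<close>);
  odd powers of sqrt e account for the factors 1/sqrt 2. Finally the Barnes value is real
  (\<open>barnes_zeta_real\<close>), so real parts of the coefficients in Q(i) may be taken, and
  these are rational.\<close>

section \<open>The lattice of Gaussian integers\<close>

definition gint :: "complex set" where
  "gint = {z. Re z \<in> \<int> \<and> Im z \<in> \<int>}"

lemma gint_0 [simp]: "0 \<in> gint"
  and gint_1 [simp]: "1 \<in> gint"
  and gint_ii [simp]: "\<i> \<in> gint"
  by (auto simp: gint_def)

lemma gint_add: "a \<in> gint \<Longrightarrow> b \<in> gint \<Longrightarrow> a + b \<in> gint"
  and gint_diff: "a \<in> gint \<Longrightarrow> b \<in> gint \<Longrightarrow> a - b \<in> gint"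
  by (auto simp: gint_def)

lemma gint_uminus_iff [simp]: "- a \<in> gint \<longleftrightarrow> a \<in> gint"
  by (auto simp: gint_def minus_in_Ints_iff)

lemma gint_ii_times_iff [simp]: "\<i> * a \<in> gint \<longleftrightarrow> a \<in> gint"
  by (auto simp: gint_def minus_in_Ints_iff)

lemma gint_cnj_iff [simp]: "cnj a \<in> gint \<longleftrightarrow> a \<in> gint"
  by (auto simp: gint_def minus_in_Ints_iff)

lemma gint_add_right_iff: "b \<in> gint \<Longrightarrow> a + b \<in> gint \<longleftrightarrow> a \<in> gint"
  using gint_add[of a b] gint_diff[of "a + b" b] by auto

lemma gint_add_left_iff: "a \<in> gint \<Longrightarrow> a + b \<in> gint \<longleftrightarrow> b \<in> gint"
  using gint_add_right_iff[of a b] by (simp add: add.commute)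

lemma gint_diff_right_iff: "b \<in> gint \<Longrightarrow> a - b \<in> gint \<longleftrightarrow> a \<in> gint"
  using gint_add_right_iff[of "-b" a] by simp

lemma bij_betw_gint: "bij_betw (\<lambda>(a, b). Complex (of_int a) (of_int b)) UNIV gint"
proof (rule bij_betwI')
  fix z assume "z \<in> gint"
  then obtain a b where "Re z = of_int a" "Im z = of_int b"
    by (auto simp: gint_def elim!: Ints_cases)
  then have "z = (case (a, b) of (a, b) \<Rightarrow> Complex (of_int a) (of_int b))"
    by (simp add: complex_eq_iff)
  then show "\<exists>x\<in>UNIV. z = (case x of (a, b) \<Rightarrow> Complex (of_int a) (of_int b))" by blast
qed (auto simp: gint_def)

lemma countable_gint: "countable gint"
  using bij_betw_imp_surj_on[OF bij_betw_gint] countable_image[of UNIV] by (metis countableI_type)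

lemma norm_gint_ge_1:
  assumes "l \<in> gint" "l \<noteq> 0"
  shows "norm l \<ge> 1"
proof -
  have "\<bar>Re l\<bar> \<ge> 1 \<or> \<bar>Im l\<bar> \<ge> 1"
    using assms by (auto simp: gint_def complex_eq_iff intro: Ints_nonzero_abs_ge1)
  then show ?thesis
    using abs_Re_le_cmod[of l] abs_Im_le_cmod[of l] by linarith
qed

lemma closed_subset_gint:
  assumes "L \<subseteq> gint"
  shows "closed L"
proof (rule discrete_imp_closed[of 1])
  show "\<forall>x\<in>L. \<forall>y\<in>L. dist y x < 1 \<longrightarrow> y = x"
    using norm_gint_ge_1[OF gint_diff] assms by (force simp: dist_norm)
qed auto

lemma open_Compl_gint: "open (- gint)"
  using closed_subset_gint by (simp add: open_Compl)

lemma connected_Compl_gint: "connected (- gint)"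
  using connected_open_diff_countable[OF _ open_UNIV connected_UNIV countable_gint]
  by (simp add: Compl_eq_Diff_UNIV)

text \<open>Both |a| and |b| are at most |a + ib|, so splitting the exponent as 3/2 + 3/2 dominates
  the terms by a product of two convergent one-dimensional series.\<close>

lemma summable_on_gint: "(\<lambda>l. 1 / (1 + norm l) ^ 3) summable_on gint"
proof -
  define h where "h = (\<lambda>a::int. (1 + \<bar>real_of_int a\<bar>) powr (-3/2))"
  have nat: "(\<lambda>n::nat. (1 + real n) powr (-3/2)) summable_on UNIV"
  proof -
    have "summable (\<lambda>n. real (Suc n) powr (-3/2))"
      by (subst summable_Suc_iff) (simp add: summable_real_powr_iff)
    then show ?thesis
      by (subst summable_on_UNIV_nonneg_real_iff) (auto simp: add_ac)
  qed
  have "h summable_on range int"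
    using nat by (subst summable_on_reindex) (auto simp: o_def h_def)
  moreover have "h summable_on range (\<lambda>n. - int n)"
    using nat by (subst summable_on_reindex) (auto simp: o_def h_def inj_on_def)
  ultimately have "h summable_on (range int \<union> range (\<lambda>n. - int n))"
    by (rule summable_on_union)
  also have "range int \<union> range (\<lambda>n. - int n) = UNIV"
    by (auto, metis int_cases2 range_eqI)
  finally have h: "h summable_on UNIV" .
  have "(\<lambda>(a, b). h a * h b) summable_on UNIV \<times> UNIV"
  proof (rule summable_on_SigmaI)
    show "((\<lambda>b. case (a, b) of (a, b) \<Rightarrow> h a * h b) has_sum h a * infsum h UNIV) UNIV" for a
      using h by (auto intro!: has_sum_cmult_right)
    show "(\<lambda>a. h a * infsum h UNIV) summable_on UNIV"
      using h by (rule summable_on_cmult_left)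
  qed (auto simp: h_def)
  then have *: "(\<lambda>(a, b). h a * h b) summable_on UNIV" by simp
  have "(\<lambda>x. 1 / (1 + norm (case x of (a, b) \<Rightarrow> Complex (of_int a) (of_int b))) ^ 3) summable_on UNIV"
  proof (rule summable_on_comparison_test[OF *])
    fix x :: "int \<times> int"
    obtain a b where x: "x = (a, b)" by force
    define n where "n = norm (Complex (of_int a) (of_int b))"
    have n: "\<bar>real_of_int a\<bar> \<le> n" "\<bar>real_of_int b\<bar> \<le> n"
      using abs_Re_le_cmod[of "Complex (of_int a) (of_int b)"]
        abs_Im_le_cmod[of "Complex (of_int a) (of_int b)"] by (auto simp: n_def)
    have "1 / (1 + n) ^ 3 = (1 + n) powr (-3/2) * (1 + n) powr (-3/2)"
      using n by (subst powr_add[symmetric]) (auto simp: powr_minus_divide powr_numeral)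
    also have "\<dots> \<le> h a * h b"
      unfolding h_def using n by (intro mult_mono powr_mono2') auto
    finally show "1 / (1 + norm (case x of (a, b) \<Rightarrow> Complex (of_int a) (of_int b))) ^ 3
        \<le> (case x of (a, b) \<Rightarrow> h a * h b)" by (simp add: x n_def)
  qed auto
  then show ?thesis
    by (subst summable_on_reindex_bij_betw[OF bij_betw_gint, symmetric])
qed

text \<open>Distant lattice points are about |l| away and close ones stay at a fixed positive
  distance; one constant covers both ranges, uniformly for z in a disc. This is what feeds the
  M-test.\<close>

lemma gint_distance:
  assumes "L \<subseteq> gint" "z0 \<notin> L"
  obtains r c where "r > 0" "c > 0"
    "\<And>z l. z \<in> cball z0 r \<Longrightarrow> l \<in> L \<Longrightarrow> c * (1 + norm l) \<le> norm (z - l)"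
proof -
  have "open (- L)" using closed_subset_gint[OF assms(1)] by auto
  then obtain d where d: "d > 0" "ball z0 d \<subseteq> - L"
    using assms(2) open_contains_ball by blast
  define r where "r = d / 2"
  define R where "R = norm z0 + r"
  \<comment> \<open>\<open>R\<close> bounds |z| on the disc. If |l| \<ge> 2R + 1 then |l| - R \<ge>
    (1 + |l|)/2; otherwise 1 + |l| \<le> 2R + 2 while |z - l| \<ge> r.\<close>
  define c where "c = min (1/2) (r / (2 * R + 2))"
  have r: "r > 0" "R > 0" using d by (auto simp: r_def R_def intro: add_nonneg_pos)
  have c: "c > 0" using r by (auto simp: c_def)
  have "c * (1 + norm l) \<le> norm (z - l)" if z: "z \<in> cball z0 r" and l: "l \<in> L" for z l
  proof (cases "norm l \<ge> 2 * R + 1")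
    case True
    have "norm z \<le> R"
      using z norm_triangle_ineq2[of z z0] by (auto simp: R_def dist_norm norm_minus_commute)
    then have "norm (z - l) \<ge> norm l - R"
      using norm_triangle_ineq2[of l z] by (auto simp: norm_minus_commute)
    moreover have "c \<le> 1/2" unfolding c_def by (rule min.cobounded1)
    then have "c * (1 + norm l) \<le> 1/2 * (1 + norm l)"
      by (intro mult_right_mono) auto
    ultimately show ?thesis using True by argo
  next
    case False
    have "dist z0 l \<ge> d" using l d by (meson ComplD linorder_not_le mem_ball subsetD)
    then have "norm (z - l) \<ge> r"
      using z dist_triangle[of z0 l z] by (auto simp: r_def dist_norm)
    moreover have "c * (1 + norm l) \<le> r / (2 * R + 2) * (2 * R + 2)"
      using False r by (intro mult_mono) (auto simp: c_def)
    ultimately show ?thesis using r by auto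
  qed
  then show ?thesis using that r c by blast
qed

section \<open>Lattice sums as holomorphic functions\<close>

text \<open>The numerator is a parameter so that constant numerators, powers of cnj l and the factor
  1/l^3 share one theory.\<close>

definition lattice_sum :: "complex set \<Rightarrow> (complex \<Rightarrow> complex) \<Rightarrow> nat \<Rightarrow> complex \<Rightarrow> complex" where
  "lattice_sum L g k z = (\<Sum>\<^sub>\<infinity>l\<in>L. g l / (z - l) ^ k)"

text \<open>The bound makes every term O((1 + |l|)^(-3)). It is written without division so that a
  decaying numerator can compensate for a small k, even k = 0.\<close>

definition admissible :: "complex set \<Rightarrow> (complex \<Rightarrow> complex) \<Rightarrow> nat \<Rightarrow> bool" where
  "admissible L g k \<longleftrightarrow> L \<subseteq> gint \<and>
     (\<exists>C. \<forall>l\<in>L. norm (g l) * (1 + norm l) ^ 3 \<le> C * (1 + norm l) ^ k)"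

lemma admissible_Suc:
  assumes "admissible L g k"
  shows "admissible L g (Suc k)"
proof -
  obtain C where L: "L \<subseteq> gint"
    and C: "\<And>l. l \<in> L \<Longrightarrow> norm (g l) * (1 + norm l) ^ 3 \<le> C * (1 + norm l) ^ k"
    using assms by (auto simp: admissible_def)
  have "norm (g l) * (1 + norm l) ^ 3 \<le> \<bar>C\<bar> * (1 + norm l) ^ Suc k" if "l \<in> L" for l
  proof -
    have "C * (1 + norm l) ^ k \<le> \<bar>C\<bar> * (1 + norm l) ^ Suc k"
      by (intro mult_mono power_increasing) auto
    then show ?thesis using C[OF that] by linarith
  qed
  then show ?thesis using L unfolding admissible_def by blast
qed

lemma admissible_mono:
  assumes "admissible L g k" "k \<le> k'"
  shows "admissible L g k'"
  using assms(2,1) by (induction rule: dec_induct) (auto intro: admissible_Suc)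

text \<open>One majorant serves a whole disc around a point off the lattice.\<close>

lemma lattice_sum_bound:
  assumes "admissible L g k" "z0 \<notin> L"
  obtains r M where "r > 0" "M summable_on L" "cball z0 r \<inter> L = {}"
    "\<And>z l. z \<in> cball z0 r \<Longrightarrow> l \<in> L \<Longrightarrow> norm (g l / (z - l) ^ k) \<le> M l"
proof -
  obtain C where L: "L \<subseteq> gint"
    and C: "\<And>l. l \<in> L \<Longrightarrow> norm (g l) * (1 + norm l) ^ 3 \<le> C * (1 + norm l) ^ k"
    using assms by (auto simp: admissible_def)
  obtain r c where r: "r > 0" "c > 0"
    and rc: "\<And>z l. z \<in> cball z0 r \<Longrightarrow> l \<in> L \<Longrightarrow> c * (1 + norm l) \<le> norm (z - l)"
    using gint_distance[OF L assms(2)] by blast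
  define M where "M = (\<lambda>l::complex. C / c ^ k * (1 / (1 + norm l) ^ 3))"
  have "M summable_on L"
    unfolding M_def
    using summable_on_subset_banach[OF summable_on_gint L] by (rule summable_on_cmult_right)
  moreover have pos: "0 < c * (1 + norm l)" for l :: complex
    using r by (simp add: add_pos_nonneg)
  have "cball z0 r \<inter> L = {}"
    using rc pos by (metis disjoint_iff diff_self norm_zero linorder_not_le)
  moreover have "norm (g l / (z - l) ^ k) \<le> M l" if "z \<in> cball z0 r" "l \<in> L" for z l
  proof -
    have p: "0 < 1 + norm l" by (simp add: add_pos_nonneg)
    have "norm (g l / (z - l) ^ k) \<le> norm (g l) / (c * (1 + norm l)) ^ k"
      unfolding norm_divide norm_power using rc[OF that] pos[of l]
      by (intro divide_left_mono power_mono mult_pos_pos[of "_ ^ _"] zero_less_power)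
         (auto intro: less_le_trans[OF pos])
    also have "\<dots> \<le> M l"
      using C[OF that(2)] p r
      unfolding M_def power_mult_distrib by (simp add: divide_simps mult_ac)
    finally show ?thesis .
  qed
  ultimately show ?thesis using that r by blast
qed

lemma lattice_sum_abs_summable:
  assumes "admissible L g k" "z \<notin> L"
  shows "(\<lambda>l. norm (g l / (z - l) ^ k)) summable_on L"
proof -
  obtain r M where rM: "r > 0" "M summable_on L" "cball z r \<inter> L = {}"
    "\<And>z' l. z' \<in> cball z r \<Longrightarrow> l \<in> L \<Longrightarrow> norm (g l / (z' - l) ^ k) \<le> M l"
    by (rule lattice_sum_bound[OF assms, of thesis]) blast
  show ?thesis
    using rM(1) by (intro summable_on_comparison_test[OF rM(2)] rM(4)) auto
qed

lemma lattice_sum_has_sum: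
  assumes "admissible L g k" "z \<notin> L"
  shows "((\<lambda>l. g l / (z - l) ^ k) has_sum lattice_sum L g k z) L"
  unfolding lattice_sum_def
  by (rule has_sum_infsum[OF Infinite_Sum.abs_summable_summable[OF lattice_sum_abs_summable[OF assms]]])

text \<open>The finite partial sums converge uniformly on a small disc along the filter of finite
  subsets, and a locally uniform limit of holomorphic functions may be differentiated
  termwise.\<close>

lemma lattice_sum_has_field_derivative:
  assumes adm: "admissible L g k" and "z \<notin> L"
  shows "(lattice_sum L g k has_field_derivative - of_nat k * lattice_sum L g (Suc k) z) (at z)"
proof -
  obtain r M where r: "r > 0" and M: "M summable_on L" and disj: "cball z r \<inter> L = {}"
    and le: "\<And>z' l. z' \<in> cball z r \<Longrightarrow> l \<in> L \<Longrightarrow> norm (g l / (z' - l) ^ k) \<le> M l"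
    by (rule lattice_sum_bound[OF assms, of thesis]) blast
  define f where "f = (\<lambda>X z. \<Sum>l\<in>X. g l / (z - l) ^ k)"
  define f' where "f' = (\<lambda>X z. \<Sum>l\<in>X. - of_nat k * (g l / (z - l) ^ Suc k))"
  have der: "(f X has_field_derivative f' X w) (at w)"
    if "w \<in> cball z r" "finite X" "X \<subseteq> L" for X w
  proof -
    have ne: "w \<noteq> l" if "l \<in> X" for l
      using that \<open>X \<subseteq> L\<close> \<open>w \<in> cball z r\<close> disj by auto
    have *: "((\<lambda>z. g l / (z - l) ^ k) has_field_derivative - of_nat k * (g l / (w - l) ^ Suc k)) (at w)"
      if "l \<in> X" for l
    proof -
      have "((\<lambda>z. g l * inverse ((z - l) ^ k)) has_field_derivative
          g l * (- (inverse ((w - l) ^ k) * (of_nat k * (w - l) ^ (k - 1)) * inverse ((w - l) ^ k)))) (at w)"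
        using ne[OF that] by (auto intro!: derivative_eq_intros)
      then show ?thesis
        unfolding divide_inverse
        by (rule DERIV_cong) (use ne[OF that] in \<open>cases k; simp add: divide_simps; simp add: algebra_simps\<close>)
    qed
    show ?thesis unfolding f_def f'_def by (intro DERIV_sum *)
  qed
  have ul: "uniform_limit (cball z r) f (lattice_sum L g k) (finite_subsets_at_top L)"
    unfolding f_def lattice_sum_def using le by (intro Weierstrass_m_test_general[OF _ M]) auto
  have ev: "\<forall>\<^sub>F X in finite_subsets_at_top L. continuous_on (cball z r) (f X) \<and>
        (\<forall>w\<in>ball z r. (f X has_field_derivative f' X w) (at w))"
    by (rule eventually_finite_subsets_at_top_weakI)
       (auto intro!: der continuous_at_imp_continuous_on intro: DERIV_isCont)
  obtain g' where g': "\<And>w. w \<in> ball z r \<Longrightarrow>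
      (lattice_sum L g k has_field_derivative g' w) (at w) \<and>
      ((\<lambda>X. f' X w) \<longlongrightarrow> g' w) (finite_subsets_at_top L)"
    using has_complex_derivative_uniform_limit[OF ev ul finite_subsets_at_top_neq_bot r] by blast
  have "((\<lambda>l. - of_nat k * (g l / (z - l) ^ Suc k)) has_sum
          - of_nat k * lattice_sum L g (Suc k) z) L"
    using lattice_sum_has_sum[OF admissible_Suc[OF adm] \<open>z \<notin> L\<close>] by (rule has_sum_cmult_right)
  then have "((\<lambda>X. f' X z) \<longlongrightarrow> - of_nat k * lattice_sum L g (Suc k) z) (finite_subsets_at_top L)"
    by (simp add: has_sum_def f'_def)
  then have "g' z = - of_nat k * lattice_sum L g (Suc k) z"
    using g'[of z] r by (intro tendsto_unique[OF finite_subsets_at_top_neq_bot]) auto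
  then show ?thesis using g'[of z] r by auto
qed

lemma lattice_sum_holomorphic:
  assumes "admissible L g k" "S \<inter> L = {}"
  shows "lattice_sum L g k holomorphic_on S"
  unfolding holomorphic_on_def field_differentiable_def
  using lattice_sum_has_field_derivative[OF assms(1)] assms(2)
  by (meson disjoint_iff has_field_derivative_at_within)

lemma lattice_sum_higher_deriv:
  assumes "admissible L g k" "z \<notin> L"
  shows "(deriv ^^ n) (lattice_sum L g k) z =
           (- 1) ^ n * of_nat (pochhammer k n) * lattice_sum L g (k + n) z"
  using assms(2)
proof (induction n arbitrary: z)
  case (Suc n)
  have op: "open (- L)"
    using assms(1) closed_subset_gint by (auto simp: admissible_def)
  have "\<forall>\<^sub>F w in nhds z. w \<in> - L"
    using op Suc.prems by (intro eventually_nhds_in_open) auto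
  then have "\<forall>\<^sub>F w in nhds z. (deriv ^^ n) (lattice_sum L g k) w =
      (- 1) ^ n * of_nat (pochhammer k n) * lattice_sum L g (k + n) w"
    by eventually_elim (use Suc.IH in auto)
  then have "(deriv ^^ Suc n) (lattice_sum L g k) z =
      deriv (\<lambda>w. (- 1) ^ n * of_nat (pochhammer k n) * lattice_sum L g (k + n) w) z"
    by (simp add: deriv_cong_ev)
  also have "\<dots> = (- 1) ^ n * of_nat (pochhammer k n) *
      (- of_nat (k + n) * lattice_sum L g (Suc (k + n)) z)"
    using admissible_mono[OF assms(1), of "k + n"] Suc.prems
    by (intro DERIV_imp_deriv DERIV_cmult lattice_sum_has_field_derivative) auto
  finally show ?case by (simp add: pochhammer_Suc algebra_simps)
qed auto

text \<open>Translations and rotations of the lattice act on the sums through this change of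
  index.\<close>

lemma lattice_sum_reindex:
  assumes "bij_betw h L L"
    and "\<And>l. l \<in> L \<Longrightarrow> g (h l) / (w - h l) ^ k = c * (g' l / (z - l) ^ k)"
  shows "lattice_sum L g k w = c * lattice_sum L g' k z"
proof -
  have "lattice_sum L g k w = (\<Sum>\<^sub>\<infinity>l\<in>L. g (h l) / (w - h l) ^ k)"
    unfolding lattice_sum_def by (rule infsum_reindex_bij_betw[OF assms(1), symmetric])
  also have "\<dots> = (\<Sum>\<^sub>\<infinity>l\<in>L. c * (g' l / (z - l) ^ k))"
    by (intro infsum_cong assms)
  also have "\<dots> = c * lattice_sum L g' k z"
    unfolding lattice_sum_def by (rule infsum_cmult_right')
  finally show ?thesis .
qed

lemma ii_power3: "(\<i> * x) ^ 3 = - \<i> * x ^ 3"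
  unfolding power_mult_distrib by (simp add: power3_eq_cube)

lemma eq_ii_times_imp_zero:
  assumes "x = \<i> * x"
  shows "x = 0"
proof -
  have "(1 - \<i>) * x = 0" using assms by algebra
  then show ?thesis by (simp add: complex_eq_iff)
qed

lemma ii_cube: "\<i> ^ 3 = - \<i>"
  by (simp add: power3_eq_cube)

lemma divide_ii_times: "a / (\<i> * x) = - \<i> * (a / x)"
  by (simp add: divide_inverse)

lemma bij_betw_gint_translate: "mu \<in> gint \<Longrightarrow> bij_betw (\<lambda>l. l + mu) gint gint"
  by (rule bij_betw_byWitness[where f' = "\<lambda>l. l - mu"])
     (auto intro: gint_add gint_diff)

lemma bij_betw_gint_rotate:
  "bij_betw (\<lambda>l. \<i> * l) gint gint" "bij_betw (\<lambda>l. \<i> * l) (gint - {0}) (gint - {0})"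
proof -
  have a: "\<i> * (- \<i> * x) = x" "- \<i> * (\<i> * x) = x" for x :: complex by (simp_all add: algebra_simps)
  have b: "- (\<i> * x) \<in> gint \<longleftrightarrow> x \<in> gint" for x by simp
  show "bij_betw (\<lambda>l. \<i> * l) gint gint" "bij_betw (\<lambda>l. \<i> * l) (gint - {0}) (gint - {0})"
    by (rule bij_betw_byWitness[where f' = "\<lambda>l. - \<i> * l"]; use a b in auto)+
qed

lemma bij_betw_gint_cnj: "bij_betw cnj (gint - {0}) (gint - {0})"
  by (rule bij_betw_byWitness[where f' = cnj]) auto

lemma admissible_gint_1: "3 \<le> k \<Longrightarrow> admissible gint (\<lambda>_. 1) k"
  by (rule admissible_mono[of _ _ 3]) (auto simp: admissible_def intro!: exI[of _ 1])

lemma admissible_gint_minus_0: "3 \<le> k \<Longrightarrow> admissible (gint - {0}) (\<lambda>_. 1) k"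
  by (rule admissible_mono[of _ _ 3]) (auto simp: admissible_def intro!: exI[of _ 1])

lemma admissible_inverse_cube: "admissible (gint - {0}) (\<lambda>l. 1 / l ^ 3) k"
proof (rule admissible_mono[of _ _ 0])
  have "norm (1 / l ^ 3) * (1 + norm l) ^ 3 \<le> 8 * (1 + norm l) ^ 0" if "l \<in> gint - {0}" for l
  proof -
    have l: "norm l \<ge> 1" using norm_gint_ge_1 that by auto
    then have "(1 + norm l) ^ 3 \<le> (2 * norm l) ^ 3" by (intro power_mono) auto
    then have "(1 + norm l) ^ 3 / norm l ^ 3 \<le> 8"
      using l by (subst pos_divide_le_eq) (auto simp: power_mult_distrib)
    then show ?thesis by (simp add: norm_divide norm_power)
  qed
  then show "admissible (gint - {0}) (\<lambda>l. 1 / l ^ 3) 0"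
    unfolding admissible_def by blast
qed auto

section \<open>The Weierstrass functions of the Gaussian integers\<close>

abbreviation eis :: "nat \<Rightarrow> complex \<Rightarrow> complex" where
  "eis \<equiv> lattice_sum gint (\<lambda>_. 1)"

abbreviation eis0 :: "nat \<Rightarrow> complex \<Rightarrow> complex" where
  "eis0 \<equiv> lattice_sum (gint - {0}) (\<lambda>_. 1)"

abbreviation vsum :: "nat \<Rightarrow> complex \<Rightarrow> complex" where
  "vsum \<equiv> lattice_sum (gint - {0}) (\<lambda>l. 1 / l ^ 3)"

text \<open>
  The terms are \<open>z\<^sup>3 / (l\<^sup>3 (z - l)) = 1 / (z - l) + 1 / l + z / l\<^sup>2 + z\<^sup>2 / l\<^sup>3\<close>, and the last
  summand adds up to \<open>0\<close> by symmetry, so this is the Weierstrass zeta function of \<open>gint\<close>.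
\<close>

definition wzeta :: "complex \<Rightarrow> complex" where
  "wzeta z = 1 / z + z ^ 3 * vsum 1 z"

definition wp :: "complex \<Rightarrow> complex" where
  "wp z = 1 / z ^ 2 - 3 * z ^ 2 * vsum 1 z + z ^ 3 * vsum 2 z"

text \<open>This sum converges absolutely over the whole lattice without correction terms, so its
  periodicity is visible term by term; periodicity of \<open>wp\<close> and \<open>wzeta\<close> is
  obtained from it by integration.\<close>

definition wp' :: "complex \<Rightarrow> complex" where
  "wp' z = - 2 * eis 3 z"

lemma not_gint_nonzero: "z \<notin> gint \<Longrightarrow> z \<noteq> 0" by auto

lemma eis_periodic: "mu \<in> gint \<Longrightarrow> eis k (z + mu) = eis k z"
  using lattice_sum_reindex[OF bij_betw_gint_translate, of mu "\<lambda>_. 1" "z + mu" k 1 "\<lambda>_. 1" z] by simp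

lemma eis_rotate: "eis k (\<i> * z) = (- \<i>) ^ k * eis k z"
proof (rule lattice_sum_reindex[OF bij_betw_gint_rotate(1)])
  fix l
  have "(\<i> * z - \<i> * l) ^ k = \<i> ^ k * (z - l) ^ k"
    by (simp add: power_mult_distrib[symmetric] algebra_simps)
  moreover have "\<i> ^ k * (- \<i>) ^ k = 1"
    by (simp add: power_mult_distrib[symmetric])
  then have "(- \<i>) ^ k = 1 / \<i> ^ k"
    by (simp add: eq_divide_eq mult.commute)
  ultimately show "1 / (\<i> * z - \<i> * l) ^ k = (- \<i>) ^ k * (1 / (z - l) ^ k)"
    by simp
qed

lemma eis_eq_eis0:
  assumes "z \<notin> gint" "3 \<le> k"
  shows "eis k z = 1 / z ^ k + eis0 k z"
proof -
  have "((\<lambda>l. 1 / (z - l) ^ k) has_sum (1 / (z - 0) ^ k + eis0 k z)) (insert 0 (gint - {0}))"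
    by (rule has_sum_insert[OF _ lattice_sum_has_sum[OF admissible_gint_minus_0]])
       (use assms in auto)
  moreover have "insert 0 (gint - {0}) = gint" by (simp add: insert_absorb)
  ultimately have "((\<lambda>l. 1 / (z - l) ^ k) has_sum (1 / z ^ k + eis0 k z)) gint" by simp
  then show ?thesis
    unfolding lattice_sum_def[of gint] by (rule infsumI)
qed

text \<open>Multiplication by i permutes the nonzero lattice points and multiplies the sum by i, so
  it must vanish.\<close>

lemma has_sum_inverse_cube: "((\<lambda>l. 1 / l ^ 3) has_sum 0) (gint - {0})"
proof -
  have s: "((\<lambda>l. 1 / l ^ 3) has_sum (- eis0 3 0)) (gint - {0})"
  proof -
    have "((\<lambda>l. - 1 * (1 / (0 - l) ^ 3)) has_sum (- 1 * eis0 3 0)) (gint - {0})"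
      by (rule has_sum_cmult_right[OF lattice_sum_has_sum[OF admissible_gint_minus_0]]) auto
    moreover have "- 1 * (1 / (0 - l) ^ 3) = 1 / l ^ 3" for l :: complex
      by (simp add: power3_eq_cube)
    ultimately show ?thesis by (simp only: mult_minus1)
  qed
  have "eis0 3 0 = \<i> * eis0 3 0"
  proof (rule lattice_sum_reindex[OF bij_betw_gint_rotate(2)])
    show "1 / (0 - \<i> * l) ^ 3 = \<i> * (1 / (0 - l) ^ 3)" for l
      using ii_power3[of "- l"] by (simp add: divide_ii_times)
  qed
  then have "eis0 3 0 = 0" by (rule eq_ii_times_imp_zero)
  with s show ?thesis by (simp only: minus_zero)
qed

text \<open>Connects the derivatives of the corrected series with the plain Eisenstein sum. With a =
  1/l and b = 1/(z - l) one has zab = a + b, so each term on the right is (zab - a)^3 + a^3 = b^3 +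
  a^3, and the a^3 sum to 0.\<close>

lemma eis0_3_eq:
  assumes "z \<notin> gint - {0}"
  shows "eis0 3 z = 3 * z * vsum 1 z - 3 * z ^ 2 * vsum 2 z + z ^ 3 * vsum 3 z"
proof -
  note v = lattice_sum_has_sum[OF admissible_inverse_cube assms]
  have "((\<lambda>l. 3 * z * (1 / l ^ 3 / (z - l) ^ 1) + (- 3 * z ^ 2) * (1 / l ^ 3 / (z - l) ^ 2)
         + z ^ 3 * (1 / l ^ 3 / (z - l) ^ 3) + - 1 * (1 / l ^ 3)) has_sum
        (3 * z * vsum 1 z + (- 3 * z ^ 2) * vsum 2 z + z ^ 3 * vsum 3 z + - 1 * 0)) (gint - {0})"
    by (intro has_sum_add has_sum_cmult_right v has_sum_inverse_cube)
  also have "?this \<longleftrightarrow> ((\<lambda>l. 1 / (z - l) ^ 3) has_sum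
        (3 * z * vsum 1 z + (- 3 * z ^ 2) * vsum 2 z + z ^ 3 * vsum 3 z + - 1 * 0)) (gint - {0})"
  proof (rule has_sum_cong)
    fix l assume "l \<in> gint - {0}"
    with assms have l: "l \<noteq> 0" "z - l \<noteq> 0" by auto
    define a b where "a = 1 / l" and "b = 1 / (z - l)"
    have ab: "z * (a * b) = a + b" using l by (simp add: a_def b_def divide_simps)
    have "3 * z * (1 / l ^ 3 / (z - l) ^ 1) + (- 3 * z ^ 2) * (1 / l ^ 3 / (z - l) ^ 2)
         + z ^ 3 * (1 / l ^ 3 / (z - l) ^ 3) + - 1 * (1 / l ^ 3)
       = 3 * z * (a ^ 3 * b) - 3 * z ^ 2 * (a ^ 3 * b ^ 2) + z ^ 3 * (a ^ 3 * b ^ 3) - a ^ 3"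
      by (simp add: a_def b_def power_one_over)
    also have "\<dots> = 3 * (z * (a * b)) * a ^ 2 - 3 * (z * (a * b)) ^ 2 * a + (z * (a * b)) ^ 3 - a ^ 3"
      by (simp add: power2_eq_square power3_eq_cube)
    also have "\<dots> = b ^ 3"
      unfolding ab by (simp add: power2_eq_square power3_eq_cube algebra_simps)
    finally show "3 * z * (1 / l ^ 3 / (z - l) ^ 1) + (- 3 * z ^ 2) * (1 / l ^ 3 / (z - l) ^ 2)
         + z ^ 3 * (1 / l ^ 3 / (z - l) ^ 3) + - 1 * (1 / l ^ 3) = 1 / (z - l) ^ 3"
      by (simp add: b_def power_one_over)
  qed
  finally have "eis0 3 z = 3 * z * vsum 1 z + (- 3 * z ^ 2) * vsum 2 z + z ^ 3 * vsum 3 z + - 1 * 0"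
    unfolding lattice_sum_def[of _ "\<lambda>_. 1"] by (rule infsumI)
  then show ?thesis by simp
qed

lemma vsum_deriv:
  "z \<notin> gint - {0} \<Longrightarrow> (vsum k has_field_derivative - of_nat k * vsum (Suc k) z) (at z)"
  by (rule lattice_sum_has_field_derivative[OF admissible_inverse_cube])

lemma wzeta_deriv: "z \<notin> gint \<Longrightarrow> (wzeta has_field_derivative - wp z) (at z)"
  unfolding wzeta_def[abs_def] wp_def
  by (rule derivative_eq_intros vsum_deriv refl | force simp: not_gint_nonzero)+
     (simp add: numeral_2_eq_2 numeral_3_eq_3 field_simps not_gint_nonzero)

lemma wp'_eq:
  assumes "z \<notin> gint"
  shows "wp' z = - 2 / z ^ 3 - 6 * z * vsum 1 z + 6 * z ^ 2 * vsum 2 z - 2 * z ^ 3 * vsum 3 z"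
proof -
  have e: "eis 3 z = 1 / z ^ 3 + (3 * z * vsum 1 z - 3 * z ^ 2 * vsum 2 z + z ^ 3 * vsum 3 z)"
    using eis_eq_eis0[OF assms, of 3] eis0_3_eq[of z] assms by simp
  show ?thesis unfolding wp'_def e by (simp add: algebra_simps)
qed

lemma wp_deriv:
  assumes "z \<notin> gint"
  shows "(wp has_field_derivative wp' z) (at z)"
proof -
  have [simp]: "z \<noteq> 0" using assms by auto
  have "(wp has_field_derivative - 2 / z ^ 3 - 3 * (2 * z * vsum 1 z + z ^ 2 * - vsum 2 z)
      + (3 * z ^ 2 * vsum 2 z + z ^ 3 * (- 2 * vsum 3 z))) (at z)"
    unfolding wp_def[abs_def]
    by (rule derivative_eq_intros vsum_deriv refl | force simp: assms)+
       (simp add: numeral_2_eq_2 numeral_3_eq_3 field_simps)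
  then show ?thesis by (rule DERIV_cong) (simp add: wp'_eq assms algebra_simps)
qed

lemma wp'_deriv: "z \<notin> gint \<Longrightarrow> (wp' has_field_derivative 6 * eis 4 z) (at z)"
  using DERIV_cmult[OF lattice_sum_has_field_derivative[OF admissible_gint_1[of 3]], of z "- 2"]
  by (simp add: wp'_def[abs_def])

lemma wzeta_holomorphic: "S \<inter> gint = {} \<Longrightarrow> wzeta holomorphic_on S"
  and wp_holomorphic: "S \<inter> gint = {} \<Longrightarrow> wp holomorphic_on S"
  and wp'_holomorphic: "S \<inter> gint = {} \<Longrightarrow> wp' holomorphic_on S"
  unfolding holomorphic_on_def field_differentiable_def
  using wzeta_deriv wp_deriv wp'_deriv
  by (meson disjoint_iff has_field_derivative_at_within)+

lemma vsum_rotate: "vsum k (\<i> * z) = \<i> * (- \<i>) ^ k * vsum k z"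
proof (rule lattice_sum_reindex[OF bij_betw_gint_rotate(2)])
  fix l
  have "(\<i> * z - \<i> * l) ^ k = \<i> ^ k * (z - l) ^ k"
    by (simp add: power_mult_distrib[symmetric] algebra_simps)
  moreover have "\<i> ^ k * (- \<i>) ^ k = 1"
    by (simp add: power_mult_distrib[symmetric])
  then have "(- \<i>) ^ k = 1 / \<i> ^ k"
    by (simp add: eq_divide_eq mult.commute)
  ultimately show "1 / (\<i> * l) ^ 3 / (\<i> * z - \<i> * l) ^ k = \<i> * (- \<i>) ^ k * (1 / l ^ 3 / (z - l) ^ k)"
    by (simp add: ii_power3 divide_ii_times)
qed

lemma wzeta_rotate: "wzeta (\<i> * z) = - \<i> * wzeta z"
  by (simp add: wzeta_def vsum_rotate ii_power3 ii_cube divide_ii_times algebra_simps)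

lemma wp_rotate: "wp (\<i> * z) = - wp z"
  by (simp add: wp_def vsum_rotate ii_power3 ii_cube power_mult_distrib algebra_simps)

lemma wp'_rotate: "wp' (\<i> * z) = \<i> * wp' z"
  by (simp add: wp'_def eis_rotate power3_eq_cube)

lemma wzeta_minus: "wzeta (- z) = - wzeta z"
  and wp_minus: "wp (- z) = wp z"
  and wp'_minus: "wp' (- z) = - wp' z"
proof -
  have z: "- z = \<i> * (\<i> * z)" by simp
  show "wzeta (- z) = - wzeta z" "wp (- z) = wp z" "wp' (- z) = - wp' z"
    unfolding z wzeta_rotate wp_rotate wp'_rotate by simp_all
qed

lemma vsum_cnj: "vsum k (cnj z) = cnj (vsum k z)"
proof -
  have "vsum k (cnj z) = (\<Sum>\<^sub>\<infinity>l\<in>gint - {0}. 1 / cnj l ^ 3 / (cnj z - cnj l) ^ k)"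
    unfolding lattice_sum_def by (rule infsum_reindex_bij_betw[OF bij_betw_gint_cnj, symmetric])
  also have "\<dots> = (\<Sum>\<^sub>\<infinity>l\<in>gint - {0}. cnj (1 / l ^ 3 / (z - l) ^ k))" by simp
  also have "\<dots> = cnj (vsum k z)" unfolding lattice_sum_def by (rule infsum_cnj)
  finally show ?thesis .
qed

lemma wp_cnj: "wp (cnj z) = cnj (wp z)"
  by (simp add: wp_def vsum_cnj)

lemma wp'_cnj: "z \<notin> gint \<Longrightarrow> wp' (cnj z) = cnj (wp' z)"
  by (simp add: wp'_eq vsum_cnj)

lemma wp'_periodic: "mu \<in> gint \<Longrightarrow> wp' (z + mu) = wp' z"
  by (simp add: wp'_def eis_periodic)

section \<open>Periodicity, and Liouville's theorem on the torus\<close>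

lemma constant_on_Compl_gint:
  assumes "\<And>z. z \<notin> gint \<Longrightarrow> (f has_field_derivative 0) (at z)"
  obtains c where "\<And>z. z \<notin> gint \<Longrightarrow> f z = c"
  using has_field_derivative_0_imp_constant_on[of "- gint" f] assms
    connected_Compl_gint open_Compl_gint
  by (auto simp: constant_on_def)

lemma translate_deriv:
  assumes "(f has_field_derivative D) (at (z + mu))"
  shows "((\<lambda>z. f (z + mu)) has_field_derivative D) (at z)"
  using assms by (simp add: DERIV_shift)

lemma wp_periodic_basic:
  assumes "mu \<in> {1, \<i>}" "z \<notin> gint"
  shows "wp (z + mu) = wp z"
proof -
  have mu: "mu \<in> gint" using assms by auto
  have "((\<lambda>z. wp (z + mu) - wp z) has_field_derivative 0) (at w)" if "w \<notin> gint" for w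
    using translate_deriv[OF wp_deriv[of "w + mu"]] wp_deriv[OF that] that mu
    by (auto intro!: derivative_eq_intros simp: gint_add_right_iff wp'_periodic)
  then obtain c where c: "\<And>z. z \<notin> gint \<Longrightarrow> wp (z + mu) - wp z = c"
    using constant_on_Compl_gint by blast
  \<comment> \<open>The constant is read off at -mu/2, whose translate by mu is its negative;
    \<open>wp\<close> is even.\<close>
  have "- (mu / 2) \<notin> gint"
    using assms Ints_nonzero_abs_less1[of "-1/2 :: real"] by (auto simp: gint_def)
  then have "c = wp (- (mu / 2) + mu) - wp (- (mu / 2))" using c by metis
  also have "\<dots> = 0" by (simp add: wp_minus)
  finally show ?thesis using c assms(2) by force
qed

lemma periodic_gint:
  assumes f1: "\<And>z. z \<notin> gint \<Longrightarrow> f (z + 1) = f z"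
    and fi: "\<And>z. z \<notin> gint \<Longrightarrow> f (z + \<i>) = f z"
    and "mu \<in> gint" "z \<notin> gint"
  shows "f (z + mu) = f z"
proof -
  \<comment> \<open>The periods form a group, so 1 and i generate all of
    \<open>gint\<close>.\<close>
  define P where "P = (\<lambda>mu. mu \<in> gint \<and> (\<forall>z. z \<notin> gint \<longrightarrow> f (z + mu) = f z))"
  have add: "P (a + b)" if "P a" "P b" for a b
    unfolding P_def
  proof (intro conjI allI impI)
    fix z assume z: "z \<notin> gint"
    then have "z + a \<notin> gint" using that by (simp add: P_def gint_add_right_iff)
    then have "f (z + a + b) = f (z + a)" using that(2) by (simp add: P_def)
    then show "f (z + (a + b)) = f z" using that(1) z by (simp add: P_def add.assoc)
  qed (use that in \<open>auto simp: P_def gint_add\<close>)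
  have minus: "P (- a)" if "P a" for a
    unfolding P_def
  proof (intro conjI allI impI)
    fix z assume z: "z \<notin> gint"
    then have "z - a \<notin> gint" using that by (simp add: P_def gint_diff_right_iff)
    then have "f (z - a + a) = f (z - a)" using that unfolding P_def by blast
    then show "f (z + - a) = f z" by simp
  qed (use that in \<open>auto simp: P_def\<close>)
  have int: "P (of_int n * a)" if "P a" for a n
  proof (induction n)
    case (nonneg n)
    show ?case
    proof (induction n)
      case 0
      then show ?case by (simp add: P_def)
    next
      case (Suc n)
      then show ?case using add[OF that, of "of_int (int n) * a"] by (simp add: algebra_simps)
    qed
  next
    case (neg n)
    show ?case
    proof (induction n)
      case 0
      then show ?case using minus[OF that] by simp
    next
      case (Suc n)
      have "of_int (- int (Suc (Suc n))) * a = - a + of_int (- int (Suc n)) * a"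
        by (simp add: algebra_simps)
      then show ?case using add[OF minus[OF that] Suc] by simp
    qed
  qed
  obtain a b where ab: "Re mu = of_int a" "Im mu = of_int b"
    using assms(3) by (auto simp: gint_def elim!: Ints_cases)
  have "P 1" "P \<i>" using f1 fi by (auto simp: P_def)
  then have "P (of_int a * 1 + of_int b * \<i>)" by (intro add int)
  also have "of_int a * 1 + of_int b * \<i> = mu" using ab by (simp add: complex_eq_iff)
  finally show ?thesis using assms(4) by (simp add: P_def)
qed

text \<open>Liouville's theorem on the torus, for functions with a removable singularity.\<close>

lemma elliptic_constant:
  assumes hol: "f holomorphic_on - gint"
    and f1: "\<And>z. z \<notin> gint \<Longrightarrow> f (z + 1) = f z"
    and fi: "\<And>z. z \<notin> gint \<Longrightarrow> f (z + \<i>) = f z"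
    and g: "g holomorphic_on ball 0 1" "\<And>z. z \<in> ball 0 1 \<Longrightarrow> z \<noteq> 0 \<Longrightarrow> f z = g z"
  obtains c where "\<And>z. z \<notin> gint \<Longrightarrow> f z = c"
proof -
  define F where "F = (\<lambda>z. if z \<in> gint then g 0 else f z)"
  have per: "f (z + mu) = f z" if "mu \<in> gint" "z \<notin> gint" for mu z
    using f1 fi that by (rule periodic_gint)
  have F: "(F field_differentiable at z)" for z
  proof (cases "z \<in> gint")
    case True
    \<comment> \<open>By periodicity the extension \<open>g\<close> at 0 also removes the
      singularity at any other lattice point.\<close>
    have "(\<lambda>w. g (w - z)) holomorphic_on ball z 1"
      by (rule holomorphic_on_compose_gen[OF _ g(1), unfolded o_def])
         (auto intro!: holomorphic_intros simp: dist_norm norm_minus_commute)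
    then obtain D where D: "((\<lambda>w. g (w - z)) has_field_derivative D) (at z)"
      unfolding holomorphic_on_open[OF open_ball] by (meson centre_in_ball zero_less_one)
    have eq: "g (w - z) = F w" if "w \<in> ball z 1" for w
    proof (cases "w = z")
      case False
      have "norm (w - z) < 1" using that by (auto simp: dist_norm norm_minus_commute)
      then have n: "w - z \<notin> gint" using norm_gint_ge_1[of "w - z"] False by auto
      then have "w \<notin> gint" using True gint_diff by blast
      moreover have "f (w - z + z) = f (w - z)" using per[OF True n] .
      moreover have "f (w - z) = g (w - z)"
        using \<open>norm (w - z) < 1\<close> False by (intro g(2)) auto
      ultimately show ?thesis by (simp add: F_def)
    qed (auto simp: F_def True)
    have "(F has_field_derivative D) (at z)"
      by (rule has_field_derivative_transform_within_open[OF D open_ball[of z 1]]) (use eq in auto)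
    then show ?thesis by (auto simp: field_differentiable_def)
  next
    case False
    then have "f field_differentiable at z"
      using hol open_Compl_gint by (auto simp: holomorphic_on_open field_differentiable_def)
    moreover have "f w = F w" if "w \<in> - gint" for w using that by (auto simp: F_def)
    ultimately show ?thesis
      using False
      by (auto simp: field_differentiable_def intro: has_field_derivative_transform_within_open[OF _ open_Compl_gint])
  qed
  then have holF: "F holomorphic_on UNIV"
    by (simp add: holomorphic_on_def field_differentiable_at_within)
  have perF: "F (z + mu) = F z" if "mu \<in> gint" for z mu
    using per[OF that, of z] that by (auto simp: F_def gint_add_right_iff)
  have "range F \<subseteq> F ` cbox 0 (1 + \<i>)"
  proof safe
    fix z
    \<comment> \<open>Subtracting integer parts moves z into the closed unit square, so F takes all
      its values on a compact set.\<close>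
    define mu where "mu = Complex (of_int \<lfloor>Re z\<rfloor>) (of_int \<lfloor>Im z\<rfloor>)"
    have "F z = F (z - mu)" using perF[of mu "z - mu"] by (simp add: mu_def gint_def)
    moreover have "z - mu \<in> cbox 0 (1 + \<i>)"
      by (auto simp: in_cbox_complex_iff mu_def) linarith+
    ultimately show "F z \<in> F ` cbox 0 (1 + \<i>)" by blast
  qed
  moreover have "bounded (F ` cbox 0 (1 + \<i>))"
    using holF holomorphic_on_imp_continuous_on
    by (intro compact_imp_bounded compact_continuous_image)
       (auto intro: holomorphic_on_imp_continuous_on holomorphic_on_subset)
  ultimately have "bounded (range F)" using bounded_subset by blast
  then have "F constant_on UNIV" by (rule Liouville_theorem[OF holF])
  then show ?thesis
    by (metis F_def UNIV_I constant_on_def that)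
qed

section \<open>The differential equation of \<open>wp\<close>\<close>

lemma wp_periodic: "mu \<in> gint \<Longrightarrow> z \<notin> gint \<Longrightarrow> wp (z + mu) = wp z"
  by (rule periodic_gint) (auto simp: wp_periodic_basic)

lemma vsum_holomorphic: "S \<inter> (gint - {0}) = {} \<Longrightarrow> vsum k holomorphic_on S"
  by (rule lattice_sum_holomorphic[OF admissible_inverse_cube])

lemma ball_gint: "ball 0 1 \<inter> (gint - {0}) = {}"
  using norm_gint_ge_1 by fastforce

lemma not_gint_ball: "z \<in> ball 0 1 \<Longrightarrow> z \<noteq> 0 \<Longrightarrow> z \<notin> gint"
  using ball_gint by blast

text \<open>In the classical notation this is -g2/2. It is defined as the value of wp'' - 6 wp^2 at
  1/2, any point off the lattice being as good once that function is known to be constant.\<close>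

definition wk :: complex where
  "wk = 6 * eis 4 (1/2) - 6 * wp (1/2) ^ 2"

lemma half_notin_gint: "1/2 \<notin> gint"
  using Ints_nonzero_abs_less1[of "1/2 :: real"] by (auto simp: gint_def)

text \<open>The left side is wp''. The difference wp'' - 6 wp^2 is elliptic and its poles at the
  lattice points cancel, so it is constant.\<close>

lemma wp''_eq:
  assumes "z \<notin> gint"
  shows "6 * eis 4 z = 6 * wp z ^ 2 + wk"
proof -
  define f where "f = (\<lambda>z. 6 * eis 4 z - 6 * wp z ^ 2)"
  \<comment> \<open>Near 0, wp = 1/z^2 + z^2 p with p holomorphic; squaring shows that 6/z^4 is the
    whole principal part of 6 wp^2.\<close>
  define p where "p = (\<lambda>z. - 3 * vsum 1 z + z * vsum 2 z)"
  define g where "g = (\<lambda>z. 6 * eis0 4 z - 12 * p z - 6 * z ^ 4 * p z ^ 2)"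
  have "f holomorphic_on - gint"
    unfolding f_def
    by (intro holomorphic_intros wp_holomorphic lattice_sum_holomorphic admissible_gint_1) auto
  moreover have "f (z + 1) = f z" "f (z + \<i>) = f z" if "z \<notin> gint" for z
    using that by (auto simp: f_def wp_periodic eis_periodic)
  moreover have "g holomorphic_on ball 0 1"
    unfolding g_def p_def
    by (intro holomorphic_intros vsum_holomorphic lattice_sum_holomorphic admissible_gint_minus_0 ball_gint) auto
  moreover have "f z = g z" if "z \<in> ball 0 1" "z \<noteq> 0" for z
  proof -
    have "wp z = 1 / z ^ 2 + z ^ 2 * p z"
      by (simp add: wp_def p_def power2_eq_square power3_eq_cube algebra_simps)
    then have "wp z ^ 2 = 1 / z ^ 4 + 2 * p z + z ^ 4 * p z ^ 2"
      using that(2) by (simp add: power2_sum power_mult_distrib power_one_over power_divide flip: power_mult)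
    then show ?thesis
      using eis_eq_eis0[OF not_gint_ball[OF that], of 4] by (simp add: f_def g_def algebra_simps)
  qed
  ultimately obtain c where c: "\<And>z. z \<notin> gint \<Longrightarrow> f z = c"
    using elliptic_constant[of f g] by blast
  have "f z = wk" using c[OF assms] c[OF half_notin_gint] by (simp add: wk_def f_def)
  then show ?thesis by (simp add: f_def algebra_simps)
qed

lemma wp'_deriv': "z \<notin> gint \<Longrightarrow> (wp' has_field_derivative 6 * wp z ^ 2 + wk) (at z)"
  using wp'_deriv[of z] wp''_eq[of z] by simp

text \<open>The Weierstrass cubic with g3 = 0. The difference of the sides has derivative 0 by the
  second-order equation, and multiplication of the argument by i reverses its sign, so the constant
  is 0.\<close>

lemma wp'_squared:
  assumes "z \<notin> gint"
  shows "wp' z ^ 2 = 4 * wp z ^ 3 + 2 * wk * wp z"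
proof -
  define f where "f = (\<lambda>z. wp' z ^ 2 - 4 * wp z ^ 3 - 2 * wk * wp z)"
  have "(f has_field_derivative 0) (at z)" if "z \<notin> gint" for z
    unfolding f_def
    by (rule derivative_eq_intros wp_deriv wp'_deriv' that refl)+
       (simp add: algebra_simps power2_eq_square)
  then obtain c where c: "\<And>z. z \<notin> gint \<Longrightarrow> f z = c"
    using constant_on_Compl_gint[of f] by blast
  have "f (\<i> * (1/2)) = - f (1/2)"
    unfolding f_def wp_rotate wp'_rotate by (simp add: power_mult_distrib)
  then have "c = - c" using c half_notin_gint gint_ii_times_iff by metis
  then have "c = 0" by simp
  then show ?thesis using c[OF assms] by (simp add: f_def diff_eq_eq add.commute)
qed

section \<open>Quasi-periods of the zeta function\<close>

lemma wzeta_quasi_period: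
  assumes mu: "mu \<in> gint"
  obtains c where "\<And>z. z \<notin> gint \<Longrightarrow> wzeta (z + mu) = wzeta z + c"
proof -
  have "((\<lambda>z. wzeta (z + mu) - wzeta z) has_field_derivative 0) (at w)" if "w \<notin> gint" for w
    using translate_deriv[OF wzeta_deriv[of "w + mu"]] wzeta_deriv[OF that] that mu
    by (auto intro!: derivative_eq_intros simp: gint_add_right_iff wp_periodic)
  then obtain c where c: "\<And>z. z \<notin> gint \<Longrightarrow> wzeta (z + mu) - wzeta z = c"
    using constant_on_Compl_gint[of "\<lambda>z. wzeta (z + mu) - wzeta z"] by blast
  show ?thesis
  proof
    show "wzeta (z + mu) = wzeta z + c" if "z \<notin> gint" for z
      using c[OF that] by (simp add: diff_eq_eq add.commute)
  qed
qed

text \<open>The opposite side of a period parallelogram, run backwards, cancels the first side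
  except for the quasi-period.\<close>

lemma wzeta_contour_shift:
  assumes per: "\<And>z. z \<notin> gint \<Longrightarrow> wzeta (z + mu) = wzeta z + c"
    and seg: "closed_segment a b \<inter> gint = {}"
  shows "contour_integral (linepath (b + mu) (a + mu)) wzeta
           = - contour_integral (linepath a b) wzeta + c * (a - b)"
proof -
  have cont: "continuous_on (closed_segment a b) wzeta"
    using wzeta_holomorphic[OF seg] by (rule holomorphic_on_imp_continuous_on)
  then have cont': "continuous_on (closed_segment b a) wzeta"
    by (simp add: closed_segment_commute)
  have "linepath (b + mu) (a + mu) = (+) mu \<circ> linepath b a"
    by (auto simp: linepath_def algebra_simps scaleR_conv_of_real)
  then have "contour_integral (linepath (b + mu) (a + mu)) wzeta
      = contour_integral (linepath b a) (\<lambda>z. wzeta (z + mu))"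
    by (simp add: contour_integral_translate)
  also have "\<dots> = contour_integral (linepath b a) (\<lambda>z. wzeta z + c)"
    using seg by (intro contour_integral_eq per) (auto simp: closed_segment_commute)
  also have "\<dots> = contour_integral (linepath b a) wzeta + c * (a - b)"
    using contour_integrable_continuous_linepath[OF cont']
    by (subst contour_integral_add) auto
  finally show ?thesis
    using contour_integral_reverse_linepath[OF cont'] by simp
qed

text \<open>The square lies in the unit disc, where \<open>wzeta\<close> is 1/z plus a holomorphic
  function; only the simple pole at 0 contributes.\<close>

lemma contour_integral_wzeta_square:
  assumes "a = Complex (-1/2) (-1/2)" "b = Complex (1/2) (1/2)"
  shows "(wzeta has_contour_integral 2 * of_real pi * \<i>) (rectpath a b)"
    and "path_image (rectpath a b) \<inter> gint = {}"
proof -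
  have le: "Re a \<le> Re b" "Im a \<le> Im b" using assms by auto
  have sub: "cbox a b \<subseteq> ball 0 1"
  proof
    fix z assume "z \<in> cbox a b"
    then have "\<bar>Re z\<bar> \<le> 1/2" "\<bar>Im z\<bar> \<le> 1/2"
      using assms by (auto simp: in_cbox_complex_iff)
    then have "(Re z)\<^sup>2 \<le> (1/2)\<^sup>2" "(Im z)\<^sup>2 \<le> (1/2)\<^sup>2" by (metis abs_ge_zero power2_abs power_mono)+
    then have "(norm z)\<^sup>2 < 1\<^sup>2" unfolding cmod_power2 by (simp add: power2_eq_square)
    then have "norm z < 1" by (rule power2_less_imp_less) simp
    then show "z \<in> ball 0 1" by simp
  qed
  have box: "0 \<in> box a b" using assms by (simp add: in_box_complex_iff)
  have im: "path_image (rectpath a b) = cbox a b - box a b"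
    using le by (rule path_image_rectpath_cbox_minus_box)
  then have im': "path_image (rectpath a b) \<subseteq> ball 0 1" "0 \<notin> path_image (rectpath a b)"
    using sub box by auto
  then show "path_image (rectpath a b) \<inter> gint = {}" using not_gint_ball by fastforce
  have "((\<lambda>z. 1 / (z - 0)) has_contour_integral 2 * of_real pi * \<i> * winding_number (rectpath a b) 0) (rectpath a b)"
    using has_contour_integral_winding_number[OF valid_path_rectpath im'(2)] by simp
  moreover have "((\<lambda>z. z ^ 3 * vsum 1 z) has_contour_integral 0) (rectpath a b)"
    using im' by (intro Cauchy_theorem_convex_simple[where S = "ball 0 1"])
      (auto intro!: holomorphic_intros vsum_holomorphic ball_gint)
  ultimately have "((\<lambda>z. 1 / (z - 0) + z ^ 3 * vsum 1 z) has_contour_integral 2 * of_real pi * \<i> + 0) (rectpath a b)"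
    using winding_number_rectpath[OF box] by (intro has_contour_integral_add) auto
  then show "(wzeta has_contour_integral 2 * of_real pi * \<i>) (rectpath a b)"
    by (simp add: wzeta_def[abs_def])
qed

text \<open>Legendre's relation for the square lattice.\<close>

lemma wzeta_translate:
  assumes "mu \<in> gint" "z \<notin> gint"
  shows "wzeta (z + mu) = wzeta z + of_real pi * cnj mu"
proof -
  obtain c where c: "\<And>z. z \<notin> gint \<Longrightarrow> wzeta (z + 1) = wzeta z + c"
    using wzeta_quasi_period[OF gint_1] by blast
  have c1: "wzeta (z + - 1) = wzeta z + - c" if "z \<notin> gint" for z
    using c[of "z - 1"] that by (simp add: gint_diff_right_iff)
  \<comment> \<open>Rotation by i conjugates translation by 1 into translation by i, so a single
    unknown \<open>c\<close> is left.\<close>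
  have ci: "wzeta (z + \<i>) = wzeta z + - \<i> * c" if "z \<notin> gint" for z
  proof -
    have nz: "- \<i> * z \<notin> gint" using that by simp
    have "wzeta (\<i> * (- \<i> * z + 1)) = - \<i> * (wzeta (- \<i> * z) + c)"
      by (simp only: wzeta_rotate c[OF nz])
    also have "\<dots> = wzeta (\<i> * (- \<i> * z)) + - \<i> * c"
      unfolding wzeta_rotate by (simp add: algebra_simps)
    also have "\<i> * (- \<i> * z) = z" by simp
    also have "\<i> * (- \<i> * z + 1) = z + \<i>" by (simp add: algebra_simps)
    finally show ?thesis .
  qed
  \<comment> \<open>Corners of the unit square centred at 0. Its opposite sides differ by the
    periods i and -1, so the integral around it is 2ic; the residue at 0 makes it 2 pi i.\<close>
  define a1 a2 a3 a4 where "a1 = Complex (-1/2) (-1/2)" and "a2 = Complex (1/2) (-1/2)"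
    and "a3 = Complex (1/2) (1/2)" and "a4 = Complex (-1/2) (1/2)"
  note int = contour_integral_wzeta_square[OF a1_def a3_def]
  have rect: "rectpath a1 a3 = linepath a1 a2 +++ linepath a2 a3 +++ linepath a3 a4 +++ linepath a4 a1"
    by (simp add: rectpath_def Let_def a1_def a2_def a3_def a4_def)
  have "path_image (rectpath a1 a3) =
      closed_segment a1 a2 \<union> closed_segment a2 a3 \<union> closed_segment a3 a4 \<union> closed_segment a4 a1"
    unfolding rect by (simp add: path_image_join Un_assoc)
  then have seg: "closed_segment a1 a2 \<inter> gint = {}" "closed_segment a2 a3 \<inter> gint = {}"
    "closed_segment a3 a4 \<inter> gint = {}" "closed_segment a4 a1 \<inter> gint = {}"
    using int(2) by blast+
  have ci': "wzeta contour_integrable_on linepath a b" if "closed_segment a b \<inter> gint = {}" for a b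
    using that
    by (intro contour_integrable_continuous_linepath holomorphic_on_imp_continuous_on wzeta_holomorphic)
  have "2 * of_real pi * \<i> = contour_integral (rectpath a1 a3) wzeta"
    using contour_integral_unique[OF int(1)] by simp
  also have "\<dots> = contour_integral (linepath a1 a2) wzeta + contour_integral (linepath a2 a3) wzeta
      + contour_integral (linepath a3 a4) wzeta + contour_integral (linepath a4 a1) wzeta"
    unfolding rect using ci' seg
    by (simp add: contour_integrable_joinI)
  also have "linepath a3 a4 = linepath (a2 + \<i>) (a1 + \<i>)"
    by (rule arg_cong2[where f = linepath]) (simp_all add: a1_def a2_def a3_def a4_def complex_eq_iff)
  also have "linepath a4 a1 = linepath (a3 + - 1) (a2 + - 1)"
    by (rule arg_cong2[where f = linepath]) (simp_all add: a1_def a2_def a3_def a4_def complex_eq_iff)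
  also have "contour_integral (linepath a1 a2) wzeta + contour_integral (linepath a2 a3) wzeta
      + contour_integral (linepath (a2 + \<i>) (a1 + \<i>)) wzeta
      + contour_integral (linepath (a3 + - 1) (a2 + - 1)) wzeta
      = - \<i> * c * (a1 - a2) + - c * (a2 - a3)"
    using wzeta_contour_shift[OF ci seg(1)] wzeta_contour_shift[OF c1 seg(2)] by simp
  also have "\<dots> = 2 * \<i> * c"
  proof -
    have "a1 - a2 = - 1" "a2 - a3 = - \<i>"
      by (simp_all add: a1_def a2_def a3_def complex_eq_iff)
    then show ?thesis by simp
  qed
  finally have cpi: "c = of_real pi" by simp
  define f where "f = (\<lambda>z. wzeta z - of_real pi * cnj z)"
  have "f (z + mu) = f z"
  proof (rule periodic_gint[OF _ _ assms])
    show "f (w + 1) = f w" "f (w + \<i>) = f w" if "w \<notin> gint" for w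
      unfolding f_def c[OF that] ci[OF that] cpi complex_cnj_add by (simp_all add: ring_distribs)
  qed
  then have "wzeta (z + mu) = wzeta z - of_real pi * cnj z + of_real pi * cnj (z + mu)"
    by (simp only: f_def diff_eq_eq)
  then show ?thesis by (simp only: complex_cnj_add ring_distribs) simp
qed

section \<open>Eisenstein-Kronecker sums as derivatives\<close>

text \<open>The function is constant by Liouville, and a constant that equals u times itself with u
  \<noteq> 1 is 0. The rotational symmetry thus replaces the computation of a value.\<close>

lemma elliptic_zero:
  assumes "f holomorphic_on - gint"
    and "\<And>z. z \<notin> gint \<Longrightarrow> f (z + 1) = f z"
    and "\<And>z. z \<notin> gint \<Longrightarrow> f (z + \<i>) = f z"
    and "g holomorphic_on ball 0 1" "\<And>z. z \<in> ball 0 1 \<Longrightarrow> z \<noteq> 0 \<Longrightarrow> f z = g z"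
    and rot: "\<And>z. z \<notin> gint \<Longrightarrow> f (\<i> * z) = u * f z" "u \<noteq> 1"
    and "z \<notin> gint"
  shows "f z = 0"
proof -
  obtain c where c: "\<And>z. z \<notin> gint \<Longrightarrow> f z = c"
    using elliptic_constant[OF assms(1-5)] by blast
  have "c = u * c" using c rot(1) assms(8) gint_ii_times_iff by metis
  then have "(u - 1) * c = 0" by (simp add: algebra_simps)
  then show ?thesis using c[OF assms(8)] rot(2) by simp
qed

text \<open>\<open>wQ2\<close> and \<open>wQ3\<close> are the coefficients of w^2 and w^3 in sigma(z
  + w) / sigma(z), where sigma is the Weierstrass sigma function with sigma'/sigma = zeta.\<close>

definition wQ2 :: "complex \<Rightarrow> complex" where
  "wQ2 z = (wzeta z ^ 2 - wp z) / 2"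

definition wQ3 :: "complex \<Rightarrow> complex" where
  "wQ3 z = (wzeta z ^ 3 - 3 * wzeta z * wp z - wp' z) / 6"

abbreviation eis1 :: "nat \<Rightarrow> complex \<Rightarrow> complex" where
  "eis1 \<equiv> lattice_sum gint cnj"

abbreviation eis2 :: "nat \<Rightarrow> complex \<Rightarrow> complex" where
  "eis2 \<equiv> lattice_sum gint (\<lambda>l. cnj l ^ 2)"

lemma admissible_cnj_power:
  assumes "L \<subseteq> gint" "a + 3 \<le> k"
  shows "admissible L (\<lambda>l. cnj l ^ a) k"
proof (rule admissible_mono[OF _ assms(2)])
  have "norm (cnj l ^ a) * (1 + norm l) ^ 3 \<le> 1 * (1 + norm l) ^ (a + 3)" for l
  proof -
    have "norm l ^ a * (1 + norm l) ^ 3 \<le> (1 + norm l) ^ a * (1 + norm l) ^ 3"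
      by (intro mult_right_mono power_mono) auto
    then show ?thesis by (simp add: norm_power power_add)
  qed
  then show "admissible L (\<lambda>l. cnj l ^ a) (a + 3)"
    unfolding admissible_def using assms(1) by blast
qed

lemma admissible_cnj: "L \<subseteq> gint \<Longrightarrow> 4 \<le> k \<Longrightarrow> admissible L cnj k"
  using admissible_cnj_power[of L 1 k] by simp

text \<open>A numerator vanishing at 0 removes the term that would have a pole there, so such sums
  extend holomorphically over the unit disc.\<close>

lemma lattice_sum_remove_0:
  assumes "g 0 = 0"
  shows "lattice_sum gint g k = lattice_sum (gint - {0}) g k"
  unfolding lattice_sum_def[abs_def]
  by (intro ext infsum_cong_neutral) (use assms in auto)

lemma eis1_translate:
  assumes "mu \<in> gint" "z \<notin> gint" "4 \<le> k"
  shows "eis1 k (z + mu) = eis1 k z + cnj mu * eis k z"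
proof -
  have "eis1 k (z + mu) = lattice_sum gint (\<lambda>l. cnj l + cnj mu * 1) k z"
    using lattice_sum_reindex[OF bij_betw_gint_translate[OF assms(1)],
        of cnj "z + mu" k 1 "\<lambda>l. cnj l + cnj mu * 1" z] by simp
  also have "((\<lambda>l. cnj l / (z - l) ^ k + cnj mu * (1 / (z - l) ^ k)) has_sum
      (eis1 k z + cnj mu * eis k z)) gint"
    using assms by (intro has_sum_add has_sum_cmult_right lattice_sum_has_sum
        admissible_cnj admissible_gint_1) auto
  then have "lattice_sum gint (\<lambda>l. cnj l + cnj mu * 1) k z = eis1 k z + cnj mu * eis k z"
    unfolding lattice_sum_def[of gint "\<lambda>l. cnj l + cnj mu * 1"]
    by (intro infsumI) (simp add: add_divide_distrib)
  finally show ?thesis .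
qed

lemma eis2_translate:
  assumes "mu \<in> gint" "z \<notin> gint" "5 \<le> k"
  shows "eis2 k (z + mu) = eis2 k z + 2 * cnj mu * eis1 k z + cnj mu ^ 2 * eis k z"
proof -
  let ?g = "\<lambda>l. cnj l ^ 2 + 2 * cnj mu * cnj l + cnj mu ^ 2 * 1"
  have "eis2 k (z + mu) = lattice_sum gint ?g k z"
    using lattice_sum_reindex[OF bij_betw_gint_translate[OF assms(1)],
        of "\<lambda>l. cnj l ^ 2" "z + mu" k 1 ?g z]
    by (simp add: power2_sum mult_ac add_ac)
  also have "((\<lambda>l. cnj l ^ 2 / (z - l) ^ k + 2 * cnj mu * (cnj l / (z - l) ^ k)
      + cnj mu ^ 2 * (1 / (z - l) ^ k)) has_sum
      (eis2 k z + 2 * cnj mu * eis1 k z + cnj mu ^ 2 * eis k z)) gint"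
    using assms by (intro has_sum_add has_sum_cmult_right lattice_sum_has_sum
        admissible_cnj admissible_cnj_power admissible_gint_1) auto
  then have "lattice_sum gint ?g k z = eis2 k z + 2 * cnj mu * eis1 k z + cnj mu ^ 2 * eis k z"
    unfolding lattice_sum_def[of gint ?g]
    by (intro infsumI) (simp add: add_divide_distrib)
  finally show ?thesis .
qed

lemma eis1_rotate: "eis1 k (\<i> * z) = - \<i> * (- \<i>) ^ k * eis1 k z"
  and eis2_rotate: "eis2 k (\<i> * z) = - ((- \<i>) ^ k) * eis2 k z"
proof -
  have pw: "(\<i> * z - \<i> * l) ^ k = \<i> ^ k * (z - l) ^ k" for l
    by (simp add: power_mult_distrib[symmetric] algebra_simps)
  have "\<i> ^ k * (- \<i>) ^ k = 1"
    by (simp add: power_mult_distrib[symmetric])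
  then have q: "(- \<i>) ^ k = 1 / \<i> ^ k"
    by (simp add: eq_divide_eq mult.commute)
  show "eis1 k (\<i> * z) = - \<i> * (- \<i>) ^ k * eis1 k z"
    by (rule lattice_sum_reindex[OF bij_betw_gint_rotate(1)]) (simp add: pw q)
  show "eis2 k (\<i> * z) = - ((- \<i>) ^ k) * eis2 k z"
    by (rule lattice_sum_reindex[OF bij_betw_gint_rotate(1)]) (simp add: pw q power_mult_distrib)
qed

lemma higher_deriv_cong_Compl_gint:
  assumes "\<And>z. z \<notin> gint \<Longrightarrow> f z = g z" "z \<notin> gint"
  shows "(deriv ^^ n) f z = (deriv ^^ n) g z"
proof (rule higher_deriv_cong_ev)
  have "\<forall>\<^sub>F w in nhds z. w \<in> - gint"
    using open_Compl_gint assms(2) by (intro eventually_nhds_in_open) auto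
  then show "\<forall>\<^sub>F w in nhds z. f w = g w"
    by eventually_elim (use assms(1) in auto)
qed auto

lemma fact_mult_pochhammer: "fact k * pochhammer (Suc k) n = (fact (n + k) :: nat)"
  by (induction n) (simp_all add: pochhammer_Suc algebra_simps)

lemma wzeta_higher_deriv:
  assumes "z \<notin> gint"
  shows "(deriv ^^ (n + 2)) wzeta z = (- 1) ^ n * of_nat (fact (n + 2)) * eis (n + 3) z"
proof -
  have 1: "deriv wzeta w = - wp w" if "w \<notin> gint" for w
    using wzeta_deriv[OF that] by (rule DERIV_imp_deriv)
  have "deriv (deriv wzeta) w = 2 * eis 3 w" if "w \<notin> gint" for w
  proof -
    have "deriv (deriv wzeta) w = deriv (\<lambda>w. - wp w) w"
      using higher_deriv_cong_Compl_gint[OF 1 that, where n = 1] by simp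
    also have "\<dots> = - wp' w"
      by (intro DERIV_imp_deriv DERIV_minus wp_deriv that)
    finally show ?thesis by (simp add: wp'_def)
  qed
  then have "(deriv ^^ n) (deriv (deriv wzeta)) z = (deriv ^^ n) (\<lambda>w. 2 * eis 3 w) z"
    using assms by (rule higher_deriv_cong_Compl_gint)
  also have "\<dots> = 2 * (deriv ^^ n) (eis 3) z"
    using assms open_Compl_gint
    by (intro higher_deriv_cmult[where A = "- gint"] lattice_sum_holomorphic admissible_gint_1) auto
  also have "\<dots> = (- 1) ^ n * of_nat (2 * pochhammer 3 n) * eis (n + 3) z"
    using assms by (subst lattice_sum_higher_deriv) (auto intro: admissible_gint_1 simp: add_ac)
  also have "2 * pochhammer 3 n = (fact (n + 2) :: nat)"
    using fact_mult_pochhammer[of 2 n] by (simp add: fact_numeral)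
  also have "(deriv ^^ n) (deriv (deriv wzeta)) z = (deriv ^^ (n + 2)) wzeta z"
    by (simp add: funpow_Suc_right del: funpow.simps)
  finally show ?thesis .
qed

lemma higher_deriv_translate_gint:
  assumes "f holomorphic_on - gint" "mu \<in> gint" "z \<notin> gint"
  shows "(deriv ^^ n) f (z + mu) = (deriv ^^ n) (\<lambda>w. f (w + mu)) z"
  using higher_deriv_compose_linear'[OF assms(1) open_Compl_gint open_Compl_gint, of z 1 mu n]
    assms by (simp add: gint_add_right_iff)

lemma higher_deriv_rotate_gint:
  assumes "f holomorphic_on - gint" "z \<notin> gint" and rot: "\<And>w. w \<notin> gint \<Longrightarrow> f (\<i> * w) = u * f w"
  shows "\<i> ^ n * (deriv ^^ n) f (\<i> * z) = u * (deriv ^^ n) f z"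
proof -
  have "\<i> ^ n * (deriv ^^ n) f (\<i> * z) = (deriv ^^ n) (\<lambda>w. f (\<i> * w)) z"
    using higher_deriv_compose_linear[OF assms(1) open_Compl_gint open_Compl_gint, of z \<i> n]
      assms(2) by simp
  also have "\<dots> = (deriv ^^ n) (\<lambda>w. u * f w) z"
    using rot assms(2) by (rule higher_deriv_cong_Compl_gint)
  also have "\<dots> = u * (deriv ^^ n) f z"
    using assms(1,2) open_Compl_gint by (intro higher_deriv_cmult[where A = "- gint"]) auto
  finally show ?thesis .
qed

lemma higher_deriv_extend:
  assumes "g holomorphic_on ball 0 1" "\<And>z. z \<in> ball 0 1 \<Longrightarrow> z \<noteq> 0 \<Longrightarrow> f z = g z"
    and "z \<in> ball 0 1" "z \<noteq> 0"
  shows "(deriv ^^ n) f z = (deriv ^^ n) g z"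
proof (rule higher_deriv_cong_ev)
  have "\<forall>\<^sub>F w in nhds z. w \<in> ball 0 1 - {0}"
    using assms(3,4) by (intro eventually_nhds_in_open) auto
  then show "\<forall>\<^sub>F w in nhds z. f w = g w"
    by eventually_elim (use assms(2) in auto)
qed auto

lemma wQ2_holomorphic: "wQ2 holomorphic_on - gint"
  unfolding wQ2_def[abs_def] by (intro holomorphic_intros wzeta_holomorphic wp_holomorphic) auto

lemma wQ3_holomorphic: "wQ3 holomorphic_on - gint"
  unfolding wQ3_def[abs_def]
  by (intro holomorphic_intros wzeta_holomorphic wp_holomorphic wp'_holomorphic) auto

text \<open>Adding mu to z multiplies sigma(z + w) / sigma(z) by exp(c w). This formula and the one
  for \<open>wQ3\<close> are the comparison of coefficients of w^2 and w^3.\<close>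

lemma wQ2_translate:
  assumes "mu \<in> gint" "z \<notin> gint"
  defines "c \<equiv> of_real pi * cnj mu"
  shows "wQ2 (z + mu) = wQ2 z + c * wzeta z + c ^ 2 / 2"
  unfolding wQ2_def wzeta_translate[OF assms(1,2)] wp_periodic[OF assms(1,2)] c_def[symmetric]
  by (simp add: field_simps power2_eq_square)

lemma wQ3_translate:
  assumes "mu \<in> gint" "z \<notin> gint"
  defines "c \<equiv> of_real pi * cnj mu"
  shows "wQ3 (z + mu) = wQ3 z + c * wQ2 z + c ^ 2 / 2 * wzeta z + c ^ 3 / 6"
  unfolding wQ2_def wQ3_def wzeta_translate[OF assms(1,2)] wp_periodic[OF assms(1,2)]
    wp'_periodic[OF assms(1)] c_def[symmetric]
  by (simp add: field_simps power2_eq_square power3_eq_cube)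

text \<open>A lattice translation changes both sides by the same multiple of \<open>eis 4\<close>,
  neither side has a pole at 0, and the difference picks up the factor -i under rotation by i; so it
  vanishes by \<open>elliptic_zero\<close>.\<close>

lemma wQ2_higher_deriv_3:
  assumes "z \<notin> gint"
  shows "(deriv ^^ 3) wQ2 z = - 6 * of_real pi * eis1 4 z"
proof -
  define f where "f = (\<lambda>z. (deriv ^^ 3) wQ2 z + 6 * of_real pi * eis1 4 z)"
  define p where "p = (\<lambda>z. - 3 * vsum 1 z + z * vsum 2 z)"
  \<comment> \<open>\<open>g\<close> is the extension of \<open>wQ2\<close> over 0: the double poles
    of zeta^2 and wp cancel.\<close>
  define g where "g = (\<lambda>z. (2 * z ^ 2 * vsum 1 z + z ^ 6 * vsum 1 z ^ 2 - z ^ 2 * p z) / 2)"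
  define h where "h = (\<lambda>z. (deriv ^^ 3) g z + 6 * of_real pi * lattice_sum (gint - {0}) cnj 4 z)"
  have holg: "g holomorphic_on ball 0 1"
    unfolding g_def p_def by (intro holomorphic_intros vsum_holomorphic ball_gint) auto
  have gz: "wQ2 z = g z" if "z \<in> ball 0 1" "z \<noteq> 0" for z
  proof -
    define a V W where "a = 1 / z" and "V = vsum 1 z" and "W = vsum 2 z"
    have az: "a * z = 1" using that by (simp add: a_def)
    have w: "wzeta z = a + z ^ 3 * V" "wp z = a ^ 2 - 3 * z ^ 2 * V + z ^ 3 * W"
      by (simp_all add: wzeta_def wp_def a_def V_def W_def power_one_over)
    have alg: "(a + z ^ 3 * V) ^ 2 - (a ^ 2 - 3 * z ^ 2 * V + z ^ 3 * W)
        = 2 * z ^ 2 * V + z ^ 6 * V ^ 2 - z ^ 2 * (- 3 * V + z * W)"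
      using az by algebra
    show ?thesis unfolding wQ2_def w alg unfolding g_def p_def V_def W_def ..
  qed
  have "f z = 0"
  proof (rule elliptic_zero[where f = f and z = z and g = h and u = "- \<i>"])
    show "f holomorphic_on - gint"
      unfolding f_def
      by (intro holomorphic_intros holomorphic_higher_deriv wQ2_holomorphic open_Compl_gint
          lattice_sum_holomorphic admissible_cnj) auto
    have per: "f (w + mu) = f w" if mu: "mu \<in> gint" and w: "w \<notin> gint" for w mu
    proof -
      define c where "c = of_real pi * cnj mu"
      have "(deriv ^^ 3) wQ2 (w + mu) = (deriv ^^ 3) (\<lambda>z. wQ2 (z + mu)) w"
        by (rule higher_deriv_translate_gint[OF wQ2_holomorphic mu w])
      also have "\<dots> = (deriv ^^ 3) (\<lambda>z. wQ2 z + c * wzeta z + c ^ 2 / 2) w"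
        using wQ2_translate[OF mu] w unfolding c_def by (intro higher_deriv_cong_Compl_gint) auto
      also have "\<dots> = (deriv ^^ 3) (\<lambda>z. wQ2 z + c * wzeta z) w + (deriv ^^ 3) (\<lambda>_. c ^ 2 / 2) w"
        using w open_Compl_gint
        by (intro higher_deriv_add[where S = "- gint"] holomorphic_intros wQ2_holomorphic wzeta_holomorphic) auto
      also have "(deriv ^^ 3) (\<lambda>z. wQ2 z + c * wzeta z) w
          = (deriv ^^ 3) wQ2 w + (deriv ^^ 3) (\<lambda>z. c * wzeta z) w"
        using w open_Compl_gint
        by (intro higher_deriv_add[where S = "- gint"] holomorphic_intros wQ2_holomorphic wzeta_holomorphic) auto
      also have "(deriv ^^ 3) (\<lambda>z. c * wzeta z) w = c * (deriv ^^ 3) wzeta w"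
        using w open_Compl_gint by (intro higher_deriv_cmult[where A = "- gint"] wzeta_holomorphic) auto
      also have "(deriv ^^ 3) wzeta w = - 6 * eis 4 w"
        using wzeta_higher_deriv[OF w, of 1] by (simp add: fact_numeral eval_nat_numeral)
      finally show ?thesis
        using eis1_translate[OF mu w, of 4] by (simp add: f_def c_def algebra_simps)
    qed
    show "f (w + 1) = f w" "f (w + \<i>) = f w" if "w \<notin> gint" for w
      using per that by auto
    show "h holomorphic_on ball 0 1"
      unfolding h_def
      by (intro holomorphic_intros holomorphic_higher_deriv holg lattice_sum_holomorphic
          admissible_cnj ball_gint) auto
    show "f w = h w" if "w \<in> ball 0 1" "w \<noteq> 0" for w
      using higher_deriv_extend[OF holg gz that, of 3] lattice_sum_remove_0[of cnj 4]
      by (simp add: f_def h_def)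
    show "f (\<i> * w) = - \<i> * f w" if "w \<notin> gint" for w
    proof -
      have "\<i> ^ 3 * (deriv ^^ 3) wQ2 (\<i> * w) = - 1 * (deriv ^^ 3) wQ2 w"
        using wQ2_holomorphic that
        by (rule higher_deriv_rotate_gint, unfold wQ2_def wzeta_rotate wp_rotate)
           (simp add: power_mult_distrib field_simps)
      then have rot: "\<i> * (deriv ^^ 3) wQ2 (\<i> * w) = (deriv ^^ 3) wQ2 w"
        by (simp add: ii_cube)
      have "(deriv ^^ 3) wQ2 (\<i> * w) = - \<i> * (deriv ^^ 3) wQ2 w"
        unfolding rot[symmetric] by simp
      then show ?thesis by (simp add: f_def eis1_rotate algebra_simps)
    qed
  qed (use assms in \<open>auto simp: complex_eq_iff\<close>)
  then show ?thesis by (simp add: f_def add_eq_0_iff2)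
qed

lemma wQ2_higher_deriv:
  assumes "z \<notin> gint"
  shows "(deriv ^^ (n + 3)) wQ2 z = of_real pi * ((- 1) ^ Suc n * of_nat (fact (n + 3)) * eis1 (n + 4) z)"
proof -
  have "(deriv ^^ (n + 3)) wQ2 z = (deriv ^^ n) ((deriv ^^ 3) wQ2) z"
    by (simp add: funpow_add)
  also have "\<dots> = (deriv ^^ n) (\<lambda>z. - 6 * of_real pi * eis1 4 z) z"
    using wQ2_higher_deriv_3 assms by (rule higher_deriv_cong_Compl_gint)
  also have "\<dots> = - 6 * of_real pi * (deriv ^^ n) (eis1 4) z"
    using assms open_Compl_gint
    by (intro higher_deriv_cmult[where A = "- gint"] lattice_sum_holomorphic admissible_cnj) auto
  also have "\<dots> = of_real pi * ((- 1) ^ Suc n * of_nat (6 * pochhammer 4 n) * eis1 (n + 4) z)"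
    using assms by (subst lattice_sum_higher_deriv) (auto intro: admissible_cnj simp: add_ac)
  also have "6 * pochhammer 4 n = (fact (n + 3) :: nat)"
    using fact_mult_pochhammer[of 3 n] by (simp add: fact_numeral)
  finally show ?thesis .
qed

text \<open>The same argument one order higher: translation now adds multiples of
  \<open>eis1 5\<close> and \<open>eis 5\<close> to both sides alike, and the rotation factor is
  i.\<close>

lemma wQ3_higher_deriv_4:
  assumes "z \<notin> gint"
  shows "(deriv ^^ 4) wQ3 z = 12 * of_real pi ^ 2 * eis2 5 z"
proof -
  define f where "f = (\<lambda>z. (deriv ^^ 4) wQ3 z - 12 * of_real pi ^ 2 * eis2 5 z)"
  \<comment> \<open>\<open>g\<close> extends \<open>wQ3\<close> over 0: the triple poles of zeta^3,
    -3 zeta wp and -wp' have coefficients 1 - 3 + 2 = 0.\<close>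
  define g where "g = (\<lambda>z. (15 * z * vsum 1 z + 12 * z ^ 5 * vsum 1 z ^ 2 + z ^ 9 * vsum 1 z ^ 3
    - 9 * z ^ 2 * vsum 2 z - 3 * z ^ 6 * vsum 1 z * vsum 2 z + 2 * z ^ 3 * vsum 3 z) / 6)"
  define h where "h = (\<lambda>z. (deriv ^^ 4) g z
    - 12 * of_real pi ^ 2 * lattice_sum (gint - {0}) (\<lambda>l. cnj l ^ 2) 5 z)"
  have holg: "g holomorphic_on ball 0 1"
    unfolding g_def by (intro holomorphic_intros vsum_holomorphic ball_gint) auto
  have gz: "wQ3 z = g z" if "z \<in> ball 0 1" "z \<noteq> 0" for z
  proof -
    define a V W X where "a = 1 / z" and "V = vsum 1 z" and "W = vsum 2 z" and "X = vsum 3 z"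
    have az: "a * z = 1" using that by (simp add: a_def)
    have w: "wzeta z = a + z ^ 3 * V" "wp z = a ^ 2 - 3 * z ^ 2 * V + z ^ 3 * W"
      "wp' z = - 2 * a ^ 3 - 6 * z * V + 6 * z ^ 2 * W - 2 * z ^ 3 * X"
      using wp'_eq[OF not_gint_ball[OF that]]
      by (simp_all add: wzeta_def wp_def a_def V_def W_def X_def power_one_over)
    have alg: "(a + z ^ 3 * V) ^ 3 - 3 * (a + z ^ 3 * V) * (a ^ 2 - 3 * z ^ 2 * V + z ^ 3 * W)
        - (- 2 * a ^ 3 - 6 * z * V + 6 * z ^ 2 * W - 2 * z ^ 3 * X)
        = 15 * z * V + 12 * z ^ 5 * V ^ 2 + z ^ 9 * V ^ 3 - 9 * z ^ 2 * W - 3 * z ^ 6 * V * W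
          + 2 * z ^ 3 * X"
      using az by algebra
    show ?thesis unfolding wQ3_def w alg unfolding g_def V_def W_def X_def ..
  qed
  have "f z = 0"
  proof (rule elliptic_zero[where f = f and z = z and g = h and u = "\<i>"])
    show "f holomorphic_on - gint"
      unfolding f_def
      by (intro holomorphic_intros holomorphic_higher_deriv wQ3_holomorphic open_Compl_gint
          lattice_sum_holomorphic admissible_cnj_power) auto
    have per: "f (w + mu) = f w" if mu: "mu \<in> gint" and w: "w \<notin> gint" for w mu
    proof -
      define c where "c = of_real pi * cnj mu"
      note hol = wQ3_holomorphic wQ2_holomorphic wzeta_holomorphic[of "- gint"]
      have "(deriv ^^ 4) wQ3 (w + mu) = (deriv ^^ 4) (\<lambda>z. wQ3 (z + mu)) w"
        by (rule higher_deriv_translate_gint[OF wQ3_holomorphic mu w])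
      also have "\<dots> = (deriv ^^ 4) (\<lambda>z. wQ3 z + c * wQ2 z + c ^ 2 / 2 * wzeta z + c ^ 3 / 6) w"
        using wQ3_translate[OF mu] w unfolding c_def by (intro higher_deriv_cong_Compl_gint) auto
      also have "\<dots> = (deriv ^^ 4) (\<lambda>z. wQ3 z + c * wQ2 z + c ^ 2 / 2 * wzeta z) w
          + (deriv ^^ 4) (\<lambda>_. c ^ 3 / 6) w"
        using w open_Compl_gint
        by (intro higher_deriv_add[where S = "- gint"] holomorphic_intros hol) auto
      also have "(deriv ^^ 4) (\<lambda>z. wQ3 z + c * wQ2 z + c ^ 2 / 2 * wzeta z) w
          = (deriv ^^ 4) (\<lambda>z. wQ3 z + c * wQ2 z) w + (deriv ^^ 4) (\<lambda>z. c ^ 2 / 2 * wzeta z) w"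
        using w open_Compl_gint
        by (intro higher_deriv_add[where S = "- gint"] holomorphic_intros hol) auto
      also have "(deriv ^^ 4) (\<lambda>z. wQ3 z + c * wQ2 z) w
          = (deriv ^^ 4) wQ3 w + (deriv ^^ 4) (\<lambda>z. c * wQ2 z) w"
        using w open_Compl_gint
        by (intro higher_deriv_add[where S = "- gint"] holomorphic_intros hol) auto
      also have "(deriv ^^ 4) (\<lambda>z. c * wQ2 z) w = c * (deriv ^^ 4) wQ2 w"
        using w open_Compl_gint by (intro higher_deriv_cmult[where A = "- gint"] hol) auto
      also have "(deriv ^^ 4) (\<lambda>z. c ^ 2 / 2 * wzeta z) w = c ^ 2 / 2 * (deriv ^^ 4) wzeta w"
        using w open_Compl_gint by (intro higher_deriv_cmult[where A = "- gint"] hol) auto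
      also have "(deriv ^^ 4) wzeta w = 24 * eis 5 w"
        using wzeta_higher_deriv[OF w, of 2] by (simp add: fact_numeral)
      also have "(deriv ^^ 4) wQ2 w = 24 * of_real pi * eis1 5 w"
        using wQ2_higher_deriv[OF w, of 1] by (simp add: fact_numeral)
      finally show ?thesis
        using eis2_translate[OF mu w, of 5] by (simp add: f_def c_def algebra_simps power2_eq_square)
    qed
    show "f (w + 1) = f w" "f (w + \<i>) = f w" if "w \<notin> gint" for w
      using per that by auto
    show "h holomorphic_on ball 0 1"
      unfolding h_def
      by (intro holomorphic_intros holomorphic_higher_deriv holg lattice_sum_holomorphic
          admissible_cnj_power ball_gint) auto
    show "f w = h w" if "w \<in> ball 0 1" "w \<noteq> 0" for w
      using higher_deriv_extend[OF holg gz that, of 4] lattice_sum_remove_0[of "\<lambda>l. cnj l ^ 2" 5]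
      by (simp add: f_def h_def)
    show "f (\<i> * w) = \<i> * f w" if "w \<notin> gint" for w
    proof -
      have "\<i> ^ 4 * (deriv ^^ 4) wQ3 (\<i> * w) = \<i> * (deriv ^^ 4) wQ3 w"
        using wQ3_holomorphic that
        by (rule higher_deriv_rotate_gint, unfold wQ3_def wzeta_rotate wp_rotate wp'_rotate)
           (simp add: power_mult_distrib ii_cube field_simps)
      moreover have "\<i> ^ 4 = 1" "(- \<i>) ^ 5 = - \<i>" by (simp_all add: eval_nat_numeral)
      ultimately show ?thesis by (simp add: f_def eis2_rotate algebra_simps)
    qed
  qed (use assms in \<open>auto simp: complex_eq_iff\<close>)
  then show ?thesis by (simp add: f_def)
qed

lemma wQ3_higher_deriv:
  assumes "z \<notin> gint"
  shows "(deriv ^^ (n + 4)) wQ3 z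
    = of_real pi ^ 2 * ((- 1) ^ n * of_nat (fact (n + 4)) / 2 * eis2 (n + 5) z)"
proof -
  have "(deriv ^^ (n + 4)) wQ3 z = (deriv ^^ n) ((deriv ^^ 4) wQ3) z"
    by (simp add: funpow_add)
  also have "\<dots> = (deriv ^^ n) (\<lambda>z. 12 * of_real pi ^ 2 * eis2 5 z) z"
    using wQ3_higher_deriv_4 assms by (rule higher_deriv_cong_Compl_gint)
  also have "\<dots> = 12 * of_real pi ^ 2 * (deriv ^^ n) (eis2 5) z"
    using assms open_Compl_gint
    by (intro higher_deriv_cmult[where A = "- gint"] lattice_sum_holomorphic admissible_cnj_power) auto
  also have "\<dots> = of_real pi ^ 2 * ((- 1) ^ n * of_nat (24 * pochhammer 5 n) / 2 * eis2 (n + 5) z)"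
    using assms by (subst lattice_sum_higher_deriv) (auto intro: admissible_cnj_power simp: add_ac)
  also have "24 * pochhammer 5 n = (fact (n + 4) :: nat)"
    using fact_mult_pochhammer[of 4 n] by (simp add: fact_numeral)
  finally show ?thesis .
qed

section \<open>The equation f'' = 6 f^2 + k and separation of points\<close>

text \<open>Leibniz's rule applied to the equation expresses every derivative of order at least 2 by
  lower ones. It serves twice: for uniqueness of solutions and for the arithmetic of the Taylor
  coefficients of \<open>wp\<close>.\<close>

lemma ode_higher_deriv:
  fixes f f' :: "complex \<Rightarrow> complex"
  assumes "open S" "a \<in> S"
    and f: "\<And>z. z \<in> S \<Longrightarrow> (f has_field_derivative f' z) (at z)"
    and f': "\<And>z. z \<in> S \<Longrightarrow> (f' has_field_derivative 6 * f z ^ 2 + k) (at z)"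
  shows "(deriv ^^ Suc (Suc n)) f a =
    6 * (\<Sum>i = 0..n. of_nat (n choose i) * (deriv ^^ i) f a * (deriv ^^ (n - i)) f a)
    + (if n = 0 then k else 0)"
proof -
  have hol: "f holomorphic_on S"
    using f by (auto simp: holomorphic_on_open[OF assms(1)])
  have nhd: "\<forall>\<^sub>F w in nhds z. w \<in> S" if "z \<in> S" for z
    using assms(1) that by (rule eventually_nhds_in_open)
  have 1: "deriv f z = f' z" if "z \<in> S" for z
    using f[OF that] by (rule DERIV_imp_deriv)
  have 2: "deriv (deriv f) z = 6 * (f z * f z) + k" if "z \<in> S" for z
  proof -
    have "deriv (deriv f) z = deriv f' z"
      using nhd[OF that] by (intro deriv_cong_ev) (auto elim!: eventually_mono simp: 1)
    also have "\<dots> = 6 * (f z * f z) + k"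
      using DERIV_imp_deriv[OF f'[OF that]] by (simp add: power2_eq_square)
    finally show ?thesis .
  qed
  have "(deriv ^^ Suc (Suc n)) f a = (deriv ^^ n) (deriv (deriv f)) a"
    by (simp add: funpow_Suc_right del: funpow.simps)
  also have "\<dots> = (deriv ^^ n) (\<lambda>z. 6 * (f z * f z) + k) a"
    using nhd[OF assms(2)] by (intro higher_deriv_cong_ev) (auto elim!: eventually_mono simp: 2)
  also have "\<dots> = (deriv ^^ n) (\<lambda>z. 6 * (f z * f z)) a + (deriv ^^ n) (\<lambda>_. k) a"
    using assms(1,2) by (intro higher_deriv_add[where S = S] holomorphic_intros hol)
  also have "(deriv ^^ n) (\<lambda>z. 6 * (f z * f z)) a = 6 * (deriv ^^ n) (\<lambda>z. f z * f z) a"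
    using assms(1,2) by (intro higher_deriv_cmult[where A = S] holomorphic_intros hol)
  also have "(deriv ^^ n) (\<lambda>z. f z * f z) a
      = (\<Sum>i = 0..n. of_nat (n choose i) * (deriv ^^ i) f a * (deriv ^^ (n - i)) f a)"
    by (rule higher_deriv_mult[OF hol hol assms(1,2)])
  finally show ?thesis by simp
qed

text \<open>The recurrence determines all derivatives at \<open>a\<close> from the first two, and
  the identity theorem spreads the equality over the connected set.\<close>

lemma ode_unique:
  fixes f f' g g' :: "complex \<Rightarrow> complex"
  assumes S: "open S" "connected S" "a \<in> S" "w \<in> S"
    and f: "\<And>z. z \<in> S \<Longrightarrow> (f has_field_derivative f' z) (at z)"
    and f': "\<And>z. z \<in> S \<Longrightarrow> (f' has_field_derivative 6 * f z ^ 2 + k) (at z)"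
    and g: "\<And>z. z \<in> S \<Longrightarrow> (g has_field_derivative g' z) (at z)"
    and g': "\<And>z. z \<in> S \<Longrightarrow> (g' has_field_derivative 6 * g z ^ 2 + k) (at z)"
    and init: "f a = g a" "f' a = g' a"
  shows "f w = g w"
proof (rule holomorphic_fun_eq_on_connected[OF _ _ S(1,2) _ S(3,4)])
  show "f holomorphic_on S" "g holomorphic_on S"
    using f g by (auto simp: holomorphic_on_open[OF S(1)])
  show "(deriv ^^ n) f a = (deriv ^^ n) g a" for n
  proof (induction n rule: less_induct)
    case (less n)
    consider "n = 0" | "n = 1" | m where "n = Suc (Suc m)"
      by (metis One_nat_def not0_implies_Suc)
    then show ?case
    proof cases
      case 2
      then show ?thesis
        using DERIV_imp_deriv[OF f[OF S(3)]] DERIV_imp_deriv[OF g[OF S(3)]] init by simp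
    next
      case (3 m)
      have "(deriv ^^ i) f a = (deriv ^^ i) g a" if "i \<le> m" for i
        using less.IH 3 that by simp
      then have "(\<Sum>i = 0..m. of_nat (m choose i) * (deriv ^^ i) f a * (deriv ^^ (m - i)) f a)
          = (\<Sum>i = 0..m. of_nat (m choose i) * (deriv ^^ i) g a * (deriv ^^ (m - i)) g a)"
        by (intro sum.cong) auto
      moreover have "(deriv ^^ n) f a =
          6 * (\<Sum>i = 0..m. of_nat (m choose i) * (deriv ^^ i) f a * (deriv ^^ (m - i)) f a)
          + (if m = 0 then k else 0)"
        unfolding 3 using S(1,3) f f' by (rule ode_higher_deriv)
      moreover have "(deriv ^^ n) g a =
          6 * (\<Sum>i = 0..m. of_nat (m choose i) * (deriv ^^ i) g a * (deriv ^^ (m - i)) g a)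
          + (if m = 0 then k else 0)"
        unfolding 3 using S(1,3) g g' by (rule ode_higher_deriv)
      ultimately show ?thesis by simp
    qed (use init in simp)
  qed
qed

lemma wp_asymptotic: "((\<lambda>z. z ^ 2 * wp z) \<longlongrightarrow> 1) (at 0)"
proof -
  have "isCont (vsum k) 0" for k
    using vsum_deriv[of 0 k] by (intro DERIV_isCont) auto
  then have "isCont (\<lambda>z. 1 - 3 * z ^ 4 * vsum 1 z + z ^ 5 * vsum 2 z) 0"
    by (intro continuous_intros)
  then have "((\<lambda>z. 1 - 3 * z ^ 4 * vsum 1 z + z ^ 5 * vsum 2 z) \<longlongrightarrow> 1) (at 0)"
    by (simp add: isCont_def)
  moreover have "\<forall>\<^sub>F z in at 0. 1 - 3 * z ^ 4 * vsum 1 z + z ^ 5 * vsum 2 z = z ^ 2 * wp z"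
    by (auto simp: eventually_at_filter wp_def field_simps eval_nat_numeral)
  ultimately show ?thesis by (rule Lim_transform_eventually)
qed

lemma open_connected_translates:
  "open {t. a + t \<notin> gint \<and> b + t \<notin> gint}" "connected {t. a + t \<notin> gint \<and> b + t \<notin> gint}"
proof -
  have eq: "{t. a + t \<notin> gint \<and> b + t \<notin> gint} = - ((\<lambda>l. l - a) ` gint \<union> (\<lambda>l. l - b) ` gint)"
    by (auto simp: image_iff algebra_simps)
  have "closed ((\<lambda>l. l - c) ` gint)" for c
    using closed_translation[OF closed_subset_gint[of gint], of "- c"] by simp
  then show "open {t. a + t \<notin> gint \<and> b + t \<notin> gint}"
    unfolding eq by (intro open_Compl closed_Un)
  show "connected {t. a + t \<notin> gint \<and> b + t \<notin> gint}"
    unfolding eq Compl_eq_Diff_UNIV using countable_gint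
    by (intro connected_open_diff_countable) auto
qed

lemma translate_deriv':
  assumes "(f has_field_derivative D) (at (a + z))"
  shows "((\<lambda>t. f (a + t)) has_field_derivative D) (at z)"
  using translate_deriv[of f D z a] assms by (simp add: add.commute)

text \<open>Equal initial data make t \<mapsto> wp(a + t) and t \<mapsto> wp(b + t) the same
  solution, so b - a is a period of \<open>wp\<close>; the double pole at 0 then forces it into the
  lattice.\<close>

lemma wp_determines_point:
  assumes a: "a \<notin> gint" and b: "b \<notin> gint" and eq: "wp a = wp b" "wp' a = wp' b"
  shows "a - b \<in> gint"
proof (rule ccontr)
  assume ab: "a - b \<notin> gint"
  define S where "S = {t. a + t \<notin> gint \<and> b + t \<notin> gint}"
  have S: "open S" "connected S" unfolding S_def by (rule open_connected_translates)+
  have *: "wp (a + t) = wp (b + t)" if "t \<in> S" for t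
    by (rule ode_unique[OF S, of 0 t "\<lambda>t. wp (a + t)" "\<lambda>t. wp' (a + t)" wk
          "\<lambda>t. wp (b + t)" "\<lambda>t. wp' (b + t)"])
       (use a b eq that in \<open>auto simp: S_def intro!: translate_deriv' wp_deriv wp'_deriv'\<close>)
  \<comment> \<open>If b - a is off the lattice, wp stays bounded near it, so t^2 wp(t) would tend
    to 0 instead of 1.\<close>
  have "((\<lambda>t. t ^ 2 * wp (b - a + t)) \<longlongrightarrow> 0 ^ 2 * wp (b - a + 0)) (at 0)"
  proof (intro tendsto_intros)
    have "b - a \<notin> gint" using ab gint_uminus_iff[of "a - b"] by simp
    then have "isCont (\<lambda>t. wp (b - a + t)) 0"
      by (intro DERIV_isCont[OF translate_deriv'[OF wp_deriv]]) simp
    then show "((\<lambda>t. wp (b - a + t)) \<longlongrightarrow> wp (b - a + 0)) (at 0)"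
      by (simp only: isCont_def)
  qed
  moreover have "\<forall>\<^sub>F t in at 0. t ^ 2 * wp (b - a + t) = t ^ 2 * wp t"
  proof -
    have "open {t. b - a + t \<notin> gint \<and> b - a + t \<notin> gint}" by (rule open_connected_translates)
    then have "\<forall>\<^sub>F t in nhds 0. b - a + t \<notin> gint"
      using ab gint_uminus_iff[of "a - b"] eventually_nhds_in_open by fastforce
    then have "\<forall>\<^sub>F t in at 0. b - a + t \<notin> gint" by (simp add: eventually_at_filter eventually_mono)
    moreover have "\<forall>\<^sub>F t in at 0. t \<in> ball 0 1 - {0 :: complex}"
      by (intro eventually_at_in_open) auto
    ultimately show ?thesis
    proof eventually_elim
      case (elim t)
      then have "t \<notin> gint" using not_gint_ball by auto
      then have "wp (a + (t - a)) = wp (b + (t - a))"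
        using elim by (intro *) (auto simp: S_def algebra_simps)
      then show ?case by (simp add: algebra_simps)
    qed
  qed
  ultimately have "((\<lambda>t. t ^ 2 * wp t) \<longlongrightarrow> 0) (at 0)"
    using Lim_transform_eventually by fastforce
  then show False using wp_asymptotic tendsto_unique[OF at_neq_bot] by fastforce
qed

lemma wp'_half_period: "2 * h \<in> gint \<Longrightarrow> wp' h = 0"
  using wp'_periodic[of "2 * h" "- h"] wp'_minus[of h] by simp

section \<open>Half periods and translation by (1 - i)/2\<close>

definition we :: complex where "we = wp (1/2)"

text \<open>The half periods 1/2 and (1-i)/2 are both zeros of wp', and wp vanishes at the second.
  As they are inequivalent, wp cannot also vanish at 1/2; the cubic relation there then gives
  \<open>wk\<close>.\<close>

lemma wk_eq: "wk = - 2 * we ^ 2" and we_nonzero: "we \<noteq> 0"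
proof -
  \<comment> \<open>Multiplication by i fixes \<open>h\<close> modulo the lattice and changes the
    sign of wp, so wp(h) = 0.\<close>
  define h where "h = (1 - \<i>) / 2"
  have h: "h \<notin> gint"
    using Ints_nonzero_abs_less1[of "1/2 :: real"] by (auto simp: h_def gint_def)
  have "wp (\<i> * h) = wp (h + \<i>)" by (rule arg_cong[where f = wp]) (simp add: h_def complex_eq_iff)
  also have "\<dots> = wp h" using h by (intro wp_periodic) auto
  finally have wph: "wp h = 0" by (simp add: wp_rotate)
  have wp': "wp' (1/2) = 0" "wp' h = 0"
    by (intro wp'_half_period; simp add: h_def gint_def)+
  show "we \<noteq> 0"
  proof
    assume "we = 0"
    then have "1/2 - h \<in> gint"
      using wp_determines_point[OF half_notin_gint h] wph wp' by (simp add: we_def)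
    then show False
      using Ints_nonzero_abs_less1[of "1/2 :: real"] by (auto simp: gint_def h_def)
  qed
  moreover have "4 * we ^ 3 + 2 * wk * we = 0"
    using wp'_squared[OF half_notin_gint] wp' by (simp add: we_def)
  then have "(2 * we) * (2 * we ^ 2 + wk) = 0" by (simp add: algebra_simps power2_eq_square power3_eq_cube)
  ultimately show "wk = - 2 * we ^ 2" by (simp add: eq_neg_iff_add_eq_0 add.commute)
qed

text \<open>Near 1/2 the functions wp(z + h) and -e^2/wp(z) solve the same second-order equation,
  with the same value -e and derivative 0 at 1/2. Analytic continuation does the rest.\<close>

lemma wp_product:
  assumes "z \<notin> gint" "z + (1 - \<i>) / 2 \<notin> gint"
  shows "wp (z + (1 - \<i>) / 2) * wp z = - (we ^ 2)"
proof -
  define h where "h = (1 - \<i>) / 2"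
  define U where "U = {z. 0 + z \<notin> gint \<and> h + z \<notin> gint}"
  have U: "open U" "connected U" unfolding U_def by (rule open_connected_translates)+
  have nh: "x \<notin> \<int>" if "x = 1/2 \<or> x = - (1/2)" for x :: real
    using that Ints_nonzero_abs_less1[of x] by auto
  have half: "1/2 \<in> U" using nh[of "-1/2"] half_notin_gint by (simp add: U_def h_def gint_def)
  have wpc: "continuous_on U wp"
    by (intro holomorphic_on_imp_continuous_on wp_holomorphic) (auto simp: U_def)
  have "open (U \<inter> wp -` (- {0}))" by (intro continuous_open_preimage wpc U) auto
  moreover have "1/2 \<in> U \<inter> wp -` (- {0})" using half we_nonzero by (auto simp: we_def)
  ultimately obtain r where r: "r > 0" "ball (1/2) r \<subseteq> U \<inter> wp -` (- {0})"
    using open_contains_ball by blast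
  have eq1: "wp (h + z) = - (we ^ 2) / wp z" if "z \<in> ball (1/2) r" for z
  proof (rule ode_unique[OF open_ball connected_ball _ that, of "1/2" "\<lambda>z. wp (h + z)"
        "\<lambda>z. wp' (h + z)" wk "\<lambda>z. - (we ^ 2) / wp z" "\<lambda>z. we ^ 2 * wp' z / wp z ^ 2"])
    fix w :: complex assume w: "w \<in> ball (1/2) r"
    then have wU: "w \<notin> gint" "h + w \<notin> gint" "wp w \<noteq> 0" using r by (auto simp: U_def)
    show "((\<lambda>z. wp (h + z)) has_field_derivative wp' (h + w)) (at w)"
      "((\<lambda>z. wp' (h + z)) has_field_derivative 6 * wp (h + w) ^ 2 + wk) (at w)"
      using wU by (auto intro!: translate_deriv' wp_deriv wp'_deriv')
    show "((\<lambda>z. - (we ^ 2) / wp z) has_field_derivative we ^ 2 * wp' w / wp w ^ 2) (at w)"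
      using wU by (auto intro!: derivative_eq_intros wp_deriv simp: power2_eq_square)
    have "((\<lambda>z. we ^ 2 * wp' z / wp z ^ 2) has_field_derivative
        (we ^ 2 * (6 * wp w ^ 2 + wk) * wp w ^ 2 - we ^ 2 * wp' w * (2 * wp w * wp' w))
          / (wp w ^ 2 * wp w ^ 2)) (at w)"
      using wU by (auto intro!: derivative_eq_intros wp_deriv wp'_deriv')
    also have "(we ^ 2 * (6 * wp w ^ 2 + wk) * wp w ^ 2 - we ^ 2 * wp' w * (2 * wp w * wp' w))
        = we ^ 2 * (6 * wp w ^ 2 + wk) * wp w ^ 2 - 2 * we ^ 2 * wp w * wp' w ^ 2"
      by (simp add: power2_eq_square)
    also have "\<dots> = - 2 * we ^ 2 * wp w ^ 4 + 6 * we ^ 4 * wp w ^ 2"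
      unfolding wp'_squared[OF wU(1)] wk_eq by (simp add: algebra_simps eval_nat_numeral)
    also have "(- 2 * we ^ 2 * wp w ^ 4 + 6 * we ^ 4 * wp w ^ 2) / (wp w ^ 2 * wp w ^ 2)
        = 6 * (- (we ^ 2) / wp w) ^ 2 + wk"
      unfolding wk_eq using wU(3) by (simp add: field_simps eval_nat_numeral)
    finally show "((\<lambda>z. we ^ 2 * wp' z / wp z ^ 2) has_field_derivative
        6 * (- (we ^ 2) / wp w) ^ 2 + wk) (at w)" .
  next
    have "wp (h + 1/2) = wp (- (\<i> * (1/2)) + 1)"
      by (rule arg_cong[where f = wp]) (simp add: h_def complex_eq_iff)
    also have "\<dots> = wp (- (\<i> * (1/2)))" using half_notin_gint gint_ii_times_iff[of "1/2"]
      by (intro wp_periodic) auto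
    also have "\<dots> = - we" unfolding wp_minus wp_rotate we_def ..
    finally show "wp (h + 1/2) = - (we ^ 2) / wp (1/2)"
      using we_nonzero by (simp add: we_def power2_eq_square)
    have "wp' (h + 1/2) = 0" "wp' (1/2) = 0"
      by (intro wp'_half_period; simp add: h_def gint_def)+
    then show "wp' (h + 1/2) = we ^ 2 * wp' (1/2) / wp (1/2) ^ 2" by simp
  qed (use r in auto)
  have "wp (h + z) * wp z = - (we ^ 2)"
  proof (rule analytic_continuation_open[of "ball (1/2) r" U "\<lambda>z. wp (h + z) * wp z" "\<lambda>_. - (we ^ 2)"])
    show "(\<lambda>z. wp (h + z) * wp z) holomorphic_on U"
      unfolding holomorphic_on_open[OF U(1)]
    proof
      fix w assume "w \<in> U"
      then have "0 + w \<notin> gint" "h + w \<notin> gint" by (auto simp: U_def)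
      then show "\<exists>d. ((\<lambda>z. wp (h + z) * wp z) has_field_derivative d) (at w)"
        using DERIV_mult[OF translate_deriv'[OF wp_deriv] wp_deriv] by auto
    qed
    show "wp (h + w) * wp w = - (we ^ 2)" if "w \<in> ball (1/2) r" for w
      using eq1[OF that] r that by auto
    show "ball (1/2) r \<noteq> {}" using r by auto
  qed (use assms r U in \<open>auto simp: U_def h_def add.commute\<close>)
  then show ?thesis by (simp add: h_def add.commute)
qed

text \<open>By \<open>wp_product\<close> the difference of zeta(z + h) - zeta(z) and wp'/(2 wp) has
  derivative 0; the constant is found by translating twice.\<close>

lemma wzeta_half_translate:
  assumes "z \<notin> gint" "z + (1 - \<i>) / 2 \<notin> gint"
  shows "wzeta (z + (1 - \<i>) / 2) = wzeta z + wp' z / (2 * wp z) + of_real pi * cnj ((1 - \<i>) / 2)"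
proof -
  define h where "h = (1 - \<i>) / 2"
  define U where "U = {z. 0 + z \<notin> gint \<and> h + z \<notin> gint}"
  have U: "open U" "connected U" unfolding U_def by (rule open_connected_translates)+
  have hh: "h + h \<in> gint" by (simp add: h_def gint_def)
  define r where "r = (\<lambda>z. wp' z / (2 * wp z))"
  have prod: "wp (h + z) * wp z = - (we ^ 2)" if "z \<in> U" for z
    using wp_product[of z] that by (simp add: U_def h_def add.commute)
  then have nz: "wp z \<noteq> 0" "wp (h + z) \<noteq> 0" if "z \<in> U" for z
    using that we_nonzero by fastforce+
  define f where "f = (\<lambda>z. wzeta (h + z) - wzeta z - r z)"
  have "(f has_field_derivative 0) (at z)" if "z \<in> U" for z
  proof -
    have z: "z \<notin> gint" "h + z \<notin> gint" using that by (auto simp: U_def)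
    have "(f has_field_derivative - wp (h + z) - - wp z
        - ((6 * wp z ^ 2 + wk) * (2 * wp z) - wp' z * (2 * wp' z)) / ((2 * wp z) * (2 * wp z))) (at z)"
      unfolding f_def r_def using z nz[OF that]
      by (intro DERIV_diff DERIV_divide DERIV_cmult translate_deriv' wzeta_deriv wp_deriv wp'_deriv') auto
    also have "(6 * wp z ^ 2 + wk) * (2 * wp z) - wp' z * (2 * wp' z)
        = (6 * wp z ^ 2 + wk) * (2 * wp z) - 2 * wp' z ^ 2" by (simp add: power2_eq_square)
    also have "\<dots> = 4 * wp z ^ 3 + 4 * we ^ 2 * wp z"
      unfolding wp'_squared[OF z(1)] wk_eq by (simp add: algebra_simps eval_nat_numeral)
    also have "wp (h + z) = - (we ^ 2) / wp z"
      using prod[OF that] nz[OF that] by (subst nonzero_eq_divide_eq) auto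
    also have "- (- (we ^ 2) / wp z) - - wp z
        - (4 * wp z ^ 3 + 4 * we ^ 2 * wp z) / ((2 * wp z) * (2 * wp z)) = 0"
      using nz[OF that] by (simp add: field_simps eval_nat_numeral)
    finally show ?thesis .
  qed
  then have "f constant_on U" using U by (intro has_field_derivative_0_imp_constant_on)
  then obtain c where c: "\<And>z. z \<in> U \<Longrightarrow> f z = c" by (auto simp: constant_on_def)
  have zU: "z \<in> U" using assms by (simp add: U_def h_def add.commute)
  have per: "h + z + h = z + (h + h)" by simp
  have hzU: "h + z \<in> U"
    using zU hh by (simp add: U_def gint_add_left_iff flip: add.assoc)
  have "r (h + z) = - r z"
  proof -
    have "((\<lambda>w. wp (h + w) * wp w) has_field_derivative (wp' (h + z) * wp z + wp' z * wp (h + z))) (at z)"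
      using zU by (intro DERIV_mult translate_deriv' wp_deriv) (auto simp: U_def)
    moreover have "((\<lambda>w. wp (h + w) * wp w) has_field_derivative 0) (at z)"
      by (rule has_field_derivative_transform_within_open[OF DERIV_const U(1) zU]) (use prod in auto)
    ultimately have "wp' (h + z) * wp z + wp' z * wp (h + z) = 0" by (rule DERIV_unique)
    then show ?thesis using nz[OF zU]
      by (simp add: r_def field_simps) (simp add: eq_neg_iff_add_eq_0)
  qed
  \<comment> \<open>The \<open>r\<close> terms at z and h + z cancel, leaving zeta(z + 2h) -
    zeta(z), which Legendre's relation evaluates.\<close>
  moreover have "f (h + z) + f z = 2 * c" using c[OF hzU] c[OF zU] by simp
  moreover have "wzeta (h + (h + z)) = wzeta z + of_real pi * cnj (h + h)"
    using wzeta_translate[OF hh assms(1)] by (simp add: add_ac)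
  ultimately have "2 * c = of_real pi * cnj (h + h)" by (simp add: f_def)
  also have "\<dots> = 2 * (of_real pi * cnj h)" by simp
  finally have "c = of_real pi * cnj h" by simp
  then show ?thesis using c[OF zU] by (simp add: f_def r_def h_def algebra_simps)
qed

section \<open>The values at \<open>z0\<close>\<close>

text \<open>Since -z0 + (1-i)/2 = z0, the half-period formulas at -z0 combine with parity into
  equations for the values at \<open>z0\<close> alone.\<close>

definition z0 :: complex where "z0 = (1 - \<i>) / 4"

lemma z0_notin_gint: "z0 \<notin> gint" and minus_z0_notin_gint: "- z0 \<notin> gint"
  using Ints_nonzero_abs_less1[of "1/4 :: real"] by (auto simp: z0_def gint_def)

lemma wp_z0: "wp z0 ^ 2 = - (we ^ 2)"
proof -
  have "- z0 + (1 - \<i>) / 2 = z0" by (simp add: z0_def field_simps)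
  then show ?thesis
    using wp_product[of "- z0"] minus_z0_notin_gint z0_notin_gint
    by (simp add: wp_minus power2_eq_square)
qed

lemma wzeta_z0: "wzeta z0 - of_real pi * cnj z0 = - (wp' z0 / (4 * wp z0))"
proof -
  have "- z0 + (1 - \<i>) / 2 = z0" by (simp add: z0_def field_simps)
  moreover have "(1 - \<i>) / 2 = 2 * z0" by (simp add: z0_def)
  ultimately have "wzeta z0 = - wzeta z0 + - wp' z0 / (2 * wp z0) + of_real pi * cnj (2 * z0)"
    using wzeta_half_translate[of "- z0"] minus_z0_notin_gint z0_notin_gint
    by (simp add: wp_minus wp'_minus wzeta_minus)
  then have "2 * wzeta z0 = 2 * (of_real pi * cnj z0 - wp' z0 / (4 * wp z0))"
    by (simp add: algebra_simps)
  then have "wzeta z0 = of_real pi * cnj z0 - wp' z0 / (4 * wp z0)"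
    by (subst (asm) mult_cancel_left) simp
  then show ?thesis by simp
qed

section \<open>The real period and Gamma(1/4)\<close>

text \<open>On \<open>(0, 1/2]\<close> the function \<open>wp\<close> is real and decreases from \<open>\<infinity>\<close> to \<open>we\<close>.\<close>

definition rp :: "real \<Rightarrow> real" where "rp x = Re (wp (of_real x))"
definition rp' :: "real \<Rightarrow> real" where "rp' x = Re (wp' (of_real x))"

lemma of_real_notin_gint: "0 < x \<Longrightarrow> x < 1 \<Longrightarrow> complex_of_real x \<notin> gint"
  using Ints_nonzero_abs_less1[of x] by (auto simp: gint_def)

lemma wp_of_real: "wp (of_real x) = of_real (rp x)"
proof -
  have "Im (wp (of_real x)) = 0" using wp_cnj[of "of_real x"] by (simp add: complex_eq_iff)
  then show ?thesis by (simp add: rp_def complex_eq_iff)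
qed

lemma wp'_of_real:
  assumes "0 < x" "x < 1"
  shows "wp' (of_real x) = of_real (rp' x)"
proof -
  have "Im (wp' (of_real x)) = 0"
    using wp'_cnj[OF of_real_notin_gint[OF assms]] by (simp add: complex_eq_iff)
  then show ?thesis by (simp add: rp'_def complex_eq_iff)
qed

lemma rp_deriv:
  assumes "0 < x" "x < 1"
  shows "(rp has_real_derivative rp' x) (at x)"
proof -
  have "((\<lambda>x. wp (of_real x)) has_vector_derivative wp' (of_real x)) (at x)"
    by (intro has_vector_derivative_real_field wp_deriv of_real_notin_gint assms)
  then have "((\<lambda>x. Re (wp (of_real x))) has_vector_derivative Re (wp' (of_real x))) (at x)"
    by (rule bounded_linear.has_vector_derivative[OF bounded_linear_Re])
  then show ?thesis
    by (simp add: has_real_derivative_iff_has_vector_derivative rp_def[abs_def] rp'_def)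
qed

lemma rp_continuous_on: "S \<subseteq> {0<..<1} \<Longrightarrow> continuous_on S rp"
  by (intro continuous_at_imp_continuous_on ballI DERIV_isCont[OF rp_deriv]) auto

definition re :: real where "re = rp (1/2)"

lemma we_eq: "we = of_real re"
  using wp_of_real[of "1/2"] by (simp add: we_def re_def)

lemma rp'_squared:
  assumes "0 < x" "x < 1"
  shows "rp' x ^ 2 = 4 * rp x * (rp x ^ 2 - re ^ 2)"
proof -
  have "of_real (rp' x ^ 2) = (of_real (4 * rp x * (rp x ^ 2 - re ^ 2)) :: complex)"
    using wp'_squared[OF of_real_notin_gint[OF assms]]
    unfolding wp_of_real wp'_of_real[OF assms] wk_eq we_eq
    by (simp add: algebra_simps power2_eq_square power3_eq_cube)
  then show ?thesis by (simp only: of_real_eq_iff)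
qed

text \<open>A zero of wp' at x would give x and -x the same wp and wp', hence 2x in the lattice,
  while 0 < 2x < 1.\<close>

lemma rp'_nonzero:
  assumes "0 < x" "x < 1/2"
  shows "rp' x \<noteq> 0"
proof
  assume "rp' x = 0"
  then have "wp' (of_real x) = 0" using wp'_of_real[of x] assms by simp
  moreover have "complex_of_real x \<notin> gint" using assms by (intro of_real_notin_gint) auto
  ultimately have "of_real x - - of_real x \<in> gint"
    by (intro wp_determines_point) (auto simp: wp_minus wp'_minus)
  moreover have "of_real x - - of_real x = complex_of_real (2 * x)" by simp
  ultimately show False using of_real_notin_gint[of "2 * x"] assms by (simp del: of_real_mult)
qed

text \<open>Equal values of wp force wp' to agree up to sign, so x = y or x = -y modulo the lattice;
  both x - y and x + y are too small for anything but x = y.\<close>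

lemma rp_inj_on: "inj_on rp {0<..<1/2}"
proof
  fix x y assume xy: "x \<in> {0<..<1/2}" "y \<in> {0<..<1/2}" and eq: "rp x = rp y"
  have ng: "complex_of_real x \<notin> gint" "complex_of_real y \<notin> gint"
    using xy of_real_notin_gint[of x] of_real_notin_gint[of y] by auto
  have "rp' x ^ 2 = rp' y ^ 2" using xy eq by (simp add: rp'_squared)
  then consider "rp' x = rp' y" | "rp' x = - rp' y" by (auto simp: power2_eq_iff)
  then show "x = y"
  proof cases
    case 1
    then have "complex_of_real x - of_real y \<in> gint"
      using ng xy eq by (intro wp_determines_point) (auto simp: wp_of_real wp'_of_real)
    then have "x - y \<in> \<int>" by (simp add: gint_def)
    then show ?thesis using Ints_nonzero_abs_less1[of "x - y"] xy by auto
  next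
    case 2
    then have "complex_of_real x - - of_real y \<in> gint"
      using ng xy eq by (intro wp_determines_point) (auto simp: wp_of_real wp'_of_real wp_minus wp'_minus)
    then have "x + y \<in> \<int>" by (simp add: gint_def)
    then show ?thesis using Ints_nonzero_abs_less1[of "x + y"] xy by auto
  qed
qed

lemma rp_large:
  assumes "0 < x"
  obtains y where "0 < y" "y < x" "rp y > B"
proof -
  have "((\<lambda>y::real. (of_real y)\<^sup>2 * wp (of_real y)) \<longlongrightarrow> 1) (at_right 0)"
  proof (rule filterlim_compose[OF wp_asymptotic])
    show "filterlim complex_of_real (at 0) (at_right 0)"
      unfolding filterlim_at by (auto intro!: tendsto_eq_intros simp: eventually_at_filter)
  qed
  then have "((\<lambda>y. Re ((of_real y)\<^sup>2 * wp (of_real y))) \<longlongrightarrow> Re 1) (at_right 0)"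
    by (rule tendsto_Re)
  also have "(\<lambda>y. Re ((of_real y)\<^sup>2 * wp (of_real y))) = (\<lambda>y. y\<^sup>2 * rp y)"
    by (simp add: wp_of_real flip: of_real_power of_real_mult)
  finally have "((\<lambda>y. y\<^sup>2 * rp y) \<longlongrightarrow> 1) (at_right 0)" by simp
  then have e1: "\<forall>\<^sub>F y in at_right 0. y\<^sup>2 * rp y > 1/2" by (rule order_tendstoD) simp
  have "((\<lambda>y::real. y\<^sup>2 * \<bar>B\<bar>) \<longlongrightarrow> 0\<^sup>2 * \<bar>B\<bar>) (at_right 0)" by (intro tendsto_intros)
  then have e2: "\<forall>\<^sub>F y in at_right 0. y\<^sup>2 * \<bar>B\<bar> < 1/2" by (rule order_tendstoD) simp
  have e3: "\<forall>\<^sub>F y in at_right 0. y \<in> {0<..<x}"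
    using assms by (rule eventually_at_right_real)
  obtain y where y: "y\<^sup>2 * rp y > 1/2" "y\<^sup>2 * \<bar>B\<bar> < 1/2" "0 < y" "y < x"
    using eventually_happens[OF eventually_conj[OF e1 eventually_conj[OF e2 e3]]] by auto
  then have "y\<^sup>2 * \<bar>B\<bar> < y\<^sup>2 * rp y" by linarith
  then have "rp y > B" using y(3) by (simp add: mult_less_cancel_left_pos)
  then show ?thesis using that y by blast
qed

text \<open>\<open>rp\<close> is large near 0, so falling to |re| or below would mean taking the
  value |re| somewhere in between; there rp' = 0 by the cubic relation.\<close>

lemma rp_gt_abs_re:
  assumes "0 < x" "x < 1/2"
  shows "\<bar>re\<bar> < rp x"
proof (rule ccontr)
  assume "\<not> ?thesis"
  moreover obtain y where y: "0 < y" "y < x" "rp y > \<bar>re\<bar>" using rp_large[OF assms(1)] by blast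
  moreover have "continuous_on {y..x} rp" using assms y by (intro rp_continuous_on) auto
  ultimately obtain w where w: "y \<le> w" "w \<le> x" "rp w = \<bar>re\<bar>"
    using IVT2'[of rp x "\<bar>re\<bar>" y] by auto
  then have "rp' w ^ 2 = 0" using rp'_squared[of w] y assms by simp
  then show False using rp'_nonzero[of w] w y assms by simp
qed

text \<open>Letting x tend to 1/2 from the left gives |re| \<le> re, and re is nonzero.\<close>

lemma re_pos: "re > 0"
proof -
  have "(rp \<longlongrightarrow> rp (1/2)) (at_left (1/2))"
    using DERIV_isCont[OF rp_deriv[of "1/2"]] by (auto simp: isCont_def intro: filterlim_at_split[THEN iffD1, THEN conjunct1])
  moreover have "\<forall>\<^sub>F x in at_left (1/2 :: real). x \<in> {0<..<1/2}"
    by (rule eventually_at_left_real) simp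
  then have "\<forall>\<^sub>F x in at_left (1/2). \<bar>re\<bar> \<le> rp x"
    by eventually_elim (auto intro!: less_imp_le rp_gt_abs_re)
  ultimately have "\<bar>re\<bar> \<le> rp (1/2)" by (intro tendsto_lowerbound) auto
  moreover have "re \<noteq> 0" using we_nonzero we_eq by auto
  ultimately show ?thesis by (simp add: re_def)
qed

text \<open>The half period 1/2 is an elliptic integral in wp; the substitution t = (e/wp)^2 turns
  it into the Beta integral B(1/4, 1/2), so 2 sqrt e = B(1/4, 1/2).\<close>

lemma re_eq: "re = Gamma (1/4) ^ 4 / (8 * pi)"
proof -
  define v where "v = (\<lambda>x. (re / rp x) ^ 2)"
  define v' where "v' = (\<lambda>x. - 2 * re ^ 2 * rp' x / rp x ^ 3)"
  define f :: "real \<Rightarrow> real" where "f = (\<lambda>t. t powr (1/4 - 1) * (1 - t) powr (1/2 - 1))"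
  have gt: "re < rp x" "0 < rp x" if "x \<in> {0<..<1/2}" for x
    using rp_gt_abs_re[of x] that re_pos by auto
  have der: "(v has_field_derivative v' x) (at x within {0<..<1/2})" if "x \<in> {0<..<1/2}" for x
  proof -
    have "(rp has_field_derivative rp' x) (at x within {0<..<1/2})"
      using rp_deriv[of x] that by (auto intro: has_field_derivative_at_within)
    then show ?thesis
      unfolding v_def v'_def using gt[OF that]
      by (auto intro!: derivative_eq_intros simp: field_simps eval_nat_numeral)
  qed
  have inj: "inj_on v {0<..<1/2}"
  proof
    fix x y assume xy: "x \<in> {0<..<1/2}" "y \<in> {0<..<1/2}" "v x = v y"
    then have "re / rp x = re / rp y"
      using gt[OF xy(1)] gt[OF xy(2)] re_pos unfolding v_def by (subst (asm) power2_eq_iff_nonneg) auto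
    then have "rp x = rp y" using gt[OF xy(1)] gt[OF xy(2)] re_pos by (simp add: field_simps)
    then show "x = y" using rp_inj_on xy by (auto dest: inj_onD)
  qed
  have img: "v ` {0<..<1/2} = {0<..<1}"
  proof (intro equalityI subsetI)
    fix t assume "t \<in> v ` {0<..<1/2}"
    then obtain x where x: "x \<in> {0<..<1/2}" "t = (re / rp x) ^ 2" by (auto simp: v_def)
    moreover have r: "0 < re / rp x" "re / rp x < 1" using gt[OF x(1)] re_pos by auto
    moreover have "(re / rp x) ^ 2 < 1 ^ 2" using r by (intro power_strict_mono) auto
    ultimately show "t \<in> {0<..<1}" using gt[OF x(1)] re_pos by auto
  next
    fix t :: real assume t: "t \<in> {0<..<1}"
    define q where "q = re / sqrt t"
    have q: "q > re" using t re_pos by (simp add: q_def field_simps real_sqrt_less_iff)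
    obtain y where y: "0 < y" "y < 1/2" "rp y > q" using rp_large[of "1/2" q] by auto
    have "continuous_on {y..1/2} rp" using y by (intro rp_continuous_on) auto
    then obtain x where x: "y \<le> x" "x \<le> 1/2" "rp x = q"
      using IVT2'[of rp "1/2" q y] y q by (auto simp: re_def)
    have "x \<noteq> 1/2" using x(3) q unfolding re_def by (metis less_irrefl)
    moreover have "v x = t" using x t re_pos by (simp add: v_def q_def)
    ultimately show "t \<in> v ` {0<..<1/2}" using x y by (intro image_eqI[of _ _ x]) auto
  qed
  \<comment> \<open>The cubic relation gives |wp'| = 2 sqrt(wp) sqrt(wp^2 - e^2), after which all
    dependence on wp cancels.\<close>
  have const: "\<bar>v' x\<bar> * f (v x) = 4 * sqrt re" if x: "x \<in> {0<..<1/2}" for x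
  proof -
    define q where "q = rp x"
    have q: "re < q" "0 < q" using gt[OF x] by (auto simp: q_def)
    define d where "d = sqrt (q\<^sup>2 - re\<^sup>2)"
    have d: "d > 0" using q re_pos by (simp add: d_def power_strict_mono)
    have d2: "d\<^sup>2 = q\<^sup>2 - re\<^sup>2" using q re_pos by (simp add: d_def power_mono)
    have "\<bar>rp' x\<bar> = sqrt (rp' x ^ 2)" by simp
    also have "rp' x ^ 2 = (2 * sqrt q * d)\<^sup>2"
      using rp'_squared[of x] x q d2 by (simp add: q_def power_mult_distrib)
    finally have rp': "\<bar>rp' x\<bar> = 2 * sqrt q * d" using q d by simp
    have v: "v x = (re / q)\<^sup>2" by (simp add: v_def q_def)
    have "v x powr (1/4 - 1) = (q / re) powr (3/2)"
    proof -
      have "v x = (q / re) powr (- 2)"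
        using q re_pos by (simp add: v powr_minus powr_numeral power_divide)
      then show ?thesis by (simp add: powr_powr)
    qed
    also have "\<dots> = q / re * sqrt (q / re)"
      using q re_pos powr_add[of "q / re" 1 "1/2"] by (simp add: powr_half_sqrt)
    finally have p1: "v x powr (1/4 - 1) = q / re * sqrt (q / re)" .
    have "1 - v x = (d / q)\<^sup>2"
      using q by (simp add: v d2 power_divide field_simps)
    then have p2: "(1 - v x) powr (1/2 - 1) = q / d"
      using q d by (simp add: powr_minus powr_half_sqrt)
    have "\<bar>v' x\<bar> * f (v x) = (2 * re\<^sup>2 * (2 * sqrt q * d) / q ^ 3) * ((q / re * sqrt (q / re)) * (q / d))"
      unfolding f_def p1 p2 using q rp' by (simp add: v'_def q_def abs_mult)
    also have "\<dots> = 4 * (re * sqrt q * sqrt (q / re)) / q"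
      using q re_pos d by (simp add: field_simps eval_nat_numeral)
    also have "re * sqrt q * sqrt (q / re) = q * sqrt re"
    proof -
      have "re = sqrt re * sqrt re" "q = sqrt q * sqrt q" using re_pos q by auto
      then show ?thesis using re_pos q by (simp add: real_sqrt_divide field_simps)
    qed
    finally show ?thesis using q by simp
  qed
  have int1: "((\<lambda>x. \<bar>v' x\<bar> * f (v x)) has_integral 4 * sqrt re * (1/2)) {0<..<1/2}"
  proof (rule has_integral_eq[of _ "\<lambda>_. 4 * sqrt re"])
    have "((\<lambda>_. 4 * sqrt re) has_integral 4 * sqrt re * (1/2)) {0..1/2 :: real}"
      using has_integral_const_real[of "4 * sqrt re" 0 "1/2"] by simp
    then show "((\<lambda>_. 4 * sqrt re) has_integral 4 * sqrt re * (1/2)) {0<..<1/2 :: real}"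
      by (simp only: has_integral_Icc_iff_Ioo)
  qed (use const in auto)
  then have "(\<lambda>x. \<bar>v' x\<bar> * f (v x)) absolutely_integrable_on {0<..<1/2}"
    using const re_pos by (intro nonnegative_absolutely_integrable_1) auto
  then have "integral (v ` {0<..<1/2}) f = 4 * sqrt re * (1/2)"
    using has_absolute_integral_change_of_variables_1'[of "{0<..<1/2}" v v' f "4 * sqrt re * (1/2)", OF _ der inj]
      int1 by (auto simp: integral_unique)
  moreover have "integral {0<..<1} f = Beta (1/4) (1/2)"
    unfolding f_def integral_open_interval_real[symmetric]
    using has_integral_Beta_real[of "1/4" "1/2"] by (intro integral_unique) simp
  ultimately have beta: "2 * sqrt re = Beta (1/4) (1/2)" by (simp add: img)
  \<comment> \<open>The reflection formula at 1/4 eliminates the Gamma(3/4) in the denominator of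
    the Beta value.\<close>
  have refl: "Gamma (1/4) * Gamma (3/4) = (pi * sqrt 2 :: real)"
  proof -
    have "Gamma (complex_of_real (1/4)) * Gamma (complex_of_real (3/4))
        = of_real pi / sin (of_real (pi / 4))"
      using Gamma_reflection_complex[of "1/4"] by simp
    also have "\<dots> = of_real (pi / sin (pi / 4))" by (subst sin_of_real) (rule of_real_divide[symmetric])
    finally have "complex_of_real (Gamma (1/4) * Gamma (3/4)) = of_real (pi / sin (pi / 4))"
      by (simp only: Gamma_complex_of_real of_real_mult)
    then have "Gamma (1/4) * Gamma (3/4) = pi / sin (pi / 4)" by (simp only: of_real_eq_iff)
    also have "\<dots> = pi * sqrt 2" by (simp add: sin_45 real_div_sqrt field_simps)
    finally show ?thesis .
  qed
  have G34: "Gamma (3/4 :: real) > 0" "Gamma (1/4 :: real) > 0" by (auto intro: Gamma_real_pos)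
  have "2 * sqrt re = Gamma (1/4) * sqrt pi / Gamma (3/4)"
    using beta by (simp add: Beta_def Gamma_one_half_real)
  also have "\<dots> = Gamma (1/4) ^ 2 * sqrt pi / (pi * sqrt 2)"
    unfolding refl[symmetric] using G34 by (simp add: power2_eq_square)
  finally have "(2 * sqrt re) ^ 2 = (Gamma (1/4) ^ 2 * sqrt pi / (pi * sqrt 2)) ^ 2" by simp
  then have "4 * re = Gamma (1/4) ^ 4 * pi / (pi ^ 2 * 2)"
    using re_pos by (simp add: power_mult_distrib power_divide flip: power_mult)
  then show ?thesis by (simp add: field_simps power2_eq_square)
qed

section \<open>Homogeneity of Taylor coefficients at \<open>z0\<close>\<close>

definition gauss_rat :: "complex set" where
  "gauss_rat = {z. Re z \<in> \<rat> \<and> Im z \<in> \<rat>}"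

lemma gauss_rat_simps [simp]:
  "0 \<in> gauss_rat" "1 \<in> gauss_rat" "\<i> \<in> gauss_rat" "of_nat n \<in> gauss_rat" "of_int i \<in> gauss_rat"
  "numeral k \<in> gauss_rat" "- 1 \<in> gauss_rat" "- numeral k \<in> gauss_rat"
  by (auto simp: gauss_rat_def)

lemma fact_in_gauss_rat [simp]: "fact n \<in> gauss_rat"
  using gauss_rat_simps(4)[of "fact n"] by simp

lemma gauss_rat_closed [intro!]:
  assumes "a \<in> gauss_rat"
  shows "b \<in> gauss_rat \<Longrightarrow> a + b \<in> gauss_rat" "b \<in> gauss_rat \<Longrightarrow> a - b \<in> gauss_rat"
    "b \<in> gauss_rat \<Longrightarrow> a * b \<in> gauss_rat" "- a \<in> gauss_rat" "cnj a \<in> gauss_rat"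
    "inverse a \<in> gauss_rat"
  using assms by (auto simp: gauss_rat_def)

lemma gauss_rat_divide [intro!]: "a \<in> gauss_rat \<Longrightarrow> b \<in> gauss_rat \<Longrightarrow> a / b \<in> gauss_rat"
  unfolding divide_inverse by (intro gauss_rat_closed)

lemma gauss_rat_power [intro!]: "a \<in> gauss_rat \<Longrightarrow> a ^ n \<in> gauss_rat"
  by (induction n) auto

lemma z0_in_gauss_rat: "z0 \<in> gauss_rat" "cnj z0 \<in> gauss_rat"
  unfolding z0_def by (intro gauss_rat_closed gauss_rat_divide; simp)+

text \<open>Weight is counted in units of sqrt e rather than e, because wp' and zeta contribute
  half-integral powers of e.\<close>

definition weight :: "nat \<Rightarrow> complex set" where
  "weight n = (\<lambda>c. c * of_real (sqrt re) ^ n) ` gauss_rat"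

lemma weightI: "c \<in> gauss_rat \<Longrightarrow> z = c * of_real (sqrt re) ^ n \<Longrightarrow> z \<in> weight n"
  by (auto simp: weight_def)

lemma weight_0 [simp]: "0 \<in> weight n"
  by (rule weightI[of 0]) auto

lemma weight_add: "a \<in> weight n \<Longrightarrow> b \<in> weight n \<Longrightarrow> a + b \<in> weight n"
  by (auto simp: weight_def simp flip: distrib_right)

lemma weight_mult: "a \<in> weight m \<Longrightarrow> b \<in> weight n \<Longrightarrow> a * b \<in> weight (m + n)"
proof -
  assume "a \<in> weight m" "b \<in> weight n"
  then obtain c d where "c \<in> gauss_rat" "d \<in> gauss_rat"
    "a = c * of_real (sqrt re) ^ m" "b = d * of_real (sqrt re) ^ n" by (auto simp: weight_def)
  then show ?thesis by (intro weightI[of "c * d"]) (auto simp: power_add)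
qed

lemma weight_cmult: "c \<in> gauss_rat \<Longrightarrow> a \<in> weight n \<Longrightarrow> c * a \<in> weight n"
  by (auto simp: weight_def simp flip: mult.assoc)

lemma weight_sum: "(\<And>i. i \<in> A \<Longrightarrow> f i \<in> weight n) \<Longrightarrow> sum f A \<in> weight n"
  by (induction A rule: infinite_finite_induct) (auto intro: weight_add)

lemma weight_cancel:
  assumes "c * a \<in> weight n" "c \<in> gauss_rat" "c \<noteq> 0"
  shows "a \<in> weight n"
proof -
  have "inverse c * (c * a) \<in> weight n" using assms by (intro weight_cmult[of _ "c * a"]) auto
  also have "inverse c * (c * a) = a" using assms(3) by simp
  finally show ?thesis .
qed

lemma of_real_sqrt_re_power: "complex_of_real (sqrt re) ^ 2 = we"
  using re_pos by (simp add: we_eq flip: of_real_power)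

text \<open>wp(z0)^2 = -e^2 and the cubic relation give wp'(z0)^2 = -8 e^2 wp(z0), whose root is
  explicit because (1 - si)^2 = -2si. The signs stay open; they do not affect membership in
  Q(i).\<close>

lemma values_z0:
  obtains s t :: complex where "s \<in> {1, -1}" "t \<in> {1, -1}"
    "wp z0 = s * \<i> * of_real (sqrt re) ^ 2"
    "wp' z0 = 2 * t * (1 - s * \<i>) * of_real (sqrt re) ^ 3"
proof -
  define d where "d = complex_of_real (sqrt re)"
  have d2: "d ^ 2 = we" unfolding d_def by (rule of_real_sqrt_re_power)
  have "wp z0 ^ 2 = (\<i> * d ^ 2) ^ 2" using wp_z0 by (simp add: power_mult_distrib d2)
  then have "wp z0 = \<i> * d ^ 2 \<or> wp z0 = - (\<i> * d ^ 2)" by (simp only: power2_eq_iff)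
  then obtain s where s: "s \<in> {1, -1}" "wp z0 = s * \<i> * d ^ 2" by force
  have s2: "s ^ 2 = 1" using s by auto
  have "wp' z0 ^ 2 = 4 * wp z0 * wp z0 ^ 2 - 4 * we ^ 2 * wp z0"
    unfolding wp'_squared[OF z0_notin_gint] wk_eq by (simp add: power2_eq_square power3_eq_cube)
  also have "\<dots> = - 8 * we ^ 2 * wp z0" unfolding wp_z0 by simp
  also have "\<dots> = - 8 * s * \<i> * d ^ 6" unfolding s(2) d2[symmetric] by (simp add: eval_nat_numeral)
  also have "\<dots> = (2 * (1 - s * \<i>) * d ^ 3) ^ 2"
  proof -
    have "(1 - s * \<i>) ^ 2 = 1 - 2 * s * \<i> + s ^ 2 * \<i> ^ 2" by (simp add: power2_eq_square algebra_simps)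
    also have "\<dots> = - 2 * s * \<i>" using s2 by simp
    finally have "(1 - s * \<i>) ^ 2 = - 2 * s * \<i>" .
    then show ?thesis unfolding power_mult_distrib by (simp flip: power_mult)
  qed
  finally have "wp' z0 = 2 * (1 - s * \<i>) * d ^ 3 \<or> wp' z0 = - (2 * (1 - s * \<i>) * d ^ 3)"
    by (simp only: power2_eq_iff)
  then obtain t where t: "t \<in> {1, -1}" "wp' z0 = 2 * t * (1 - s * \<i>) * d ^ 3"
  proof (elim disjE)
    assume "wp' z0 = 2 * (1 - s * \<i>) * d ^ 3"
    then show thesis by (intro that[of 1]) simp_all
  next
    assume "wp' z0 = - (2 * (1 - s * \<i>) * d ^ 3)"
    then show thesis by (intro that[of "- 1"]) (simp_all add: algebra_simps)
  qed
  show ?thesis using that[OF s(1) t(1)] s t by (simp add: d_def)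
qed

lemma wp_z0_weight: "wp z0 \<in> weight 2"
  and wp'_z0_weight: "wp' z0 \<in> weight 3"
  and wzeta_z0_weight: "wzeta z0 - of_real pi * cnj z0 \<in> weight 1"
proof -
  obtain s t :: complex where st: "s \<in> {1, -1}" "t \<in> {1, -1}"
    and wp: "wp z0 = s * \<i> * of_real (sqrt re) ^ 2"
    and wp': "wp' z0 = 2 * t * (1 - s * \<i>) * of_real (sqrt re) ^ 3"
    by (rule values_z0)
  have q: "s \<in> gauss_rat" "t \<in> gauss_rat" using st by auto
  show "wp z0 \<in> weight 2" using wp q by (intro weightI[of "s * \<i>"]) auto
  show "wp' z0 \<in> weight 3"
    using wp' q by (intro weightI[of "2 * t * (1 - s * \<i>)"]) auto
  show "wzeta z0 - of_real pi * cnj z0 \<in> weight 1"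
  proof (rule weightI)
    show "- (2 * t * (1 - s * \<i>) / (4 * (s * \<i>))) \<in> gauss_rat" using q by auto
    show "wzeta z0 - of_real pi * cnj z0
        = - (2 * t * (1 - s * \<i>) / (4 * (s * \<i>))) * of_real (sqrt re) ^ 1"
      unfolding wzeta_z0 wp wp' using st(1) re_pos by (auto simp: field_simps eval_nat_numeral)
  qed
qed

text \<open>The functions all of whose Taylor coefficients at \<open>z0\<close> have the weight that
  homogeneity predicts.\<close>

definition homog :: "nat \<Rightarrow> (complex \<Rightarrow> complex) \<Rightarrow> bool" where
  "homog n f \<longleftrightarrow> f holomorphic_on - gint \<and> (\<forall>k. (deriv ^^ k) f z0 \<in> weight (n + k))"

lemma z0_Compl: "z0 \<in> - gint" using z0_notin_gint by simp

lemma homog_add: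
  assumes "homog n f" "homog n g"
  shows "homog n (\<lambda>z. f z + g z)"
  using assms unfolding homog_def
  by (auto intro!: holomorphic_intros weight_add
      simp: higher_deriv_add[OF _ _ open_Compl_gint z0_Compl])

lemma homog_cmult:
  assumes "homog n f" "c \<in> gauss_rat"
  shows "homog n (\<lambda>z. c * f z)"
  using assms unfolding homog_def
  by (auto intro!: holomorphic_intros weight_cmult
      simp: higher_deriv_cmult[OF _ z0_Compl open_Compl_gint])

lemma homog_mult:
  assumes "homog m f" "homog n g"
  shows "homog (m + n) (\<lambda>z. f z * g z)"
  unfolding homog_def
proof (intro conjI allI)
  have hol: "f holomorphic_on - gint" "g holomorphic_on - gint" using assms by (auto simp: homog_def)
  then show "(\<lambda>z. f z * g z) holomorphic_on - gint" by (intro holomorphic_intros)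
  fix k
  have "of_nat (k choose i) * (deriv ^^ i) f z0 * (deriv ^^ (k - i)) g z0 \<in> weight (m + n + k)"
    if "i \<in> {0..k}" for i
  proof -
    have "(deriv ^^ i) f z0 * (deriv ^^ (k - i)) g z0 \<in> weight ((m + i) + (n + (k - i)))"
      using assms by (intro weight_mult) (auto simp: homog_def)
    also have "(m + i) + (n + (k - i)) = m + n + k" using that by auto
    finally show ?thesis unfolding mult.assoc by (rule weight_cmult[rotated]) simp
  qed
  then show "(deriv ^^ k) (\<lambda>z. f z * g z) z0 \<in> weight (m + n + k)"
    unfolding higher_deriv_mult[OF hol open_Compl_gint z0_Compl] by (rule weight_sum)
qed

text \<open>The two initial values have the right weights, and the quadratic recurrence from wp'' =
  6 wp^2 + wk preserves weight.\<close>

lemma homog_wp: "homog 2 wp"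
  unfolding homog_def
proof (intro conjI allI)
  show "wp holomorphic_on - gint" by (intro wp_holomorphic) auto
  show "(deriv ^^ k) wp z0 \<in> weight (2 + k)" for k
  proof (induction k rule: less_induct)
    case (less k)
    consider "k = 0" | "k = 1" | n where "k = Suc (Suc n)"
      by (metis One_nat_def not0_implies_Suc)
    then show ?case
    proof cases
      case 1
      then show ?thesis using wp_z0_weight by simp
    next
      case 2
      then show ?thesis
        using wp'_z0_weight DERIV_imp_deriv[OF wp_deriv[OF z0_notin_gint]] by (simp add: eval_nat_numeral)
    next
      case (3 n)
      have "of_nat (n choose i) * (deriv ^^ i) wp z0 * (deriv ^^ (n - i)) wp z0 \<in> weight (2 + k)"
        if "i \<in> {0..n}" for i
      proof -
        have "(deriv ^^ i) wp z0 * (deriv ^^ (n - i)) wp z0 \<in> weight ((2 + i) + (2 + (n - i)))"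
          using 3 that by (intro weight_mult less.IH) auto
        also have "(2 + i) + (2 + (n - i)) = 2 + k" using that 3 by auto
        finally show ?thesis unfolding mult.assoc by (rule weight_cmult[rotated]) simp
      qed
      then have "(\<Sum>i = 0..n. of_nat (n choose i) * (deriv ^^ i) wp z0 * (deriv ^^ (n - i)) wp z0)
          \<in> weight (2 + k)" by (rule weight_sum)
      then have "6 * (\<Sum>i = 0..n. of_nat (n choose i) * (deriv ^^ i) wp z0 * (deriv ^^ (n - i)) wp z0)
          \<in> weight (2 + k)" by (rule weight_cmult[rotated]) simp
      \<comment> \<open>The constant enters only for k = 2, where weight 4 is required;
        \<open>wk\<close> is -2 (sqrt e)^4.\<close>
      moreover have "(if n = 0 then wk else 0) \<in> weight (2 + k)"
      proof (cases "n = 0")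
        case True
        have "wk = - 2 * of_real (sqrt re) ^ 4"
          unfolding wk_eq of_real_sqrt_re_power[symmetric] by (simp flip: power_mult)
        then have "wk \<in> weight 4" by (intro weightI[of "- 2"]) auto
        then show ?thesis using True 3 by (simp add: eval_nat_numeral)
      qed auto
      moreover have "(deriv ^^ k) wp z0 = 6 * (\<Sum>i = 0..n. of_nat (n choose i) * (deriv ^^ i) wp z0
          * (deriv ^^ (n - i)) wp z0) + (if n = 0 then wk else 0)"
        unfolding 3 using open_Compl_gint z0_Compl
        by (rule ode_higher_deriv) (auto intro: wp_deriv wp'_deriv')
      ultimately show ?thesis by (simp only: weight_add)
    qed
  qed
qed

lemma homog_wp': "homog 3 wp'"
  unfolding homog_def
proof (intro conjI allI)
  show "wp' holomorphic_on - gint" by (intro wp'_holomorphic) auto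
  fix k
  have "(deriv ^^ k) wp' z0 = (deriv ^^ k) (deriv wp) z0"
    using z0_notin_gint by (intro higher_deriv_cong_Compl_gint DERIV_imp_deriv[symmetric] wp_deriv)
  also have "\<dots> = (deriv ^^ Suc k) wp z0" by (simp add: funpow_Suc_right del: funpow.simps)
  also have "\<dots> \<in> weight (2 + Suc k)" using homog_wp by (simp only: homog_def)
  finally show "(deriv ^^ k) wp' z0 \<in> weight (3 + k)" by (simp add: eval_nat_numeral)
qed

text \<open>The shift by pi cnj z0 makes the value at z0 homogeneous and, in the sums derived below,
  replaces cnj l by cnj l - cnj z0.\<close>

definition uz :: "complex \<Rightarrow> complex" where "uz z = wzeta z - of_real pi * cnj z0"

lemma uz_holomorphic: "uz holomorphic_on - gint"
  unfolding uz_def[abs_def] by (intro holomorphic_intros wzeta_holomorphic) auto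

lemma homog_uz: "homog 1 uz"
  unfolding homog_def
proof (intro conjI allI uz_holomorphic)
  fix k
  show "(deriv ^^ k) uz z0 \<in> weight (1 + k)"
  proof (cases k)
    case 0
    then show ?thesis using wzeta_z0_weight by (simp add: uz_def)
  next
    case (Suc n)
    have "(deriv ^^ k) uz z0 = (deriv ^^ n) (deriv uz) z0"
      by (simp add: Suc funpow_Suc_right del: funpow.simps)
    also have "\<dots> = (deriv ^^ n) (\<lambda>z. - 1 * wp z) z0"
      using z0_notin_gint wzeta_deriv
      by (intro higher_deriv_cong_Compl_gint DERIV_imp_deriv)
         (auto simp: uz_def[abs_def] intro!: derivative_eq_intros)
    also have "\<dots> \<in> weight (2 + n)"
      using homog_cmult[OF homog_wp, of "- 1"] unfolding homog_def by auto
    finally show ?thesis by (simp add: Suc eval_nat_numeral)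
  qed
qed

text \<open>\<open>uQ2\<close> and \<open>uQ3\<close> are \<open>wQ2\<close> and \<open>wQ3\<close>
  with \<open>uz\<close> in place of \<open>wzeta\<close>, written as sums of multiples so that the
  closure rules for \<open>homog\<close> apply directly.\<close>

definition uQ2 :: "complex \<Rightarrow> complex" where
  "uQ2 z = 1/2 * (uz z * uz z + - 1 * wp z)"

definition uQ3 :: "complex \<Rightarrow> complex" where
  "uQ3 z = 1/6 * (uz z * (uz z * uz z) + - 3 * (uz z * wp z) + - 1 * wp' z)"

lemma homog_uQ2: "homog 2 uQ2"
proof -
  have "homog 2 (\<lambda>z. uz z * uz z)"
    using homog_mult[OF homog_uz homog_uz] by (simp only: one_add_one)
  then show ?thesis
    unfolding uQ2_def[abs_def] by (intro homog_cmult homog_add homog_wp) auto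
qed

lemma homog_uQ3: "homog 3 uQ3"
proof -
  have 2: "homog 2 (\<lambda>z. uz z * uz z)"
    using homog_mult[OF homog_uz homog_uz] by (simp only: one_add_one)
  have 3: "1 + 2 = (3 :: nat)" by simp
  have "homog 3 (\<lambda>z. uz z * (uz z * uz z))" "homog 3 (\<lambda>z. uz z * wp z)"
    using homog_mult[OF homog_uz 2] homog_mult[OF homog_uz homog_wp] unfolding 3 .
  then show ?thesis
    unfolding uQ3_def[abs_def] by (intro homog_cmult homog_add homog_wp') auto
qed

lemma uz_higher_deriv:
  "(deriv ^^ (n + 2)) uz z0 = (- 1) ^ n * of_nat (fact (n + 2)) * eis (n + 3) z0"
proof -
  have "(deriv ^^ (n + 2)) uz z0
      = (deriv ^^ (n + 2)) wzeta z0 - (deriv ^^ (n + 2)) (\<lambda>_. of_real pi * cnj z0) z0"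
    unfolding uz_def[abs_def]
    by (intro higher_deriv_diff[where S = "- gint"] holomorphic_intros wzeta_holomorphic
        open_Compl_gint z0_Compl) auto
  then show ?thesis using wzeta_higher_deriv[OF z0_notin_gint, of n] by simp
qed

text \<open>With c = pi cnj z0, uQ2 = wQ2 - c wzeta + c^2/2; differentiation removes the constant
  and turns the rest into the sum with cnj l - cnj z0.\<close>

lemma uQ2_higher_deriv:
  "(deriv ^^ (n + 3)) uQ2 z0 = of_real pi *
     ((- 1) ^ Suc n * of_nat (fact (n + 3)) * (eis1 (n + 4) z0 - cnj z0 * eis (n + 4) z0))"
proof -
  define c where "c = of_real pi * cnj z0"
  note hol = wQ2_holomorphic wzeta_holomorphic[of "- gint"]
  have eq: "uQ2 = (\<lambda>z. wQ2 z - c * wzeta z + c ^ 2 / 2)"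
    by (auto simp: fun_eq_iff uQ2_def wQ2_def uz_def c_def power2_eq_square field_simps)
  have "(deriv ^^ (n + 3)) uQ2 z0 =
      (deriv ^^ (n + 3)) (\<lambda>z. wQ2 z - c * wzeta z) z0 + (deriv ^^ (n + 3)) (\<lambda>_. c ^ 2 / 2) z0"
    unfolding eq by (intro higher_deriv_add[where S = "- gint"] holomorphic_intros hol
        open_Compl_gint z0_Compl) auto
  also have "(deriv ^^ (n + 3)) (\<lambda>z. wQ2 z - c * wzeta z) z0
      = (deriv ^^ (n + 3)) wQ2 z0 - (deriv ^^ (n + 3)) (\<lambda>z. c * wzeta z) z0"
    by (intro higher_deriv_diff[where S = "- gint"] holomorphic_intros hol open_Compl_gint z0_Compl) auto
  also have "(deriv ^^ (n + 3)) (\<lambda>z. c * wzeta z) z0 = c * (deriv ^^ (n + 3)) wzeta z0"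
    by (intro higher_deriv_cmult[where A = "- gint"] hol open_Compl_gint z0_Compl) auto
  also have "(deriv ^^ (n + 3)) wzeta z0 = (- 1) ^ Suc n * of_nat (fact (n + 3)) * eis (n + 4) z0"
  proof -
    have "Suc n + 2 = n + 3" "Suc n + 3 = n + 4" by simp_all
    then show ?thesis using wzeta_higher_deriv[OF z0_notin_gint, of "Suc n"] by (simp only:)
  qed
  also note wQ2_higher_deriv[OF z0_notin_gint]
  finally show ?thesis by (simp add: c_def algebra_simps)
qed

text \<open>Likewise uQ3 = wQ3 - c wQ2 + (c^2/2) wzeta - c^3/6, whose derivatives assemble the
  square (cnj l - cnj z0)^2.\<close>

lemma uQ3_higher_deriv:
  "(deriv ^^ (n + 4)) uQ3 z0 = of_real pi ^ 2 * ((- 1) ^ n * of_nat (fact (n + 4)) / 2 *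
     (eis2 (n + 5) z0 - 2 * cnj z0 * eis1 (n + 5) z0 + cnj z0 ^ 2 * eis (n + 5) z0))"
proof -
  define c where "c = of_real pi * cnj z0"
  note hol = wQ3_holomorphic wQ2_holomorphic wzeta_holomorphic[of "- gint"]
  have eq: "uQ3 = (\<lambda>z. (wQ3 z - c * wQ2 z) + c ^ 2 / 2 * wzeta z + - (c ^ 3) / 6)"
    by (auto simp: fun_eq_iff uQ3_def wQ3_def wQ2_def uz_def c_def power2_eq_square power3_eq_cube
        field_simps)
  have "(deriv ^^ (n + 4)) uQ3 z0 =
      (deriv ^^ (n + 4)) (\<lambda>z. (wQ3 z - c * wQ2 z) + c ^ 2 / 2 * wzeta z) z0
      + (deriv ^^ (n + 4)) (\<lambda>_. - (c ^ 3) / 6) z0"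
    unfolding eq by (intro higher_deriv_add[where S = "- gint"] holomorphic_intros hol
        open_Compl_gint z0_Compl) auto
  also have "(deriv ^^ (n + 4)) (\<lambda>z. (wQ3 z - c * wQ2 z) + c ^ 2 / 2 * wzeta z) z0
      = (deriv ^^ (n + 4)) (\<lambda>z. wQ3 z - c * wQ2 z) z0 + (deriv ^^ (n + 4)) (\<lambda>z. c ^ 2 / 2 * wzeta z) z0"
    by (intro higher_deriv_add[where S = "- gint"] holomorphic_intros hol open_Compl_gint z0_Compl) auto
  also have "(deriv ^^ (n + 4)) (\<lambda>z. wQ3 z - c * wQ2 z) z0
      = (deriv ^^ (n + 4)) wQ3 z0 - (deriv ^^ (n + 4)) (\<lambda>z. c * wQ2 z) z0"
    by (intro higher_deriv_diff[where S = "- gint"] holomorphic_intros hol open_Compl_gint z0_Compl)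
  also have "(deriv ^^ (n + 4)) (\<lambda>z. c * wQ2 z) z0 = c * (deriv ^^ (n + 4)) wQ2 z0"
    by (intro higher_deriv_cmult[where A = "- gint"] hol open_Compl_gint z0_Compl)
  also have "(deriv ^^ (n + 4)) (\<lambda>z. c ^ 2 / 2 * wzeta z) z0 = c ^ 2 / 2 * (deriv ^^ (n + 4)) wzeta z0"
    by (intro higher_deriv_cmult[where A = "- gint"] hol open_Compl_gint z0_Compl) auto
  also have "(deriv ^^ (n + 4)) wzeta z0 = (- 1) ^ n * of_nat (fact (n + 4)) * eis (n + 5) z0"
  proof -
    have "n + 2 + 2 = n + 4" "n + 2 + 3 = n + 5" "(- 1 :: complex) ^ (n + 2) = (- 1) ^ n" by simp_all
    then show ?thesis using wzeta_higher_deriv[OF z0_notin_gint, of "n + 2"] by (simp only:)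
  qed
  also have "(deriv ^^ (n + 4)) wQ2 z0
      = of_real pi * ((- 1) ^ n * of_nat (fact (n + 4)) * eis1 (n + 5) z0)"
  proof -
    have "n + 1 + 3 = n + 4" "n + 1 + 4 = n + 5" "(- 1 :: complex) ^ Suc (n + 1) = (- 1) ^ n" by simp_all
    then show ?thesis using wQ2_higher_deriv[OF z0_notin_gint, of "n + 1"] by (simp only:)
  qed
  also note wQ3_higher_deriv[OF z0_notin_gint]
  finally show ?thesis by (simp add: c_def algebra_simps power2_eq_square)
qed

lemma eis_weight:
  assumes "3 \<le> k"
  shows "eis k z0 \<in> weight k"
proof (rule weight_cancel)
  have "(deriv ^^ (k - 3 + 2)) uz z0 \<in> weight (1 + (k - 3 + 2))"
    using homog_uz by (simp only: homog_def)
  moreover have "1 + (k - 3 + 2) = k" "k - 3 + 3 = k" using assms by auto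
  ultimately show "(- 1) ^ (k - 3) * of_nat (fact (k - 3 + 2)) * eis k z0 \<in> weight k"
    by (simp only: uz_higher_deriv)
qed (auto simp del: fact_Suc add_2_eq_Suc')

lemma eis1_weight:
  assumes "4 \<le> k"
  shows "of_real pi * (eis1 k z0 - cnj z0 * eis k z0) \<in> weight (k + 1)"
proof (rule weight_cancel)
  have "(deriv ^^ (k - 4 + 3)) uQ2 z0 \<in> weight (2 + (k - 4 + 3))"
    using homog_uQ2 by (simp only: homog_def)
  moreover have "2 + (k - 4 + 3) = k + 1" "k - 4 + 4 = k" using assms by auto
  ultimately show "(- 1) ^ Suc (k - 4) * of_nat (fact (k - 4 + 3))
      * (of_real pi * (eis1 k z0 - cnj z0 * eis k z0)) \<in> weight (k + 1)"
    by (simp only: uQ2_higher_deriv mult_ac)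
qed (auto simp del: fact_Suc add_2_eq_Suc')

lemma eis2_weight:
  assumes "5 \<le> k"
  shows "of_real pi ^ 2 * (eis2 k z0 - 2 * cnj z0 * eis1 k z0 + cnj z0 ^ 2 * eis k z0) \<in> weight (k + 2)"
proof (rule weight_cancel)
  have "(deriv ^^ (k - 5 + 4)) uQ3 z0 \<in> weight (3 + (k - 5 + 4))"
    using homog_uQ3 by (simp only: homog_def)
  moreover have "3 + (k - 5 + 4) = k + 2" "k - 5 + 5 = k" using assms by auto
  ultimately show "(- 1) ^ (k - 5) * of_nat (fact (k - 5 + 4)) / 2
      * (of_real pi ^ 2 * (eis2 k z0 - 2 * cnj z0 * eis1 k z0 + cnj z0 ^ 2 * eis k z0)) \<in> weight (k + 2)"
    by (simp only: uQ3_higher_deriv mult_ac)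
qed (auto simp del: fact_Suc add_2_eq_Suc')

section \<open>From the Barnes series to a lattice sum\<close>

text \<open>Numbers the nonzero integers as -1, 1, -2, 2, ..., which is the order of increasing |1 +
  4a| = 3, 5, 7, 9, ...; so index j belongs to the odd number 2j + 3.\<close>

definition zsign_index :: "int \<Rightarrow> nat" where
  "zsign_index a = nat (if a > 0 then 2 * a - 1 else - 2 * a - 2)"

definition zsign_value :: "nat \<Rightarrow> int" where
  "zsign_value j = (if odd j then (int j + 1) div 2 else - (int j div 2) - 1)"

lemma zsign_index_inverse: "a \<noteq> 0 \<Longrightarrow> zsign_value (zsign_index a) = a"
  by (auto simp: zsign_index_def zsign_value_def even_nat_iff)

lemma zsign_value_inverse: "zsign_index (zsign_value j) = j"
  by (auto simp: zsign_index_def zsign_value_def elim!: oddE evenE)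

lemma zsign_value_nonzero: "zsign_value j \<noteq> 0"
  by (auto simp: zsign_value_def elim!: oddE)

lemma zsign_value_pos_iff: "zsign_value j > 0 \<longleftrightarrow> odd j"
  by (auto simp: zsign_value_def elim!: oddE evenE)

lemma even_zsign_index: "a \<noteq> 0 \<Longrightarrow> even (zsign_index a) \<longleftrightarrow> \<not> a > 0"
  using zsign_value_pos_iff[of "zsign_index a"] by (simp add: zsign_index_inverse)

lemma zsign_index_facts:
  assumes "a \<noteq> 0"
  shows "int (2 * zsign_index a + 3) = sgn a * (1 + 4 * a)"
    and "int (zsign_index a div 2 + 1) = sgn a * a"
proof -
  have "int (2 * zsign_index a + 3) = sgn a * (1 + 4 * a) \<and> int (zsign_index a div 2 + 1) = sgn a * a"
  proof (cases "a > 0")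
    case True
    then have "zsign_index a = nat (2 * a - 1)" by (simp add: zsign_index_def)
    then show ?thesis using True by (auto simp: zdiv_int)
  next
    case False
    then have "zsign_index a = nat (- 2 * a - 2)" "a < 0" using assms by (auto simp: zsign_index_def)
    then show ?thesis by (auto simp: zdiv_int)
  qed
  then show "int (2 * zsign_index a + 3) = sgn a * (1 + 4 * a)"
    and "int (zsign_index a div 2 + 1) = sgn a * a" by blast+
qed

definition quad_term :: "nat \<Rightarrow> nat \<times> nat \<Rightarrow> complex" where
  "quad_term s = (\<lambda>(j, k). 1 / (of_nat (2 * j + 3) - \<i> * of_nat (2 * k + 3)) ^ s)"

definition barnes_lattice_sum :: "nat \<Rightarrow> complex" where
  "barnes_lattice_sum s = lattice_sum gint (\<lambda>l. cnj l ^ 2 - l ^ 2) s z0"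

definition pair_term :: "nat \<Rightarrow> int \<times> int \<Rightarrow> complex" where
  "pair_term s = (\<lambda>(a, b). of_int (a * b) / (of_int (1 + 4 * a) - \<i> * of_int (1 + 4 * b)) ^ s)"

lemma admissible_cnj_square_diff: "5 \<le> s \<Longrightarrow> admissible gint (\<lambda>l. cnj l ^ 2 - l ^ 2) s"
proof (rule admissible_mono[of _ _ 5])
  have "norm (cnj l ^ 2 - l ^ 2) * (1 + norm l) ^ 3 \<le> 2 * (1 + norm l) ^ 5" for l
  proof -
    have "norm (cnj l ^ 2 - l ^ 2) \<le> norm (cnj l ^ 2) + norm (l ^ 2)" by (rule norm_triangle_ineq4)
    also have "\<dots> = 2 * norm l ^ 2" by (simp add: norm_power)
    also have "\<dots> \<le> 2 * (1 + norm l) ^ 2" by (intro mult_left_mono power_mono) auto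
    finally have "norm (cnj l ^ 2 - l ^ 2) * (1 + norm l) ^ 3 \<le> (2 * (1 + norm l) ^ 2) * (1 + norm l) ^ 3"
      by (intro mult_right_mono) auto
    then show ?thesis by (simp add: mult.assoc flip: power_add)
  qed
  then show "admissible gint (\<lambda>l. cnj l ^ 2 - l ^ 2) 5" unfolding admissible_def by blast
qed

lemma pair_term_sums:
  assumes "5 \<le> s"
  shows "(pair_term s has_sum (barnes_lattice_sum s / (4 * \<i> * 4 ^ s))) UNIV"
    and "(\<lambda>x. norm (pair_term s x)) summable_on UNIV"
proof -
  define h where "h = (\<lambda>l. (cnj l ^ 2 - l ^ 2) / (z0 - l) ^ s)"
  \<comment> \<open>With l = -a + ib, z0 - l is a quarter of (1 + 4a) - i(1 + 4b), and cnj l^2 - l^2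
    = 4iab.\<close>
  define p where "p = (\<lambda>(a, b). Complex (of_int (- a)) (of_int b))"
  have bij: "bij_betw p UNIV gint"
    by (rule bij_betw_byWitness[where f' = "\<lambda>l. (- \<lfloor>Re l\<rfloor>, \<lfloor>Im l\<rfloor>)"])
       (auto simp: p_def gint_def complex_eq_iff)
  have hp: "h (p x) = 4 * \<i> * 4 ^ s * pair_term s x" for x
  proof -
    obtain a b where x: "x = (a, b)" by force
    have 1: "cnj (p x) ^ 2 - p x ^ 2 = 4 * \<i> * of_int (a * b)"
      by (simp add: x p_def complex_eq_iff power2_eq_square)
    have "z0 - p x = (of_int (1 + 4 * a) - \<i> * of_int (1 + 4 * b)) / 4"
      by (simp add: x p_def z0_def complex_eq_iff)
    then have 2: "(z0 - p x) ^ s = (of_int (1 + 4 * a) - \<i> * of_int (1 + 4 * b)) ^ s / 4 ^ s"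
      by (simp only: power_divide)
    show ?thesis unfolding h_def 1 2 by (simp add: x pair_term_def)
  qed
  then have eq: "pair_term s = (\<lambda>x. 1 / (4 * \<i> * 4 ^ s) * h (p x))" by auto
  note hs = lattice_sum_has_sum[OF admissible_cnj_square_diff[OF assms] z0_notin_gint]
  have "(h has_sum barnes_lattice_sum s) gint"
    using hs unfolding h_def barnes_lattice_sum_def .
  then have "((\<lambda>x. h (p x)) has_sum barnes_lattice_sum s) UNIV"
    by (subst has_sum_reindex_bij_betw[OF bij])
  then have "((\<lambda>x. 1 / (4 * \<i> * 4 ^ s) * h (p x)) has_sum 1 / (4 * \<i> * 4 ^ s) * barnes_lattice_sum s) UNIV"
    by (rule has_sum_cmult_right)
  then show "(pair_term s has_sum (barnes_lattice_sum s / (4 * \<i> * 4 ^ s))) UNIV"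
    unfolding eq by simp
  have "(\<lambda>l. norm (h l)) summable_on gint"
    unfolding h_def by (rule lattice_sum_abs_summable[OF admissible_cnj_square_diff[OF assms] z0_notin_gint])
  then have "(\<lambda>x. norm (h (p x))) summable_on UNIV"
    by (subst summable_on_reindex_bij_betw[OF bij])
  then have "(\<lambda>x. norm (1 / (4 * \<i> * 4 ^ s)) * norm (h (p x))) summable_on UNIV"
    by (rule summable_on_cmult_right)
  then show "(\<lambda>x. norm (pair_term s x)) summable_on UNIV"
    unfolding eq norm_mult .
qed

lemma ii_power_4m_minus_2:
  assumes "s mod 4 = 2"
  shows "\<i> ^ s = - 1"
proof -
  define q where "q = s div 4"
  have "s = 4 * q + 2" using assms div_mult_mod_eq[of s 4] unfolding q_def by linarith
  moreover have "\<i> ^ 4 = 1" by (simp add: eval_nat_numeral)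
  ultimately show ?thesis by (simp add: power_add power_mult)
qed

text \<open>The rotations by \<open>\<i>\<close> fold the plane onto the quadrant, on which the summands agree
  because \<open>\<i> ^ s = - 1\<close>.\<close>

definition quad_fold :: "int \<times> int \<Rightarrow> nat \<times> nat" where
  "quad_fold = (\<lambda>(a, b). if (a > 0) = (b > 0) then (zsign_index a, zsign_index b)
     else (zsign_index b, zsign_index a))"

lemma bij_betw_quad_fold: "bij_betw quad_fold {(a, b). a \<noteq> 0 \<and> b \<noteq> 0} UNIV"
  by (rule bij_betw_byWitness[where f' = "\<lambda>(j, k). if odd j = odd k then (zsign_value j, zsign_value k)
     else (zsign_value k, zsign_value j)"])
     (auto simp: quad_fold_def even_zsign_index zsign_index_inverse zsign_value_inverse
        zsign_value_nonzero zsign_value_pos_iff split: if_splits)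

text \<open>For equal signs of a and b the denominators differ by a sign, harmless as s is even, and
  |ab| = ab. For opposite signs they differ by i up to sign, and i^s = -1 turns |ab| into
  ab.\<close>

lemma quad_term_fold:
  assumes "s mod 4 = 2" "a \<noteq> 0" "b \<noteq> 0"
  shows "(case quad_fold (a, b) of (j, k) \<Rightarrow>
    of_nat ((j div 2 + 1) * (k div 2 + 1)) * quad_term s (j, k)) = pair_term s (a, b)"
proof -
  have ev: "even s" using assms(1) by presburger
  define w where "w = complex_of_int (1 + 4 * a) - \<i> * of_int (1 + 4 * b)"
  have n: "complex_of_nat n = of_int (int n)" for n by simp
  have t: "of_nat ((zsign_index x div 2 + 1) * (zsign_index y div 2 + 1)) * quad_term s (zsign_index x, zsign_index y)
      = of_int (sgn x * sgn y * (x * y)) / (of_int (sgn x * (1 + 4 * x)) - \<i> * of_int (sgn y * (1 + 4 * y))) ^ s"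
    if "x \<noteq> 0" "y \<noteq> 0" for x y
    unfolding quad_term_def prod.case n of_nat_mult zsign_index_facts[OF that(1)] zsign_index_facts[OF that(2)]
    by (simp add: mult_ac)
  show ?thesis
  proof (cases "(a > 0) = (b > 0)")
    case True
    then have sgn: "sgn b = sgn a" "sgn a * sgn a = 1" using assms by (auto simp: sgn_if)
    have "(of_int (sgn a * (1 + 4 * a)) - \<i> * of_int (sgn b * (1 + 4 * b))) ^ s = (of_int (sgn a) * w) ^ s"
      unfolding sgn w_def by (simp add: algebra_simps)
    also have "\<dots> = w ^ s" using ev assms(2) by (auto simp: sgn_if)
    finally show ?thesis
      using t[OF assms(2,3)] True sgn by (simp add: quad_fold_def pair_term_def w_def)
  next
    case False
    then have sgn: "sgn a = - sgn b" "sgn b * sgn b = 1" using assms by (auto simp: sgn_if)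
    have "of_int (sgn b * (1 + 4 * b)) - \<i> * of_int (sgn a * (1 + 4 * a)) = of_int (sgn b) * (\<i> * w)"
      unfolding sgn w_def by (simp add: algebra_simps)
    also have "(of_int (sgn b) * (\<i> * w)) ^ s = \<i> ^ s * w ^ s"
      using ev assms(3) by (auto simp: sgn_if power_mult_distrib)
    also have "\<dots> = - (w ^ s)" using ii_power_4m_minus_2[OF assms(1)] by simp
    finally have d: "(of_int (sgn b * (1 + 4 * b)) - \<i> * of_int (sgn a * (1 + 4 * a))) ^ s = - (w ^ s)" .
    have "sgn b * sgn a * (b * a) = - (a * b)" using sgn by simp
    then show ?thesis
      using t[OF assms(3,2)] False unfolding d
      by (simp add: quad_fold_def pair_term_def w_def del: of_int_mult)
  qed
qed

lemma quad_term_sums: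
  assumes "s mod 4 = 2" "5 \<le> s"
  defines "K \<equiv> \<lambda>(j, k). of_nat ((j div 2 + 1) * (k div 2 + 1)) * quad_term s (j, k)"
  shows "(K has_sum (barnes_lattice_sum s / (4 * \<i> * 4 ^ s))) UNIV"
    and "(\<lambda>x. norm (K x)) summable_on UNIV"
proof -
  let ?S = "{(a, b). a \<noteq> 0 \<and> b \<noteq> 0} :: (int \<times> int) set"
  have K: "K (quad_fold x) = pair_term s x" if "x \<in> ?S" for x
    using quad_term_fold[OF assms(1)] that by (auto simp: K_def)
  have 0: "pair_term s x = 0" if "x \<notin> ?S" for x
    using that by (auto simp: pair_term_def split: prod.splits)
  have "(pair_term s has_sum (barnes_lattice_sum s / (4 * \<i> * 4 ^ s))) ?S"
    using pair_term_sums(1)[OF assms(2)] 0 by (subst has_sum_cong_neutral[where T = UNIV]) auto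
  then have "((\<lambda>x. K (quad_fold x)) has_sum (barnes_lattice_sum s / (4 * \<i> * 4 ^ s))) ?S"
    using K by (subst has_sum_cong) auto
  then show "(K has_sum (barnes_lattice_sum s / (4 * \<i> * 4 ^ s))) UNIV"
    unfolding has_sum_reindex_bij_betw[OF bij_betw_quad_fold] .
  have "(\<lambda>x. norm (pair_term s x)) summable_on ?S"
    using pair_term_sums(2)[OF assms(2)] by (rule summable_on_subset_banach) auto
  then have "(\<lambda>x. norm (K (quad_fold x))) summable_on ?S"
    using K by (subst summable_on_cong) auto
  then show "(\<lambda>x. norm (K x)) summable_on UNIV"
    unfolding summable_on_reindex_bij_betw[OF bij_betw_quad_fold, of "\<lambda>x. norm (K x)"] .
qed

text \<open>The multiplicity is spread out as a finite fibre over (j, k): the admissible pairs (n1,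
  n2).\<close>

lemma quad_term_Sigma_has_sum:
  assumes "s mod 4 = 2" "5 \<le> s"
  shows "((\<lambda>(x, y). quad_term s x) has_sum (barnes_lattice_sum s / (4 * \<i> * 4 ^ s)))
    (Sigma UNIV (\<lambda>(j, k). {..j div 2} \<times> {..k div 2}))"
proof (rule has_sum_SigmaI)
  let ?B = "\<lambda>(j, k). {..j div 2} \<times> {..k div 2} :: (nat \<times> nat) set"
  have fin: "finite (?B x)" for x by (auto split: prod.splits)
  have K: "(\<lambda>(j, k). of_nat ((j div 2 + 1) * (k div 2 + 1)) * quad_term s (j, k)) x
      = (\<Sum>y\<in>?B x. quad_term s x)" for x
    by (auto split: prod.splits)
  show "((\<lambda>y. case (x, y) of (x, y) \<Rightarrow> quad_term s x) has_sum
      (\<lambda>(j, k). of_nat ((j div 2 + 1) * (k div 2 + 1)) * quad_term s (j, k)) x) (?B x)" for x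
    unfolding K using has_sum_finite[OF fin, of "\<lambda>_. quad_term s x"] by simp
  show "((\<lambda>(j, k). of_nat ((j div 2 + 1) * (k div 2 + 1)) * quad_term s (j, k)) has_sum
      (barnes_lattice_sum s / (4 * \<i> * 4 ^ s))) UNIV"
    by (rule quad_term_sums(1)[OF assms])
  have "(\<lambda>p. norm (case p of (x, y) \<Rightarrow> quad_term s x)) summable_on (Sigma UNIV ?B)"
  proof (rule summable_on_SigmaI)
    show "((\<lambda>y. norm (case (x, y) of (x, y) \<Rightarrow> quad_term s x)) has_sum
      norm ((\<lambda>(j, k). of_nat ((j div 2 + 1) * (k div 2 + 1)) * quad_term s (j, k)) x)) (?B x)" for x
    proof -
      have "norm ((\<lambda>(j, k). of_nat ((j div 2 + 1) * (k div 2 + 1)) * quad_term s (j, k)) x)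
          = (\<Sum>y\<in>?B x. norm (quad_term s x))"
        unfolding K by (simp add: norm_mult)
      then show ?thesis using has_sum_finite[OF fin, of "\<lambda>_. norm (quad_term s x)"] by simp
    qed
  qed (use quad_term_sums(2)[OF assms] in auto)
  then show "(\<lambda>(x, y). quad_term s x) summable_on Sigma UNIV ?B"
    by (rule Infinite_Sum.abs_summable_summable)
qed

text \<open>\<open>3 + n\<^sub>1 (2 + 2 \<i>) + n\<^sub>2 (2 - 2 \<i>) + n\<^sub>3 (1 + \<i>) + n\<^sub>4 (1 - \<i>)\<close> depends on
  \<open>j = 2 n\<^sub>1 + n\<^sub>3\<close> and \<open>k = 2 n\<^sub>2 + n\<^sub>4\<close> only; it is
  \<open>((2 j + 3) - \<i> (2 k + 3)) / (1 - \<i>)\<close>.\<close>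

lemma barnes_zeta_eq:
  assumes "s mod 4 = 2" "5 \<le> s"
  shows "barnes_zeta (of_nat s) 3 [2 + 2 * \<i>, 2 - 2 * \<i>, 1 + \<i>, 1 - \<i>]
    = (1 - \<i>) ^ s * (barnes_lattice_sum s / (4 * \<i> * 4 ^ s))"
proof -
  let ?as = "[2 + 2 * \<i>, 2 - 2 * \<i>, 1 + \<i>, 1 - \<i>]"
  let ?B = "\<lambda>(j, k). {..j div 2} \<times> {..k div 2} :: (nat \<times> nat) set"
  define f where "f = (\<lambda>ns. 1 / (3 + (\<Sum>j<length ?as. of_nat (ns ! j) * ?as ! j)) powr of_nat s)"
  \<comment> \<open>The fibre point (a, b) is (n1, n2); then n3 and n4 are forced. The bounds a
    \<le> j div 2 and b \<le> k div 2 keep the natural subtractions from truncating.\<close>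
  define tuple where "tuple = (\<lambda>((j, k), (a, b)). [a, b, j - 2 * a, k - 2 * b :: nat])"
  define untuple where
    "untuple = (\<lambda>ns :: nat list. ((2 * ns ! 0 + ns ! 2, 2 * ns ! 1 + ns ! 3), (ns ! 0, ns ! 1)))"
  have "((\<lambda>(x, y). (1 - \<i>) ^ s * quad_term s x) has_sum
      (1 - \<i>) ^ s * (barnes_lattice_sum s / (4 * \<i> * 4 ^ s))) (Sigma UNIV ?B)"
    using has_sum_cmult_right[OF quad_term_Sigma_has_sum[OF assms], of "(1 - \<i>) ^ s"]
    by (simp add: case_prod_unfold)
  also have "?this \<longleftrightarrow> (f has_sum (1 - \<i>) ^ s * (barnes_lattice_sum s / (4 * \<i> * 4 ^ s)))
      {ns. length ns = length ?as}"
  proof (rule has_sum_reindex_bij_witness[where j = tuple and i = untuple])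
    fix x assume x: "x \<in> Sigma UNIV ?B"
    then obtain j k a b where x_eq: "x = ((j, k), (a, b))" and ab: "2 * a \<le> j" "2 * b \<le> k"
      by auto
    define c d where "c = j - 2 * a" and "d = k - 2 * b"
    have jk: "j = 2 * a + c" "k = 2 * b + d" using ab by (auto simp: c_def d_def)
    define w where "w = 3 + (\<Sum>i<length ?as. of_nat ([a, b, c, d] ! i) * ?as ! i)"
    define q where "q = complex_of_nat (2 * j + 3) - \<i> * of_nat (2 * k + 3)"
    have w: "w = 3 + (of_nat a * (2 + 2 * \<i>) + of_nat b * (2 - 2 * \<i>) + of_nat c * (1 + \<i>) + of_nat d * (1 - \<i>))"
      by (simp add: w_def eval_nat_numeral)
    have q: "q = (1 - \<i>) * w"
      unfolding w by (simp add: q_def jk algebra_simps)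
    have "q \<noteq> 0" by (simp add: q_def complex_eq_iff)
    then have "w \<noteq> 0" using q by auto
    then have "f [a, b, c, d] = 1 / w ^ s"
      unfolding f_def w_def[symmetric] by (simp add: powr_nat')
    also have "\<dots> = (1 - \<i>) ^ s * (1 / q ^ s)"
      using \<open>q \<noteq> 0\<close> unfolding q by (simp add: power_mult_distrib)
    finally show "f (tuple x) = (case x of (x, y) \<Rightarrow> (1 - \<i>) ^ s * quad_term s x)"
      by (simp add: x_eq tuple_def quad_term_def q_def c_def d_def)
    show "untuple (tuple x) = x"
      using ab by (simp add: x_eq tuple_def untuple_def)
    show "tuple x \<in> {ns. length ns = length ?as}"
      by (simp add: x_eq tuple_def)
  next
    fix ns :: "nat list" assume "ns \<in> {ns. length ns = length ?as}"
    then obtain a b c d where "ns = [a, b, c, d]" by (auto simp: length_Suc_conv)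
    then show "tuple (untuple ns) = ns" "untuple ns \<in> Sigma UNIV ?B"
      by (auto simp: tuple_def untuple_def)
  qed simp
  finally show ?thesis
    unfolding barnes_zeta_def f_def by (rule infsumI)
qed

text \<open>Conjugating and exchanging j with k multiplies the base by i, so every term changes by
  i^s = -1.\<close>

lemma quad_sum_imaginary:
  assumes "s mod 4 = 2" "5 \<le> s"
  shows "cnj (barnes_lattice_sum s / (4 * \<i> * 4 ^ s)) = - (barnes_lattice_sum s / (4 * \<i> * 4 ^ s))"
proof -
  define K where "K = (\<lambda>(j, k). of_nat ((j div 2 + 1) * (k div 2 + 1)) * quad_term s (j, k))"
  define B where "B = barnes_lattice_sum s / (4 * \<i> * 4 ^ s)"
  have K: "(K has_sum B) UNIV"
    unfolding K_def B_def by (rule quad_term_sums(1)[OF assms])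
  have eq: "cnj (K (prod.swap x)) = - 1 * K x" for x
  proof -
    obtain j k where x: "x = (j, k)" by force
    have "of_nat (2 * k + 3) + \<i> * of_nat (2 * j + 3) = \<i> * (of_nat (2 * j + 3) - \<i> * of_nat (2 * k + 3))"
      by (simp add: algebra_simps)
    then have pw: "(of_nat (2 * k + 3) + \<i> * of_nat (2 * j + 3)) ^ s
        = - ((of_nat (2 * j + 3) - \<i> * of_nat (2 * k + 3)) ^ s)"
      using ii_power_4m_minus_2[OF assms(1)] by (simp only: power_mult_distrib) simp
    have "cnj (K (prod.swap x)) = of_nat ((j div 2 + 1) * (k div 2 + 1))
        / (of_nat (2 * k + 3) + \<i> * of_nat (2 * j + 3)) ^ s"
      by (simp add: x K_def quad_term_def mult.commute del: of_nat_mult of_nat_add of_nat_Suc)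
    also have "\<dots> = - 1 * K x"
      unfolding pw by (simp add: x K_def quad_term_def del: of_nat_mult of_nat_add of_nat_Suc)
    finally show ?thesis .
  qed
  have "((\<lambda>x. cnj (K x)) has_sum cnj B) UNIV" using K by simp
  then have "((\<lambda>x. cnj (K (prod.swap x))) has_sum cnj B) UNIV"
    by (subst has_sum_reindex_bij_betw[OF bij_swap, of "\<lambda>x. cnj (K x)"])
  moreover have "((\<lambda>x. - 1 * K x) has_sum - 1 * B) UNIV" using K by (rule has_sum_cmult_right)
  ultimately have "cnj B = - 1 * B" unfolding eq by (rule has_sum_unique)
  then show ?thesis by (simp add: B_def)
qed

text \<open>(1 - i)^s is also purely imaginary, since 1 + i = i(1 - i) and i^s = -1; so the product
  is real.\<close>

lemma barnes_zeta_real: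
  assumes "s mod 4 = 2" "5 \<le> s"
  shows "barnes_zeta (of_nat s) 3 [2 + 2 * \<i>, 2 - 2 * \<i>, 1 + \<i>, 1 - \<i>] \<in> \<real>"
proof -
  have "1 + \<i> = \<i> * (1 - \<i>)" by (simp add: algebra_simps)
  then have "cnj ((1 - \<i>) ^ s) = - ((1 - \<i>) ^ s)"
    using ii_power_4m_minus_2[OF assms(1)] by (simp add: power_mult_distrib)
  then show ?thesis
    unfolding barnes_zeta_eq[OF assms] Reals_cnj_iff complex_cnj_mult quad_sum_imaginary[OF assms] by simp
qed

section \<open>Splitting into five weights\<close>

lemma barnes_lattice_sum_expand:
  assumes "5 \<le> s"
  shows "barnes_lattice_sum s =
    (eis2 s z0 - 2 * cnj z0 * eis1 s z0 + cnj z0 ^ 2 * eis s z0)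
    + 2 * cnj z0 * (eis1 s z0 - cnj z0 * eis s z0)
    + (cnj z0 ^ 2 - z0 ^ 2) * eis s z0 + 2 * z0 * eis (s - 1) z0 - eis (s - 2) z0"
proof -
  note hs = lattice_sum_has_sum[OF _ z0_notin_gint]
  have "((\<lambda>l. cnj l ^ 2 / (z0 - l) ^ s + (- (z0 ^ 2) * (1 / (z0 - l) ^ s)
      + 2 * z0 * (1 / (z0 - l) ^ (s - 1)) + - 1 * (1 / (z0 - l) ^ (s - 2)))) has_sum
      (eis2 s z0 + (- (z0 ^ 2) * eis s z0 + 2 * z0 * eis (s - 1) z0 + - 1 * eis (s - 2) z0))) gint"
    using assms
    by (intro has_sum_add has_sum_cmult_right hs admissible_cnj_power admissible_gint_1) auto
  also have "?this \<longleftrightarrow> ((\<lambda>l. (cnj l ^ 2 - l ^ 2) / (z0 - l) ^ s) has_sum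
      (eis2 s z0 + (- (z0 ^ 2) * eis s z0 + 2 * z0 * eis (s - 1) z0 + - 1 * eis (s - 2) z0))) gint"
  proof (rule has_sum_cong)
    fix l assume "l \<in> gint"
    define w where "w = z0 - l"
    have w: "w \<noteq> 0" using \<open>l \<in> gint\<close> z0_notin_gint by (auto simp: w_def)
    have "s = (s - 2) + 2" "s - 1 = Suc (s - 2)" using assms by linarith+
    then have pw: "w ^ s = w ^ (s - 2) * w ^ 2" "w ^ (s - 1) = w ^ (s - 2) * w"
      by (metis power_add, metis power_Suc2)
    \<comment> \<open>Expressing l^2 through w = z0 - l lowers the exponent and produces the sums of
      order s, s-1 and s-2.\<close>
    have l: "l = z0 - w" by (simp add: w_def)
    have l2: "l ^ 2 = z0 ^ 2 - 2 * z0 * w + w ^ 2"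
      unfolding l by (simp add: power2_eq_square algebra_simps)
    show "cnj l ^ 2 / (z0 - l) ^ s + (- (z0 ^ 2) * (1 / (z0 - l) ^ s)
      + 2 * z0 * (1 / (z0 - l) ^ (s - 1)) + - 1 * (1 / (z0 - l) ^ (s - 2)))
      = (cnj l ^ 2 - l ^ 2) / (z0 - l) ^ s"
      unfolding w_def[symmetric] pw l2 using w by (simp add: field_simps power2_eq_square)
  qed
  finally have "barnes_lattice_sum s =
      eis2 s z0 + (- (z0 ^ 2) * eis s z0 + 2 * z0 * eis (s - 1) z0 + - 1 * eis (s - 2) z0)"
    unfolding barnes_lattice_sum_def lattice_sum_def[of gint "\<lambda>l. cnj l ^ 2 - l ^ 2"]
    by (rule infsumI)
  then show ?thesis by (simp add: algebra_simps power2_eq_square)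
qed

lemma barnes_lattice_sum_weights:
  assumes "5 \<le> s"
  obtains c1 c2 c3 c4 c5 where "c1 \<in> gauss_rat" "c2 \<in> gauss_rat" "c3 \<in> gauss_rat"
    "c4 \<in> gauss_rat" "c5 \<in> gauss_rat"
    "barnes_lattice_sum s = c1 * of_real (sqrt re ^ (s - 2)) + c2 * of_real (sqrt re ^ (s - 1))
       + c3 * of_real (sqrt re ^ s) + c4 * of_real (sqrt re ^ (s + 1) / pi)
       + c5 * of_real (sqrt re ^ (s + 2) / pi ^ 2)"
proof -
  define d where "d = complex_of_real (sqrt re)"
  have ge: "3 \<le> s - 2" "3 \<le> s - 1" "3 \<le> s" "4 \<le> s" "5 \<le> s" using assms by linarith+
  have w: "\<exists>c\<in>gauss_rat. z = c * d ^ n" if "z \<in> weight n" for z n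
    using that by (auto simp: weight_def d_def)
  obtain a1 where a1: "a1 \<in> gauss_rat" "eis (s - 2) z0 = a1 * d ^ (s - 2)"
    using w[OF eis_weight, of "s - 2"] ge by blast
  obtain a2 where a2: "a2 \<in> gauss_rat" "eis (s - 1) z0 = a2 * d ^ (s - 1)"
    using w[OF eis_weight, of "s - 1"] ge by blast
  obtain a3 where a3: "a3 \<in> gauss_rat" "eis s z0 = a3 * d ^ s"
    using w[OF eis_weight, of s] ge by blast
  obtain a4 where a4: "a4 \<in> gauss_rat"
    "of_real pi * (eis1 s z0 - cnj z0 * eis s z0) = a4 * d ^ (s + 1)"
    using w[OF eis1_weight, of s] ge by blast
  obtain a5 where a5: "a5 \<in> gauss_rat"
    "of_real pi ^ 2 * (eis2 s z0 - 2 * cnj z0 * eis1 s z0 + cnj z0 ^ 2 * eis s z0) = a5 * d ^ (s + 2)"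
    using w[OF eis2_weight, of s] ge by blast
  have 4: "eis1 s z0 - cnj z0 * eis s z0 = a4 * d ^ (s + 1) / of_real pi"
    unfolding a4(2)[symmetric] by simp
  have 5: "eis2 s z0 - 2 * cnj z0 * eis1 s z0 + cnj z0 ^ 2 * eis s z0 = a5 * d ^ (s + 2) / of_real pi ^ 2"
    unfolding a5(2)[symmetric] by simp
  show ?thesis
  proof
    show "- a1 \<in> gauss_rat" "2 * z0 * a2 \<in> gauss_rat" "(cnj z0 ^ 2 - z0 ^ 2) * a3 \<in> gauss_rat"
      "2 * cnj z0 * a4 \<in> gauss_rat" "a5 \<in> gauss_rat"
      using a1(1) a2(1) a3(1) a4(1) a5(1) z0_in_gauss_rat by auto
    show "barnes_lattice_sum s = - a1 * of_real (sqrt re ^ (s - 2)) + 2 * z0 * a2 * of_real (sqrt re ^ (s - 1))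
       + (cnj z0 ^ 2 - z0 ^ 2) * a3 * of_real (sqrt re ^ s) + 2 * cnj z0 * a4 * of_real (sqrt re ^ (s + 1) / pi)
       + a5 * of_real (sqrt re ^ (s + 2) / pi ^ 2)"
      unfolding barnes_lattice_sum_expand[OF assms] 4 5
      unfolding a1(2) a2(2) a3(2) of_real_divide of_real_power
        d_def[symmetric]
      by simp
  qed
qed

section \<open>Conversion to Gamma values and conclusion\<close>

lemma sqrt_re_power: "sqrt re ^ n = (Gamma (1/4) ^ (2 * n) / (2 * sqrt 2) ^ n) * pi powr (- real n / 2)"
proof -
  have G: "Gamma (1/4 :: real) > 0" by (rule Gamma_real_pos) simp
  have "re = (Gamma (1/4) ^ 2 / (2 * sqrt 2) * pi powr (- 1 / 2)) ^ 2"
  proof -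
    have "(pi powr (- 1 / 2)) ^ 2 = 1 / pi"
      by (simp add: powr_minus_divide powr_half_sqrt power_divide)
    then show ?thesis
      by (simp add: re_eq power_mult_distrib power_divide flip: power_mult)
  qed
  then have "sqrt re = Gamma (1/4) ^ 2 / (2 * sqrt 2) * pi powr (- 1 / 2)"
    using G by (intro real_sqrt_unique) auto
  then have "sqrt re ^ n = (Gamma (1/4) ^ 2 / (2 * sqrt 2)) ^ n * (pi powr (- 1 / 2)) ^ n"
    by (simp only: power_mult_distrib)
  also have "(pi powr (- 1 / 2)) ^ n = pi powr (- real n / 2)"
    by (simp add: powr_powr flip: powr_realpow)
  finally show ?thesis by (simp add: power_divide flip: power_mult)
qed

lemma two_sqrt_two_power: "(2 * sqrt 2) ^ (2 * n) = (8 :: real) ^ n"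
  by (simp add: power_mult power_mult_distrib)

lemma sqrt_re_power_even:
  "sqrt re ^ (2 * n) / pi ^ k = 1 / 8 ^ n * (Gamma (1/4) ^ (4 * n) / pi powr (real n + real k))"
  unfolding sqrt_re_power two_sqrt_two_power
  by (simp add: powr_add powr_minus powr_realpow field_simps)

lemma sqrt_re_power_odd:
  "sqrt re ^ (2 * n + 1) / pi ^ k
    = 1 / (2 * 8 ^ n) / sqrt 2 * (Gamma (1/4) ^ (4 * n + 2) / pi powr (real n + 1/2 + real k))"
proof -
  have "pi powr (- real (2 * n + 1) / 2) = 1 / pi powr (real n + 1/2)"
  proof -
    have "- real (2 * n + 1) / 2 = - (real n + 1/2)" by (simp add: field_simps)
    then show ?thesis by (simp only: powr_minus_divide)
  qed
  then show ?thesis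
    unfolding sqrt_re_power power_add[of "2 * sqrt 2"] two_sqrt_two_power
    by (simp add: powr_add powr_realpow)
qed

theorem theorem6p2:
  fixes m :: nat
  assumes "m > 1"
  shows "\<exists>r1 r2 r3 r4 r5 :: rat.
    Gamma (4 * of_nat m - 2) *
      barnes_zeta (4 * of_nat m - 2) 3 [2 + 2 * \<i>, 2 - 2 * \<i>, 1 + \<i>, 1 - \<i>] =
    complex_of_real
      (of_rat r1 * (Gamma (1/4) ^ (8 * m - 8) / pi powr (2 * real m - 2))
       + of_rat r2 / sqrt 2 * (Gamma (1/4) ^ (8 * m - 6) / pi powr (2 * real m - 3/2))
       + of_rat r3 * (Gamma (1/4) ^ (8 * m - 4) / pi powr (2 * real m - 1))
       + of_rat r4 / sqrt 2 * (Gamma (1/4) ^ (8 * m - 2) / pi powr (2 * real m + 1/2))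
       + of_rat r5 * (Gamma (1/4) ^ (8 * m) / pi powr (2 * real m + 2)))"
proof -
  define s where "s = 4 * m - 2"
  have s: "5 \<le> s" using assms by (simp add: s_def)
  have "s = 4 * (m - 1) + 2" using assms by (simp add: s_def)
  moreover have "(4 * k + 2) mod 4 = (2 :: nat)" for k by presburger
  ultimately have smod: "s mod 4 = 2" by simp
  have of_s: "(4 * of_nat m - 2 :: complex) = of_nat s"
    using assms by (simp add: s_def of_nat_diff)
  define B where "B = barnes_zeta (of_nat s) 3 [2 + 2 * \<i>, 2 - 2 * \<i>, 1 + \<i>, 1 - \<i>]"
  have "Gamma (of_nat s :: complex) = fact (s - 1)"
    using s Gamma_fact[of "s - 1", where 'a = complex] by (simp add: of_nat_diff)
  then have LHS: "Gamma (4 * of_nat m - 2)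
      * barnes_zeta (4 * of_nat m - 2) 3 [2 + 2 * \<i>, 2 - 2 * \<i>, 1 + \<i>, 1 - \<i>] = fact (s - 1) * B"
    unfolding of_s B_def by simp
  \<comment> \<open>\<open>C\<close> collects the factors between the left-hand side and
    \<open>barnes_lattice_sum\<close>; the Gamma value is a factorial, so \<open>C\<close> lies in
    Q(i).\<close>
  define C where "C = fact (s - 1) * ((1 - \<i>) ^ s / (4 * \<i> * 4 ^ s))"
  have C: "C \<in> gauss_rat" by (auto simp: C_def)
  obtain c1 c2 c3 c4 c5 where c: "c1 \<in> gauss_rat" "c2 \<in> gauss_rat" "c3 \<in> gauss_rat"
    "c4 \<in> gauss_rat" "c5 \<in> gauss_rat" and T:
    "barnes_lattice_sum s = c1 * of_real (sqrt re ^ (s - 2)) + c2 * of_real (sqrt re ^ (s - 1))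
       + c3 * of_real (sqrt re ^ s) + c4 * of_real (sqrt re ^ (s + 1) / pi)
       + c5 * of_real (sqrt re ^ (s + 2) / pi ^ 2)"
    by (rule barnes_lattice_sum_weights[OF s])
  have eq: "fact (s - 1) * B = (C * c1) * of_real (sqrt re ^ (s - 2)) + (C * c2) * of_real (sqrt re ^ (s - 1))
       + (C * c3) * of_real (sqrt re ^ s) + (C * c4) * of_real (sqrt re ^ (s + 1) / pi)
       + (C * c5) * of_real (sqrt re ^ (s + 2) / pi ^ 2)"
  proof -
    have "fact (s - 1) * B = C * barnes_lattice_sum s"
      unfolding B_def barnes_zeta_eq[OF smod s] C_def by simp
    then show ?thesis unfolding T by (simp only: distrib_left mult.assoc)
  qed
  have rat: "\<exists>r. Re (C * c) = of_rat r" if "c \<in> gauss_rat" for c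
  proof -
    have "C * c \<in> gauss_rat" using C that by auto
    then show ?thesis by (auto simp: gauss_rat_def elim: Rats_cases)
  qed
  obtain q1 q2 q3 q4 q5 :: rat where q: "Re (C * c1) = of_rat q1" "Re (C * c2) = of_rat q2"
    "Re (C * c3) = of_rat q3" "Re (C * c4) = of_rat q4" "Re (C * c5) = of_rat q5"
    using rat c by metis
  have Re_mult: "Re (a * of_real x) = Re a * x" for a x by simp
  \<comment> \<open>So far the five coefficients are only in Q(i). As the total and the five
    accompanying factors are real, each coefficient may be replaced by its real part.\<close>
  have "B \<in> \<real>" unfolding B_def by (rule barnes_zeta_real[OF smod s])
  then have "fact (s - 1) * B \<in> \<real>" by (intro Reals_mult) (auto simp: fact_in_Reals)
  then have "fact (s - 1) * B = of_real (Re (fact (s - 1) * B))" by (rule of_real_Re[symmetric])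
  also have "Re (fact (s - 1) * B) = of_rat q1 * sqrt re ^ (s - 2) + of_rat q2 * sqrt re ^ (s - 1)
       + of_rat q3 * sqrt re ^ s + of_rat q4 * (sqrt re ^ (s + 1) / pi)
       + of_rat q5 * (sqrt re ^ (s + 2) / pi ^ 2)"
    unfolding eq plus_complex.sel Re_mult q ..
  also have "sqrt re ^ (s - 2) = 1 / 8 ^ (2 * m - 2) * (Gamma (1/4) ^ (8 * m - 8) / pi powr (2 * real m - 2))"
    using sqrt_re_power_even[of "2 * m - 2" 0] assms
    by (simp add: s_def of_nat_diff diff_mult_distrib2)
  \<comment> \<open>For an odd power one factor 2 sqrt 2 stays outside the powers of 8, whence
    1/sqrt 2.\<close>
  also have "sqrt re ^ (s - 1) = 1 / (2 * 8 ^ (2 * m - 2)) / sqrt 2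
      * (Gamma (1/4) ^ (8 * m - 6) / pi powr (2 * real m - 3/2))"
  proof -
    have "s - 1 = 2 * (2 * m - 2) + 1" "8 * m - 6 = 4 * (2 * m - 2) + 2"
      "2 * real m - 3/2 = real (2 * m - 2) + 1/2 + real 0"
      using assms by (auto simp: s_def of_nat_diff)
    then show ?thesis using sqrt_re_power_odd[of "2 * m - 2" 0] by (simp only: power_0 div_by_1)
  qed
  also have "sqrt re ^ s = 1 / 8 ^ (2 * m - 1) * (Gamma (1/4) ^ (8 * m - 4) / pi powr (2 * real m - 1))"
    using sqrt_re_power_even[of "2 * m - 1" 0] assms
    by (simp add: s_def of_nat_diff diff_mult_distrib2)
  also have "sqrt re ^ (s + 1) / pi = 1 / (2 * 8 ^ (2 * m - 1)) / sqrt 2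
      * (Gamma (1/4) ^ (8 * m - 2) / pi powr (2 * real m + 1/2))"
  proof -
    have "s + 1 = 2 * (2 * m - 1) + 1" "8 * m - 2 = 4 * (2 * m - 1) + 2"
      "2 * real m + 1/2 = real (2 * m - 1) + 1/2 + real 1"
      using assms by (auto simp: s_def of_nat_diff)
    then show ?thesis using sqrt_re_power_odd[of "2 * m - 1" 1] by (simp only: power_one_right)
  qed
  also have "sqrt re ^ (s + 2) / pi ^ 2 = 1 / 8 ^ (2 * m) * (Gamma (1/4) ^ (8 * m) / pi powr (2 * real m + 2))"
  proof -
    have "s + 2 = 2 * (2 * m)" using assms by (simp add: s_def)
    then show ?thesis using sqrt_re_power_even[of "2 * m" 2] by simp
  qed
  finally have "fact (s - 1) * B = complex_of_real
      (of_rat (q1 / 8 ^ (2 * m - 2)) * (Gamma (1/4) ^ (8 * m - 8) / pi powr (2 * real m - 2))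
       + of_rat (q2 / (2 * 8 ^ (2 * m - 2))) / sqrt 2 * (Gamma (1/4) ^ (8 * m - 6) / pi powr (2 * real m - 3/2))
       + of_rat (q3 / 8 ^ (2 * m - 1)) * (Gamma (1/4) ^ (8 * m - 4) / pi powr (2 * real m - 1))
       + of_rat (q4 / (2 * 8 ^ (2 * m - 1))) / sqrt 2 * (Gamma (1/4) ^ (8 * m - 2) / pi powr (2 * real m + 1/2))
       + of_rat (q5 / 8 ^ (2 * m)) * (Gamma (1/4) ^ (8 * m) / pi powr (2 * real m + 2)))"
    by (simp add: of_rat_divide of_rat_mult of_rat_power)
  then show ?thesis unfolding LHS by blast
qed

end
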